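(* Let $G$ be a nonempty finite simple ordered graph. Then the derangement basis associated to $G$, i.e. the set $\{\phi_G(w) : w\in \mathcal{D}(G)\}$, is a basis of the $\mathbb{F}_2$-vector space $H_{|G|-1}(\Delta(G))$.
   Context: **Ordered graphs and edge operations.** An ordered graph is a finite simple graph $G$ together with a linear order on its vertex set $V(G)$; $|G|$ is the number of vertices. If the maximal vertex $t$ of $G$ is not isolated, the maximal edge of $G$ is $e=\{s,t\}$, where $s$ is the maximal vertex adjacent to $t$. For $e=\{s,t\}$ with $s<t$: - Deletion: $G-e$ is $G$ with the edge $e$ removed (same vertices, same order). A permutation of $V(G-e)$ is a permutation of $V(G)$. - Simple contraction: $G/e$ is obtained by contracting $e$ to a single vertex $x$ and removing loops and redundant (multiple) edges; $x$ takes the place of $s$ in the order. For a permutation $w$ of $V(G/e)$, $w_{st}$ denotes the permutation of $V(G)$ obtained by writing $w$ in cycle notation and replacing $x$ by the two consecutive letters $s\,t$ in its cycle. - Extraction: $G-[e]$ is obtained by removing $e$ and its two incident vertices $s,t$ (restricted order). For a permutation $w$ of $V(G-[e])$, $w\sqcup(st)$ is the permutation of $V(G)$ equal to $w$ on $V(G)\setminus\{s,t\}$ and exchanging $s$ and $t$. **The set $\mathcal{D}(G)$.** For a nonempty ordered graph $G$ with maximal vertex $t$, the set $\mathcal{D}(G)$ of permutations of $V(G)$ (all of which are derangements, i.e. have no fixed points) is defined recursively: - If $V(G)=\{s,t\}$ and $s,t$ are adjacent, then $\mathcal{D}(G)=\{(st)\}$. - If $t$ is isolated, then $\mathcal{D}(G)=\emptyset$.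 - If $t$ is not isolated, $|G|\ge 3$, and $e=\{s,t\}$ is the maximal edge, then $$\mathcal{D}(G)=\mathcal{D}(G-e)\cup\{w_{st}: w\in\mathcal{D}(G/e)\}\cup\{w\sqcup(st): w\in\mathcal{D}(G-[e])\}.$$ **Boolean complex and homology.** Let $\mathbb{W}(G)$ be the set of words in letters from $V(G)$ without repeated letters. Let $\sim$ be the equivalence relation on $\mathbb{W}(G)$ generated by exchanging two consecutive letters $s,t$ of a word whenever $s$ and $t$ are not adjacent in $G$. Let $\mathbb{B}(G)=\mathbb{W}(G)/\sim$, partially ordered by the order induced from subword inclusion and ranked so that words of length $k+1$ have rank $k$; $\mathbb{B}_k(G)$ is the set of elements of rank $k$ (so $\mathbb{B}_{-1}(G)$ consists of the empty word). $\Delta(G)$, the boolean complex of $G$, is the regular cell complex with face poset $\mathbb{B}(G)$. $C_k(\Delta(G))$ is the $\mathbb{F}_2$-vector space with basis $\mathbb{B}_k(G)$. For $v\in V(G)$, the linear map $\partial_v: C_{|G|-1}(\Delta(G))\to C_{|G|-2}(\Delta(G))$ sends (the class of) a word using all vertices to (the class of) the word obtained by deleting $v$, and $\partial=\sum_{v\in V(G)}\partial_v$. The (reduced, $\mathbb{F}_2$-coefficient) top homology is $H_{|G|-1}(\Delta(G))=\ker\big(\partial: C_{|G|-1}(\Delta(G))\to C_{|G|-2}(\Delta(G))\big)$. **The map $\phi$.** For a finite linearly ordered set $V$, let $K_V$ be the complete graph on $V$; thus $\mathbb{B}(K_V)$ is the set of all words without repeated letters. Word concatenation (set to $0$ if the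 two words share a letter), extended bilinearly, gives an associative product on $C_*(\Delta(K_V))$; put $(a\diamond b)=ab+ba$. Given a derangement $w$ of $V$, write it in standard cycle form: each cycle is written with its minimum element first, and cycles are arranged from left to right in increasing order of their minimum elements. Define $\phi_{K_V}(w)\in C_{|V|-1}(\Delta(K_V))$ as follows. Insert a symbol $\star$ between each pair of consecutive letters in each cycle. Repeatedly, among the remaining symbols $\star$, take the one whose immediate right-hand neighbouring letter in the standard cycle form of $w$ is largest; if it occurs as $Q\star R$, where $Q$ and $R$ are the quantities (letters or already formed $\diamond$-expressions) on its two sides, replace $Q\star R$ by $(Q\diamond R)$. When no $\star$ remains, each cycle has become one element, and $\phi_{K_V}(w)$ is the concatenation product of these elements from left to right. (For example, $\phi((134)(26)(587))=(1\diamond(3\diamond 4))\,(2\diamond 6)\,((5\diamond 8)\diamond 7)$.) The element $\phi_{K_V}(w)$ lies in $H_{|V|-1}(\Delta(K_V))$. For an ordered graph $G$ with $V=V(G)$, let ${\pi_G}_*: C_*(\Delta(K_V))\to C_*(\Delta(G))$ be the linear map sending a word to its class in $\mathbb{B}(G)$; it is a chain map, hence induces ${\pi_G}_*: H_{|G|-1}(\Delta(K_V))\to H_{|G|-1}(\Delta(G))$. For $w\in\mathcal{D}(G)$, $\phi_G(w)={\pi_G}_*(\phi_{K_V}(w))$. *)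

theory Defs
  imports
    Complex_Main
    "HOL-Library.Z2"
    "HOL-Library.Poly_Mapping"
    "HOL-Combinatorics.Cycles"
    "HOL-Combinatorics.Orbits"
begin

section \<open>Ordered graphs and edge operations\<close>

text \<open>
  The order on the vertices is the one of the type class \<^class>\<open>linorder\<close>,
  restricted to the vertex set.
\<close>

record 'a graph =
  verts :: "'a set"
  edges :: "'a set set"

definition ordered_graph :: "'a::linorder graph \<Rightarrow> bool" where
  "ordered_graph G \<longleftrightarrow>
     finite (verts G) \<and> (\<forall>e\<in>edges G. e \<subseteq> verts G \<and> card e = 2)"

definition complete_graph :: "'a set \<Rightarrow> 'a graph" where
  "complete_graph V = \<lparr>verts = V, edges = {e. e \<subseteq> V \<and> card e = 2}\<rparr>"

definition neighbours :: "'a graph \<Rightarrow> 'a \<Rightarrow> 'a set" where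
  "neighbours G v = {u \<in> verts G. {u, v} \<in> edges G}"

definition max_vertex :: "'a::linorder graph \<Rightarrow> 'a" where
  "max_vertex G = Max (verts G)"

text \<open>The maximal edge joins the following vertex to \<^const>\<open>max_vertex\<close>.\<close>

definition max_neighbour :: "'a::linorder graph \<Rightarrow> 'a" where
  "max_neighbour G = Max (neighbours G (max_vertex G))"

definition deletion :: "'a graph \<Rightarrow> 'a \<Rightarrow> 'a \<Rightarrow> 'a graph" where
  "deletion G s t = \<lparr>verts = verts G, edges = edges G - {{s, t}}\<rparr>"

text \<open>
  The vertex obtained by contracting the edge \<open>{s, t}\<close> takes the place of \<open>s\<close> in the order, so
  it is again called \<open>s\<close>. Removing \<open>{s}\<close> removes the loop; multiple edges are identified since
  the edges form a set.
\<close>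

definition contraction :: "'a graph \<Rightarrow> 'a \<Rightarrow> 'a \<Rightarrow> 'a graph" where
  "contraction G s t =
     \<lparr>verts = verts G - {t},
      edges = (\<lambda>f. (\<lambda>u. if u = t then s else u) ` f) ` edges G - {{s}}\<rparr>"

definition extraction :: "'a graph \<Rightarrow> 'a \<Rightarrow> 'a \<Rightarrow> 'a graph" where
  "extraction G s t =
     \<lparr>verts = verts G - {s, t}, edges = {f \<in> edges G. f \<inter> {s, t} = {}}\<rparr>"

lemma ordered_graph_deletion: "ordered_graph G \<Longrightarrow> ordered_graph (deletion G s t)"
  by (auto simp: ordered_graph_def deletion_def)

lemma ordered_graph_extraction: "ordered_graph G \<Longrightarrow> ordered_graph (extraction G s t)"
  by (auto simp: ordered_graph_def extraction_def)

lemma ordered_graph_contraction: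
  assumes "ordered_graph G" "{s, t} \<in> edges G"
  shows "ordered_graph (contraction G s t)"
proof -
  have st: "s \<noteq> t" "s \<in> verts G" "t \<in> verts G"
    using assms by (auto simp: ordered_graph_def)
  have "(\<lambda>u. if u = t then s else u) ` f \<subseteq> verts G - {t} \<and>
        card ((\<lambda>u. if u = t then s else u) ` f) = 2"
    if "f \<in> edges G" "(\<lambda>u. if u = t then s else u) ` f \<noteq> {s}" for f
  proof -
    from that(1) assms(1) have f: "f \<subseteq> verts G" "card f = 2"
      by (auto simp: ordered_graph_def)
    then obtain a b where ab: "f = {a, b}" "a \<noteq> b"
      by (auto simp: card_2_iff)
    show ?thesis
      using f that(2) st ab
      by (cases "a = t"; cases "b = t") (auto simp: card_insert_if)
  qed
  then show ?thesis
    using assms(1) by (auto simp: ordered_graph_def contraction_def)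
qed

section \<open>The set of derangements\<close>

text \<open>
  Permutations of a vertex set are functions that are the identity elsewhere (as with
  \<^const>\<open>permutes\<close>). Writing \<open>s\<close> for the contracted vertex, replacing it in its cycle by the two
  letters \<open>s t\<close> turns \<open>\<dots> \<mapsto> s \<mapsto> w s \<mapsto> \<dots>\<close> into \<open>\<dots> \<mapsto> s \<mapsto> t \<mapsto> w s \<mapsto> \<dots>\<close>.
\<close>

definition split_letter :: "'a \<Rightarrow> 'a \<Rightarrow> ('a \<Rightarrow> 'a) \<Rightarrow> 'a \<Rightarrow> 'a" where
  "split_letter s t w = (\<lambda>u. if u = s then t else if u = t then w s else w u)"

definition add_two_cycle :: "'a \<Rightarrow> 'a \<Rightarrow> ('a \<Rightarrow> 'a) \<Rightarrow> 'a \<Rightarrow> 'a" where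
  "add_two_cycle s t w = (\<lambda>u. if u = s then t else if u = t then s else w u)"

text \<open>
  The value \<open>{}\<close> is taken when the maximal vertex is isolated; that it is also taken when the
  argument is not a nonempty ordered graph is immaterial and makes the recursion terminate.
\<close>

function derangement_set :: "'a::linorder graph \<Rightarrow> ('a \<Rightarrow> 'a) set" where
  "derangement_set G =
     (let t = max_vertex G; s = max_neighbour G in
      if \<not> ordered_graph G \<or> verts G = {} then {}
      else if neighbours G t = {} then {}
      else if verts G = {s, t} then {transpose s t}
      else derangement_set (deletion G s t)
           \<union> split_letter s t ` derangement_set (contraction G s t)
           \<union> add_two_cycle s t ` derangement_set (extraction G s t))"
  by auto
termination
proof (relation "measures [\<lambda>G. card (verts G), \<lambda>G. card (edges G)]", goal_cases)
  case 1
  show ?case by simp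
next
  case (2 G t s)
  then have fin: "finite (verts G)" and sub: "edges G \<subseteq> Pow (verts G)"
    by (auto simp: ordered_graph_def)
  have "finite (neighbours G t)"
    using fin by (simp add: neighbours_def)
  then have "s \<in> neighbours G t"
    using 2 by (simp add: max_neighbour_def)
  then have "{s, t} \<in> edges G" by (simp add: neighbours_def)
  moreover have "finite (edges G)"
    using fin sub by (meson finite_Pow_iff finite_subset)
  ultimately have "card (edges G - {{s, t}}) < card (edges G)"
    by (intro card_Diff1_less)
  then show ?case by (simp add: deletion_def)
next
  case (3 G t s)
  then have "t \<in> verts G" "finite (verts G)"
    by (auto simp: ordered_graph_def max_vertex_def)
  then have "card (verts G - {t}) < card (verts G)"
    by (intro card_Diff1_less)
  then show ?case by (simp add: contraction_def)
next
  case (4 G t s)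
  then have "t \<in> verts G" "finite (verts G)"
    by (auto simp: ordered_graph_def max_vertex_def)
  then have "card (verts G - {s, t}) < card (verts G)"
    by (intro psubset_card_mono) auto
  then show ?case by (simp add: extraction_def)
qed

declare derangement_set.simps [simp del]

section \<open>The boolean complex\<close>

definition words :: "'a graph \<Rightarrow> 'a list set" where
  "words G = {u. distinct u \<and> set u \<subseteq> verts G}"

definition commutation_step :: "'a graph \<Rightarrow> 'a list \<Rightarrow> 'a list \<Rightarrow> bool" where
  "commutation_step G u v \<longleftrightarrow>
     u \<in> words G \<and> v \<in> words G \<and>
     (\<exists>x s t y. u = x @ [s, t] @ y \<and> v = x @ [t, s] @ y \<and> {s, t} \<notin> edges G)"

definition word_rel :: "'a graph \<Rightarrow> ('a list \<times> 'a list) set" where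
  "word_rel G = {(u, v). u \<in> words G \<and> v \<in> words G \<and> equivclp (commutation_step G) u v}"

abbreviation word_class :: "'a graph \<Rightarrow> 'a list \<Rightarrow> 'a list set" where
  "word_class G u \<equiv> word_rel G `` {u}"

definition boolean_poset :: "'a graph \<Rightarrow> 'a list set set" where
  "boolean_poset G = words G // word_rel G"

definition boolean_rank :: "'a graph \<Rightarrow> int \<Rightarrow> 'a list set set" where
  "boolean_rank G k = {X \<in> boolean_poset G. \<forall>u\<in>X. int (length u) = k + 1}"

lemma equiv_word_rel: "equiv (words G) (word_rel G)"
  by (intro equivI refl_onI symI transI)
     (auto simp: word_rel_def intro: equivclp_sym equivclp_trans)

section \<open>Chains with coefficients in the field with two elements\<close>

definition scale2 :: "bit \<Rightarrow> ('b \<Rightarrow>\<^sub>0 bit) \<Rightarrow> ('b \<Rightarrow>\<^sub>0 bit)" where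
  "scale2 c a = Poly_Mapping.map ((*) c) a"

lemma lookup_scale2 [simp]:
  "Poly_Mapping.lookup (scale2 c a) x = c * Poly_Mapping.lookup a x"
  by (simp add: scale2_def Poly_Mapping.map.rep_eq when_def)

interpretation F2: vector_space "scale2 :: bit \<Rightarrow> ('b \<Rightarrow>\<^sub>0 bit) \<Rightarrow> ('b \<Rightarrow>\<^sub>0 bit)"
  by unfold_locales
     (auto intro!: poly_mapping_eqI simp: lookup_add algebra_simps simp del: add_bit_eq_xor mult_bit_eq_and)

definition is_basis :: "('b \<Rightarrow>\<^sub>0 bit) set \<Rightarrow> ('b \<Rightarrow>\<^sub>0 bit) set \<Rightarrow> bool" where
  "is_basis B H \<longleftrightarrow> B \<subseteq> H \<and> F2.independent B \<and> F2.span B = H"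

abbreviation basis_elt :: "'b \<Rightarrow> ('b \<Rightarrow>\<^sub>0 bit)" where
  "basis_elt x \<equiv> Poly_Mapping.single x 1"

definition linear_ext :: "('b \<Rightarrow> ('c \<Rightarrow>\<^sub>0 bit)) \<Rightarrow> ('b \<Rightarrow>\<^sub>0 bit) \<Rightarrow> ('c \<Rightarrow>\<^sub>0 bit)" where
  "linear_ext f a = (\<Sum>x\<in>Poly_Mapping.keys a. scale2 (Poly_Mapping.lookup a x) (f x))"

definition chains :: "'a graph \<Rightarrow> int \<Rightarrow> ('a list set \<Rightarrow>\<^sub>0 bit) set" where
  "chains G k = {c. Poly_Mapping.keys c \<subseteq> boolean_rank G k}"

text \<open>
  The class of the word obtained by deleting \<open>v\<close>, in the usual form of a function on equivalence
  classes; see the lemma \<open>delete_letter_word_class\<close>.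
\<close>

definition delete_letter :: "'a graph \<Rightarrow> 'a \<Rightarrow> 'a list set \<Rightarrow> 'a list set" where
  "delete_letter G v X = (\<Union>u\<in>X. word_class G (removeAll v u))"

lemma removeAll_commutation_step:
  assumes "commutation_step G a b"
  shows "equivclp (commutation_step G) (removeAll v a) (removeAll v b)"
proof -
  obtain x s t y where ab: "a \<in> words G" "b \<in> words G" "a = x @ [s, t] @ y"
    "b = x @ [t, s] @ y" "{s, t} \<notin> edges G"
    using assms by (auto simp: commutation_step_def)
  have "removeAll v a \<in> words G" "removeAll v b \<in> words G"
    using ab(1,2) by (auto simp: words_def distinct_removeAll)
  then have "removeAll v a = removeAll v b \<or>
             commutation_step G (removeAll v a) (removeAll v b)"
    using ab(3-5) unfolding commutation_step_def by auto
  then show ?thesis by auto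
qed

lemma delete_letter_word_class:
  assumes "u \<in> words G"
  shows "delete_letter G v (word_class G u) = word_class G (removeAll v u)"
proof -
  have "equivclp (commutation_step G) (removeAll v a) (removeAll v b)"
    if "equivclp (commutation_step G) a b" for a b
    using that
  proof (induction rule: equivclp_induct)
    case base
    show ?case by simp
  next
    case (step y z)
    then show ?case
      by (meson removeAll_commutation_step equivclp_sym equivclp_trans)
  qed
  then have "congruent (word_rel G) (\<lambda>u. word_class G (removeAll v u))"
    by (intro congruentI equiv_class_eq[OF equiv_word_rel])
       (auto simp: word_rel_def words_def distinct_removeAll)
  then show ?thesis
    unfolding delete_letter_def by (rule UN_equiv_class[OF equiv_word_rel _ assms])
qed

definition partial_boundary ::
    "'a graph \<Rightarrow> 'a \<Rightarrow> ('a list set \<Rightarrow>\<^sub>0 bit) \<Rightarrow> ('a list set \<Rightarrow>\<^sub>0 bit)" where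
  "partial_boundary G v = linear_ext (\<lambda>X. basis_elt (delete_letter G v X))"

definition boundary :: "'a graph \<Rightarrow> ('a list set \<Rightarrow>\<^sub>0 bit) \<Rightarrow> ('a list set \<Rightarrow>\<^sub>0 bit)" where
  "boundary G c = (\<Sum>v\<in>verts G. partial_boundary G v c)"

definition top_homology :: "'a graph \<Rightarrow> ('a list set \<Rightarrow>\<^sub>0 bit) set" where
  "top_homology G = {c \<in> chains G (int (card (verts G)) - 1). boundary G c = 0}"

section \<open>The elements attached to derangements\<close>

text \<open>
  For the complete graph every class of words is a singleton. Chains of the complex of a complete
  graph are therefore written as combinations of words.
\<close>

lemma word_class_complete_graph:
  assumes "u \<in> words (complete_graph V)"
  shows "word_class (complete_graph V) u = {u}"
proof -
  have no_step: "\<not> commutation_step (complete_graph V) a b" for a b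
    by (auto simp: commutation_step_def words_def complete_graph_def card_insert_if)
  have "a = b" if "equivclp (commutation_step (complete_graph V)) a b" for a b
    using that by (induction rule: equivclp_induct) (auto simp: no_step)
  then show ?thesis
    using assms by (auto simp: word_rel_def)
qed

definition concat_prod :: "('a list \<Rightarrow>\<^sub>0 bit) \<Rightarrow> ('a list \<Rightarrow>\<^sub>0 bit) \<Rightarrow> ('a list \<Rightarrow>\<^sub>0 bit)" where
  "concat_prod a b =
     linear_ext (\<lambda>u. linear_ext (\<lambda>v. if set u \<inter> set v = {} then basis_elt (u @ v) else 0) b) a"

definition diamond :: "('a list \<Rightarrow>\<^sub>0 bit) \<Rightarrow> ('a list \<Rightarrow>\<^sub>0 bit) \<Rightarrow> ('a list \<Rightarrow>\<^sub>0 bit)" where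
  "diamond a b = concat_prod a b + concat_prod b a"

text \<open>\<^term>\<open>support w m\<close> is the cycle \<open>[m, w m, w (w m), \<dots>]\<close>.\<close>

definition standard_cycle_form :: "'a::linorder set \<Rightarrow> ('a \<Rightarrow> 'a) \<Rightarrow> 'a list list" where
  "standard_cycle_form V w =
     map (support w) (sorted_list_of_set {m \<in> V. \<forall>x\<in>orbit w m. m \<le> x})"

text \<open>
  During the evaluation the expression is a list of pairs, a pair standing for a quantity and the
  first of the letters it was formed from. This letter is the immediate right-hand neighbour in
  the standard cycle form of the star (if any) to the left of the quantity, so it identifies that
  star. The letters with a star on their left are those that are not first in their cycle;
  the stars are evaluated in decreasing order of these letters.
\<close>

fun eval_star :: "'a \<Rightarrow> ('a \<times> ('a list \<Rightarrow>\<^sub>0 bit)) list \<Rightarrow> ('a \<times> ('a list \<Rightarrow>\<^sub>0 bit)) list" where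
  "eval_star c ((a, Q) # (b, R) # xs) =
     (if b = c then (a, diamond Q R) # xs else (a, Q) # eval_star c ((b, R) # xs))"
| "eval_star c xs = xs"

definition star_letters :: "'a list list \<Rightarrow> 'a set" where
  "star_letters cs = (\<Union>c\<in>set cs. set (tl c))"

definition phi_complete :: "'a::linorder set \<Rightarrow> ('a \<Rightarrow> 'a) \<Rightarrow> ('a list \<Rightarrow>\<^sub>0 bit)" where
  "phi_complete V w =
     (let cs = standard_cycle_form V w;
          start = map (\<lambda>a. (a, basis_elt [a])) (concat cs);
          final = fold eval_star (rev (sorted_list_of_set (star_letters cs))) start
      in foldr concat_prod (map snd final) (basis_elt []))"

definition project_chain :: "'a graph \<Rightarrow> ('a list \<Rightarrow>\<^sub>0 bit) \<Rightarrow> ('a list set \<Rightarrow>\<^sub>0 bit)" where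
  "project_chain G = linear_ext (\<lambda>u. basis_elt (word_class G u))"

definition phi :: "'a::linorder graph \<Rightarrow> ('a \<Rightarrow> 'a) \<Rightarrow> ('a list set \<Rightarrow>\<^sub>0 bit)" where
  "phi G w = project_chain G (phi_complete (verts G) w)"

end

(*
  Let t be the maximal vertex of G and e = {s, t} an edge. Identifying words that differ by
  exchanging s and t maps the cycles of G to those of G - e. Replacing the contracted vertex x of a
  word A x B by st + ts identifies the chains of G / e with the kernel of the map from the chains of
  G to those of G - e. A blown up chain is a cycle as soon as the boundary of the original chain is
  concentrated at x; that boundary is then a cycle of G - [e], and it vanishes if and only if the
  original chain is a cycle. So the top homology of G is filtered with quotients inside those of
  G - e, G - [e] and G / e. Since t is maximal, the star to the left of t is evaluated first, so that
  phi(w_st) is the blow-up of phi(w), while phi of w together with the two-cycle (s t) is the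
  blow-up of a chain with boundary phi(w). Thus the three parts of D(G) yield bases of the three
  pieces of the filtration.
*)

theory Submission
  imports Defs "HOL-Combinatorics.Multiset_Permutations"
begin

text \<open>The overview bounds the pieces of the filtration from above; that they are filled
  completely comes from the recursion itself. \<open>phi_complete\<close> of a derangement is
  annihilated by every single deletion already in the complete graph, so one combination of words
  projects to cycles of G and of G - e at once. The basis of G - e known by induction therefore
  lifts to cycles of G, and surjectivity of the quotient maps is never argued separately. The main
  obstacle is exactness in the middle: a chain of G that vanishes in G - e must be a blow-up. A
  generated equivalence is awkward for this, so classes are first recognised by an invariant, the
  relative order of adjacent letters. Two classes identified in G - e then differ only in the order
  of s and t, and the letters between s and t can be moved away until these two are neighbours.
  Chains of the four graphs live on different classes, so all maps are computed on combinations of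
  words and transported through \<open>project_chain\<close>. The filtration exists for every edge;
  maximality of t enters on the combinatorial side, in the recursion and in the cycle forms.\<close>

declare add_bit_eq_xor [simp del] mult_bit_eq_and [simp del]

section \<open>Linear algebra over the field with two elements\<close>

abbreviation keys :: "('b \<Rightarrow>\<^sub>0 bit) \<Rightarrow> 'b set" where
  "keys \<equiv> Poly_Mapping.keys"

section \<open>Linear extensions and induction over the support of a chain\<close>

lemma bit_chain_add_self [simp]: "(a :: 'b \<Rightarrow>\<^sub>0 bit) + a = 0"
  by (rule poly_mapping_eqI) (simp add: lookup_add)

lemma bit_chain_add_self_left [simp]: "(a :: 'b \<Rightarrow>\<^sub>0 bit) + (a + b) = b"
  by (simp flip: add.assoc)

lemma bit_chain_add_eq_0_iff: "(a :: 'b \<Rightarrow>\<^sub>0 bit) + b = 0 \<longleftrightarrow> a = b"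
  by (metis add.right_neutral bit_chain_add_self bit_chain_add_self_left)

text \<open>The support of a sum may be smaller than the union of the supports, so additivity is
  proved by summing all extensions over one common finite set.\<close>

lemma linear_ext_superset:
  assumes "finite S" "keys a \<subseteq> S"
  shows "linear_ext f a = (\<Sum>x\<in>S. scale2 (Poly_Mapping.lookup a x) (f x))"
  unfolding linear_ext_def
proof (rule sum.mono_neutral_left[OF assms])
  show "\<forall>x\<in>S - keys a. scale2 (Poly_Mapping.lookup a x) (f x) = 0"
    by (simp add: not_in_keys_iff_lookup_eq_zero)
qed

lemma linear_ext_add: "linear_ext f (a + b) = linear_ext f a + linear_ext f b"
proof -
  let ?S = "keys a \<union> keys b"
  have "keys (a + b) \<subseteq> ?S" by (rule Poly_Mapping.keys_add)
  then show ?thesis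
    using linear_ext_superset[of ?S a f] linear_ext_superset[of ?S b f]
      linear_ext_superset[of ?S "a + b" f]
    by (simp add: lookup_add F2.scale_left_distrib sum.distrib)
qed

lemma linear_ext_0 [simp]: "linear_ext f 0 = 0"
  by (simp add: linear_ext_def)

lemma linear_ext_basis_elt [simp]: "linear_ext f (basis_elt x) = f x"
  by (simp add: linear_ext_def)

lemma linear_ext_sum: "linear_ext f (sum g A) = (\<Sum>x\<in>A. linear_ext f (g x))"
  by (induction A rule: infinite_finite_induct) (simp_all add: linear_ext_add)

text \<open>Over two elements a chain is determined by its support, and adding a basis element
  toggles one point of it.\<close>

lemma keys_basis_add:
  "x \<notin> keys (a :: 'b \<Rightarrow>\<^sub>0 bit) \<Longrightarrow> keys (basis_elt x + a) = insert x (keys a)"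
  "x \<in> keys (a :: 'b \<Rightarrow>\<^sub>0 bit) \<Longrightarrow> keys (basis_elt x + a) = keys a - {x}"
  by (auto simp: in_keys_iff lookup_add lookup_single when_def split: if_splits)

text \<open>Adding \<open>basis_elt x\<close> twice returns the chain, so a support point can be
  stripped off and put back. Scalars require no case of their own.\<close>

lemma chain_induct [consumes 1, case_names zero add]:
  fixes a :: "'b \<Rightarrow>\<^sub>0 bit"
  assumes "keys a \<subseteq> S" and "P 0"
    and "\<And>x a. x \<in> S \<Longrightarrow> keys a \<subseteq> S \<Longrightarrow> P a \<Longrightarrow> P (basis_elt x + a)"
  shows "P a"
  using assms(1)
proof (induction "card (keys a)" arbitrary: a)
  case 0
  then have "a = 0" by simp
  then show ?case using assms(2) by simp
next
  case (Suc n)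
  then obtain x where x: "x \<in> keys a"
    by (metis card.empty equals0I nat.distinct(1))
  let ?b = "basis_elt x + a"
  have k: "keys ?b = keys a - {x}"
    using x by (rule keys_basis_add)
  have "P ?b"
    using Suc k x by (intro Suc.hyps(1)) auto
  then have "P (basis_elt x + ?b)"
    using assms(3)[of x ?b] x Suc.prems k by auto
  then show ?case by simp
qed

lemma linear_ext_cong:
  "keys a \<subseteq> S \<Longrightarrow> (\<And>x. x \<in> S \<Longrightarrow> f x = g x) \<Longrightarrow> linear_ext f a = linear_ext g a"
  by (auto simp: linear_ext_def intro!: sum.cong)

lemma linear_ext_linear_ext: "linear_ext f (linear_ext g a) = linear_ext (\<lambda>x. linear_ext f (g x)) a"
  using subset_refl[of "keys a"] by (induction rule: chain_induct) (simp_all add: linear_ext_add)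

lemma linear_ext_basis_id: "linear_ext basis_elt a = a"
  using subset_refl[of "keys a"] by (induction rule: chain_induct) (simp_all add: linear_ext_add)

lemma linear_ext_zero_fun [simp]: "linear_ext (\<lambda>_. 0) a = 0"
  by (simp add: linear_ext_def)

lemma linear_ext_add_fun: "linear_ext (\<lambda>x. f x + g x) a = linear_ext f a + linear_ext g a"
  using subset_refl[of "keys a"]
  by (induction rule: chain_induct) (simp_all add: linear_ext_add ac_simps)

lemma keys_linear_ext_subset:
  assumes "keys a \<subseteq> S" "\<And>x. x \<in> S \<Longrightarrow> keys (f x) \<subseteq> T"
  shows "keys (linear_ext f a) \<subseteq> T"
  using assms(1)
proof (induction rule: chain_induct)
  case (add x a)
  then show ?case
    using assms(2)[of x] Poly_Mapping.keys_add[of "f x" "linear_ext f a"]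
    by (auto simp: linear_ext_add)
qed simp

lemma keys_linear_ext_image:
  "keys a \<subseteq> S \<Longrightarrow> keys (linear_ext (\<lambda>x. basis_elt (f x)) a) \<subseteq> f ` S"
  by (rule keys_linear_ext_subset) auto

text \<open>Used to represent a chain on classes by a combination of words, on which deletions and
  blow-ups can be computed.\<close>

lemma linear_ext_image_lift:
  fixes c :: "'c \<Rightarrow>\<^sub>0 bit"
  assumes "keys c \<subseteq> f ` S"
  obtains a where "keys a \<subseteq> S" "c = linear_ext (\<lambda>x. basis_elt (f x)) a"
proof -
  have "\<exists>a. keys a \<subseteq> S \<and> c = linear_ext (\<lambda>x. basis_elt (f x)) a"
    using assms
  proof (induction rule: chain_induct)
    case zero
    show ?case by (intro exI[of _ 0]) simp
  next
    case (add y c)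
    then obtain x a where "y = f x" "x \<in> S" "keys a \<subseteq> S"
      "c = linear_ext (\<lambda>x. basis_elt (f x)) a" by auto
    then show ?case
      using Poly_Mapping.keys_add[of "basis_elt x" a]
      by (intro exI[of _ "basis_elt x + a"]) (auto simp: linear_ext_add)
  qed
  then show ?thesis using that by blast
qed

text \<open>The extension of a left inverse of \<open>f\<close> on \<open>S\<close> recovers the
  chain.\<close>

lemma linear_ext_inj_eq_0:
  assumes "inj_on f S" "keys a \<subseteq> S" "linear_ext (\<lambda>x. basis_elt (f x)) a = 0"
  shows "a = 0"
proof -
  have "linear_ext (\<lambda>y. basis_elt (the_inv_into S f y)) (linear_ext (\<lambda>x. basis_elt (f x)) a) =
        linear_ext basis_elt a"
    unfolding linear_ext_linear_ext
    by (rule linear_ext_cong[OF assms(2)]) (simp add: the_inv_into_f_f[OF assms(1)])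
  then show ?thesis by (simp add: linear_ext_basis_id assms(3))
qed

text \<open>The coefficient of the image at \<open>f x\<close> is the number of support points in
  the fibre modulo two, so \<open>x\<close> cannot be alone there. This finds the pairs by which
  kernel elements are dismantled.\<close>

lemma linear_ext_eq_0_collision:
  assumes "linear_ext (\<lambda>x. basis_elt (f x)) a = 0" "x \<in> keys a"
  obtains y where "y \<in> keys a" "y \<noteq> x" "f y = f x"
proof (rule ccontr)
  assume "\<not> thesis"
  then have uniq: "f y \<noteq> f x" if "y \<in> keys a" "y \<noteq> x" for y
    using that \<open>\<And>y. \<lbrakk>y \<in> keys a; y \<noteq> x; f y = f x\<rbrakk> \<Longrightarrow> thesis\<close> by blast
  \<comment> \<open>A functional with values in the one-dimensional space over \<open>unit\<close>
    reads off the coefficient of the image at \<open>f x\<close>.\<close>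
  have "linear_ext (\<lambda>y. if f y = f x then basis_elt () else 0) a =
        linear_ext (\<lambda>z. if z = f x then basis_elt () else 0)
          (linear_ext (\<lambda>x. basis_elt (f x)) a)"
    by (simp add: linear_ext_linear_ext)
  also have "\<dots> = 0" by (simp add: assms(1))
  finally have "linear_ext (\<lambda>y. if f y = f x then basis_elt () else 0) a = 0" .
  moreover have "linear_ext (\<lambda>y. if f y = f x then basis_elt () else 0) a =
      (\<Sum>y\<in>{x}. scale2 (Poly_Mapping.lookup a y) (if f y = f x then basis_elt () else 0))"
    unfolding linear_ext_def
    by (rule sum.mono_neutral_right) (use assms(2) uniq in auto)
  moreover have "Poly_Mapping.lookup a x = 1"
    using assms(2) by (simp add: in_keys_iff)
  moreover have "basis_elt () \<noteq> (0 :: unit \<Rightarrow>\<^sub>0 bit)"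
    by (metis lookup_single_eq lookup_zero zero_neq_one)
  ultimately show False by simp
qed

text \<open>
  A family indexed by a finite set is a basis if every vector is the sum over exactly one subset.
  Working with families rather than sets keeps track of the injectivity of \<open>f\<close>.
\<close>

definition basis_family :: "('i \<Rightarrow> ('b \<Rightarrow>\<^sub>0 bit)) \<Rightarrow> 'i set \<Rightarrow> ('b \<Rightarrow>\<^sub>0 bit) set \<Rightarrow> bool" where
  "basis_family f D H \<longleftrightarrow>
     finite D \<and> (\<forall>S\<subseteq>D. sum f S = 0 \<longrightarrow> S = {}) \<and> H = sum f ` Pow D"

lemma basis_family_cong:
  assumes "\<And>x. x \<in> D \<Longrightarrow> f x = g x"
  shows "basis_family f D H \<longleftrightarrow> basis_family g D H"
proof -
  have "sum f S = sum g S" if "S \<subseteq> D" for S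
    using that assms by (auto intro!: sum.cong)
  then show ?thesis
    unfolding basis_family_def by (metis (no_types, lifting) Pow_iff image_cong)
qed

lemma basis_family_mem: "basis_family f D H \<Longrightarrow> x \<in> D \<Longrightarrow> f x \<in> H"
  unfolding basis_family_def by (auto intro!: image_eqI[of _ _ "{x}"])

lemma basis_family_nonzero: "basis_family f D H \<Longrightarrow> x \<in> D \<Longrightarrow> f x \<noteq> 0"
  unfolding basis_family_def by (metis bot.extremum insert_not_empty insert_subset sum.empty
      sum.insert finite.emptyI equals0D add.right_neutral)

text \<open>Equal values at two indices would cancel in characteristic two, so independence of the
  family contains injectivity.\<close>

lemma basis_family_inj: "basis_family f D H \<Longrightarrow> inj_on f D"
proof (rule inj_onI, rule ccontr)
  fix x y assume bf: "basis_family f D H" "x \<in> D" "y \<in> D" "f x = f y" "x \<noteq> y"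
  then have "sum f {x, y} = 0" by simp
  with bf(1-3) show False
    unfolding basis_family_def by (metis empty_not_insert empty_subsetI insert_subset)
qed

text \<open>Injectivity of \<open>g\<close> comes for free, since equal new indices would give equal
  basis vectors. In this way \<open>split_letter\<close> and \<open>add_two_cycle\<close> turn out
  to be injective on the derangements without any argument about permutations.\<close>

lemma basis_family_image:
  assumes "basis_family (\<lambda>x. f (g x)) D H"
  shows "basis_family f (g ` D) H"
proof -
  have inj: "inj_on g D"
    using basis_family_inj[OF assms] by (auto simp: inj_on_def)
  have sum: "sum f (g ` S) = sum (\<lambda>x. f (g x)) S" if "S \<subseteq> D" for S
    using inj_on_subset[OF inj that] by (simp add: sum.reindex)
  have "Pow (g ` D) = image g ` Pow D"
    by (auto simp: image_Pow_surj)
  then have "sum f ` Pow (g ` D) = sum (\<lambda>x. f (g x)) ` Pow D"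
    by (simp only: image_image) (rule image_cong, auto simp: sum)
  moreover have "S = {}" if S: "S \<subseteq> g ` D" "sum f S = 0" for S
  proof -
    obtain S' where "S' \<subseteq> D" "S = g ` S'"
      using S(1) by (meson subset_image_iff)
    then show ?thesis
      using S(2) assms sum[of S'] by (auto simp: basis_family_def)
  qed
  ultimately show ?thesis
    using assms by (simp add: basis_family_def)
qed

lemma basis_family_linear_image:
  assumes bf: "basis_family f D H"
    and inj: "\<And>h. h \<in> H \<Longrightarrow> linear_ext p h = 0 \<Longrightarrow> h = 0"
  shows "basis_family (\<lambda>x. linear_ext p (f x)) D (linear_ext p ` H)"
  unfolding basis_family_def
proof (intro conjI allI impI)
  show "finite D" using bf by (simp add: basis_family_def)
  show "S = {}" if "S \<subseteq> D" "(\<Sum>x\<in>S. linear_ext p (f x)) = 0" for S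
    using bf inj[of "sum f S"] that by (auto simp: basis_family_def linear_ext_sum)
  show "linear_ext p ` H = sum (\<lambda>x. linear_ext p (f x)) ` Pow D"
    using bf by (auto simp: basis_family_def linear_ext_sum image_image)
qed

text \<open>A basis of the kernel and lifts of a basis of the quotient form a basis; over two
  elements additivity of \<open>p\<close> is linearity. That \<open>p\<close> maps onto
  \<open>H'\<close> is implied by \<open>quot\<close>, since the family already lifts a basis of
  \<open>H'\<close>. The index sets are disjoint because \<open>p (f x)\<close> vanishes on
  \<open>D2\<close> and is a basis vector on \<open>D1\<close>.\<close>

lemma basis_family_extension:
  assumes add: "\<And>a b. a \<in> H \<Longrightarrow> b \<in> H \<Longrightarrow> a + b \<in> H"
    and p_add: "\<And>a b. p (a + b) = p a + p b"
    and f_H: "\<And>x. x \<in> D1 \<Longrightarrow> f x \<in> H"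
    and quot: "basis_family (\<lambda>x. p (f x)) D1 H'"
    and p_H: "\<And>h. h \<in> H \<Longrightarrow> p h \<in> H'"
    and ker: "basis_family f D2 {h \<in> H. p h = 0}"
  shows "basis_family f (D1 \<union> D2) H"
proof -
  have p0: "p 0 = 0"
    using p_add[of 0 0] by simp
  have p_sum: "p (sum f S) = (\<Sum>x\<in>S. p (f x))" for S
    by (induction S rule: infinite_finite_induct) (simp_all add: p0 p_add)
  have ker_eq: "{h \<in> H. p h = 0} = sum f ` Pow D2"
    using ker unfolding basis_family_def by blast
  have "sum f {} \<in> sum f ` Pow D2" by blast
  then have zero: "0 \<in> H"
    unfolding ker_eq[symmetric] by simp
  have sum_H: "sum f S \<in> H" if "S \<subseteq> D1 \<union> D2" for S
    using that
  proof (induction S rule: infinite_finite_induct)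
    case (insert x S)
    then show ?case
      using f_H[of x] basis_family_mem[OF ker, of x] by (auto intro!: add)
  qed (simp_all add: zero)
  have ker_f: "p (f x) = 0" if "x \<in> D2" for x
    using basis_family_mem[OF ker that] by simp
  have fin: "finite D1" "finite D2"
    using quot ker by (simp_all add: basis_family_def)
  have disj: "D1 \<inter> D2 = {}"
    using basis_family_nonzero[OF quot] ker_f by blast
  have split: "sum f S = sum f (S \<inter> D1) + sum f (S \<inter> D2)" if "S \<subseteq> D1 \<union> D2" for S
  proof -
    have "S = (S \<inter> D1) \<union> (S \<inter> D2)" using that by blast
    moreover have "(S \<inter> D1) \<inter> (S \<inter> D2) = {}" using disj by blast
    ultimately show ?thesis
      using fin by (metis finite_Int sum.union_disjoint inf_commute)
  qed
  have p_D2: "p (sum f S) = 0" if "S \<subseteq> D2" for S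
    unfolding p_sum using that ker_f by (intro sum.neutral) auto
  show ?thesis
    unfolding basis_family_def
  proof (intro conjI allI impI)
    show "finite (D1 \<union> D2)" using fin by simp
    show "S = {}" if S: "S \<subseteq> D1 \<union> D2" "sum f S = 0" for S
    proof -
      have "(\<Sum>x\<in>S \<inter> D1. p (f x)) = 0"
        using split[OF S(1)] p_D2[of "S \<inter> D2"] S(2) p_sum[of "S \<inter> D1"] p0 p_add
        by (metis add.right_neutral inf_le2)
      then have "S \<inter> D1 = {}"
        using quot unfolding basis_family_def by (meson inf_le2)
      moreover from this have "S \<inter> D2 = {}"
        using split[OF S(1)] S(2) ker unfolding basis_family_def
        by (metis add_0 inf_le2 sum.empty)
      ultimately show ?thesis using S(1) by blast
    qed
    have "\<exists>S. S \<subseteq> D1 \<union> D2 \<and> h = sum f S" if h: "h \<in> H" for h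
    proof -
      obtain S1 where S1: "S1 \<subseteq> D1" "p h = (\<Sum>x\<in>S1. p (f x))"
        using p_H[OF h] quot by (auto simp: basis_family_def)
      \<comment> \<open>Subtracting a lift of \<open>p h\<close>, which is addition in
        characteristic two, leaves an element of the kernel.\<close>
      then have "p (h + sum f S1) = 0"
        by (simp add: p_add p_sum)
      moreover have "h + sum f S1 \<in> H"
        using h sum_H[of S1] S1 by (intro add) auto
      ultimately have "h + sum f S1 \<in> sum f ` Pow D2"
        unfolding ker_eq[symmetric] by blast
      then obtain S2 where S2: "S2 \<subseteq> D2" "h + sum f S1 = sum f S2"
        by blast
      have "(S1 \<union> S2) \<inter> D1 = S1" "(S1 \<union> S2) \<inter> D2 = S2"
        using S1(1) S2(1) disj by blast+
      then have "sum f (S1 \<union> S2) = sum f S1 + (h + sum f S1)"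
        using split[of "S1 \<union> S2"] S1(1) S2 by auto
      also have "\<dots> = h" by (simp add: ac_simps)
      finally have "sum f (S1 \<union> S2) = h" .
      then show ?thesis
        using S1(1) S2(1) by (intro exI[of _ "S1 \<union> S2"]) auto
    qed
    then show "H = sum f ` Pow (D1 \<union> D2)"
      using sum_H by blast
  qed
qed

lemma scale2_cases: "scale2 c a = (if c = 0 then 0 else a)"
  by (cases c) simp_all

lemma is_basis_basis_family:
  assumes "basis_family f D H"
  shows "is_basis (f ` D) H"
proof -
  have "basis_family (\<lambda>x. x) (f ` D) H"
    by (rule basis_family_image) (use assms in simp)
  then have fin: "finite (f ` D)"
    and indep: "\<And>S. S \<subseteq> f ` D \<Longrightarrow> \<Sum>S = 0 \<Longrightarrow> S = {}"
    and H: "H = Sum ` Pow (f ` D)"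
    by (auto simp: basis_family_def)
  \<comment> \<open>Coefficients are 0 or 1, so linear combinations are sums over subsets.\<close>
  have sum_scale: "(\<Sum>v\<in>f ` D. scale2 (u v) v) = \<Sum>{v \<in> f ` D. u v \<noteq> 0}" for u
    using fin by (simp add: scale2_cases sum.If_cases Collect_neg_eq[symmetric] Int_def
        cong: if_cong) 
  have "\<Sum>{v \<in> f ` D. u v \<noteq> 0} \<noteq> 0" if "\<exists>v\<in>f ` D. u v \<noteq> 0" for u
    using indep[of "{v \<in> f ` D. u v \<noteq> 0}"] that by blast
  then have "F2.independent (f ` D)"
    unfolding F2.dependent_finite[OF fin] sum_scale by blast
  moreover have "F2.span (f ` D) = H"
  proof
    show "F2.span (f ` D) \<subseteq> H"
      unfolding F2.span_finite[OF fin] H by (auto simp: sum_scale)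
    show "H \<subseteq> F2.span (f ` D)"
      unfolding H using F2.span_base[of _ "f ` D"] by (auto intro!: F2.span_sum)
  qed
  ultimately show ?thesis
    using F2.span_superset[of "f ` D"] by (auto simp: is_basis_def)
qed

section \<open>Words and their classes\<close>

fun before :: "'a list \<Rightarrow> 'a \<Rightarrow> 'a \<Rightarrow> bool" where
  "before [] a b \<longleftrightarrow> False"
| "before (x # xs) a b \<longleftrightarrow> x = a \<and> b \<in> set xs \<or> before xs a b"

lemma before_append [simp]:
  "before (xs @ ys) a b \<longleftrightarrow> before xs a b \<or> before ys a b \<or> a \<in> set xs \<and> b \<in> set ys"
  by (induction xs) auto

lemma before_filter [simp]: "before (filter P xs) a b \<longleftrightarrow> before xs a b \<and> P a \<and> P b"
  by (induction xs) auto

lemma before_removeAll [simp]: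
  "before (removeAll v xs) a b \<longleftrightarrow> before xs a b \<and> a \<noteq> v \<and> b \<noteq> v"
  by (induction xs) auto

lemma before_set: "before xs a b \<Longrightarrow> a \<in> set xs \<and> b \<in> set xs"
  by (induction xs) auto

lemma before_irrefl: "distinct xs \<Longrightarrow> \<not> before xs a a"
  by (induction xs) auto

lemma before_asym: "distinct xs \<Longrightarrow> before xs a b \<Longrightarrow> \<not> before xs b a"
  by (induction xs) (auto dest: before_set)

lemma before_trans: "distinct xs \<Longrightarrow> before xs a b \<Longrightarrow> before xs b c \<Longrightarrow> before xs a c"
  by (induction xs) (auto dest: before_set)

lemma before_total: "a \<in> set xs \<Longrightarrow> b \<in> set xs \<Longrightarrow> a \<noteq> b \<Longrightarrow> before xs a b \<or> before xs b a"
  by (induction xs) auto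

text \<open>This is the projection criterion for partially commutative monoids. For words using all
  vertices, the order of the ends of every edge is an acyclic orientation of the graph.\<close>

definition same_order :: "'a set set \<Rightarrow> 'a list \<Rightarrow> 'a list \<Rightarrow> bool" where
  "same_order E u v \<longleftrightarrow>
     set u = set v \<and> (\<forall>a b. {a, b} \<in> E \<longrightarrow> before u a b = before v a b)"

lemma commutation_stepI:
  "x @ [s, t] @ y \<in> words G \<Longrightarrow> x @ [t, s] @ y \<in> words G \<Longrightarrow> {s, t} \<notin> edges G \<Longrightarrow>
    commutation_step G (x @ [s, t] @ y) (x @ [t, s] @ y)"
  unfolding commutation_step_def by blast

lemma commutation_step_same_order:
  assumes "commutation_step G u v"
  shows "same_order (edges G) u v"
proof -
  obtain x s t y where *: "u = x @ [s, t] @ y" "v = x @ [t, s] @ y" "{s, t} \<notin> edges G"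
    using assms by (auto simp: commutation_step_def)
  then have "{t, s} \<notin> edges G" by (simp add: insert_commute)
  with * show ?thesis by (auto simp: same_order_def)
qed

lemma commutation_step_Cons:
  assumes "commutation_step G u v" "a # u \<in> words G" "a # v \<in> words G"
  shows "commutation_step G (a # u) (a # v)"
proof -
  obtain x s t y where "u = x @ [s, t] @ y" "v = x @ [t, s] @ y" "{s, t} \<notin> edges G"
    using assms by (auto simp: commutation_step_def)
  then show ?thesis
    using assms(2,3) commutation_stepI[of "a # x" s t y G] by simp
qed

text \<open>The equality of letter sets is carried through the induction because it keeps
  \<open>a\<close> out of every intermediate word, so that prefixing \<open>a\<close> creates no
  repetition.\<close>

lemma commutation_Cons:
  assumes "equivclp (commutation_step G) u v" "a \<in> verts G" "a \<notin> set u"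
  shows "equivclp (commutation_step G) (a # u) (a # v) \<and> set u = set v"
  using assms(1)
proof (induction rule: equivclp_induct)
  case base
  show ?case by simp
next
  case (step y z)
  then have yz: "y \<in> words G" "z \<in> words G" "set y = set z"
    using commutation_step_same_order[of G y z] commutation_step_same_order[of G z y]
    by (auto simp: commutation_step_def same_order_def)
  then have az: "a # y \<in> words G" "a # z \<in> words G"
    using assms(2,3) step by (auto simp: words_def)
  have "commutation_step G (a # y) (a # z) \<or> commutation_step G (a # z) (a # y)"
    using step(2) az by (auto intro: commutation_step_Cons)
  then have "equivclp (commutation_step G) (a # y) (a # z)"
    by (auto intro: r_into_equivclp equivclp_sym)
  with step yz show ?case by (auto intro: equivclp_trans)
qed

lemma commutation_move_to_front:
  assumes "x @ a # y \<in> words G" "\<And>b. b \<in> set x \<Longrightarrow> {a, b} \<notin> edges G"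
  shows "equivclp (commutation_step G) (x @ a # y) (a # x @ y)"
  using assms
proof (induction x)
  case (Cons b x)
  have "equivclp (commutation_step G) (x @ a # y) (a # x @ y)"
    using Cons by (auto simp: words_def)
  then have "equivclp (commutation_step G) (b # x @ a # y) (b # a # x @ y)"
    using commutation_Cons[of G "x @ a # y" "a # x @ y" b] Cons.prems(1) by (auto simp: words_def)
  moreover have "commutation_step G (b # a # x @ y) (a # b # x @ y)"
    using Cons.prems(1) Cons.prems(2)[of b] commutation_stepI[of "[]" b a "x @ y" G]
    by (auto simp: words_def insert_commute)
  ultimately show ?case
    by (auto intro: equivclp_trans r_into_equivclp)
qed simp

text \<open>A letter preceding \<open>a\<close> in \<open>v\<close> comes after \<open>a\<close> in
  \<open>a # u\<close>, so it cannot be adjacent to \<open>a\<close>. Hence \<open>a\<close>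
  commutes to the front of \<open>v\<close>, and the induction hypothesis applies to the
  tails.\<close>

lemma same_order_commutation:
  assumes "u \<in> words G" "v \<in> words G" "same_order (edges G) u v"
  shows "equivclp (commutation_step G) u v"
  using assms
proof (induction u arbitrary: v)
  case Nil
  then show ?case by (simp add: same_order_def)
next
  case (Cons a u)
  have "a \<in> set v"
    using Cons.prems(3) by (auto simp: same_order_def)
  then obtain x y where v: "v = x @ a # y"
    by (meson split_list)
  have dist: "distinct (a # u)" "distinct (x @ a # y)"
    using Cons.prems v by (auto simp: words_def)
  have so: "same_order (edges G) (a # u) (x @ a # y)"
    using Cons.prems v by simp
  have nonadj: "{a, b} \<notin> edges G" if "b \<in> set x" for b
  proof
    assume "{a, b} \<in> edges G"
    moreover have "before (a # u) a b"
      using so that dist by (auto simp: same_order_def)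
    ultimately have "before v a b"
      using so v by (auto simp: same_order_def)
    moreover have "before v b a" using that v by auto
    ultimately show False using before_asym[of v] dist v by blast
  qed
  have "same_order (edges G) u (x @ y)"
    unfolding same_order_def
  proof (intro conjI allI impI)
    have "set (a # u) = set (x @ a # y)"
      using so by (simp add: same_order_def)
    then show "set u = set (x @ y)"
      using dist by auto
    fix b c assume bc: "{b, c} \<in> edges G"
    have "before (removeAll a (a # u)) b c = before (removeAll a (x @ a # y)) b c"
      using so bc unfolding same_order_def before_removeAll by blast
    moreover have "removeAll a (a # u) = u" "removeAll a (x @ a # y) = x @ y"
      using dist by auto
    ultimately show "before u b c = before (x @ y) b c" by (simp only:)
  qed
  then have "equivclp (commutation_step G) u (x @ y)"
    using Cons.prems v by (intro Cons.IH) (auto simp: words_def)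
  then have "equivclp (commutation_step G) (a # u) (a # x @ y)"
    using commutation_Cons[of G u "x @ y" a] Cons.prems(1) by (auto simp: words_def)
  moreover have "equivclp (commutation_step G) v (a # x @ y)"
    using commutation_move_to_front[of x a y G] Cons.prems(2) nonadj v by auto
  ultimately show ?case
    by (meson equivclp_sym equivclp_trans)
qed

lemma same_order_refl [simp]: "same_order E u u"
  by (simp add: same_order_def)

lemma same_order_sym: "same_order E u v \<Longrightarrow> same_order E v u"
  by (simp add: same_order_def)

lemma same_order_trans: "same_order E u v \<Longrightarrow> same_order E v w \<Longrightarrow> same_order E u w"
  by (simp add: same_order_def)

lemma commutation_iff_same_order:
  assumes "u \<in> words G" "v \<in> words G"
  shows "equivclp (commutation_step G) u v \<longleftrightarrow> same_order (edges G) u v"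
proof
  show "same_order (edges G) u v" if "equivclp (commutation_step G) u v"
    using that
  proof (induction rule: equivclp_induct)
    case (step y z)
    then show ?case
      using same_order_trans commutation_step_same_order same_order_sym by metis
  qed simp
qed (rule same_order_commutation[OF assms])

lemma word_class_altdef:
  assumes "u \<in> words G"
  shows "word_class G u = {v \<in> words G. same_order (edges G) u v}"
  using assms by (auto simp: word_rel_def commutation_iff_same_order)

lemma word_class_eq_iff:
  assumes "u \<in> words G" "v \<in> words G"
  shows "word_class G u = word_class G v \<longleftrightarrow> same_order (edges G) u v"
  using assms by (auto simp: word_class_altdef intro: same_order_trans same_order_sym)

lemma permutations_of_set_words:
  "L \<subseteq> verts G \<Longrightarrow> permutations_of_set L \<subseteq> words G"
  by (auto simp: permutations_of_set_def words_def)

text \<open>A repetition-free word of length \<open>card (verts G)\<close> uses every vertex, and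
  commutation preserves the letters, so one representative decides the rank of a class.\<close>

lemma boolean_rank_top:
  assumes "ordered_graph G"
  shows "boolean_rank G (int (card (verts G)) - 1) = word_class G ` permutations_of_set (verts G)"
    (is "?L = ?R")
proof
  have fin: "finite (verts G)" using assms by (simp add: ordered_graph_def)
  show "?L \<subseteq> ?R"
  proof
    fix X assume X: "X \<in> ?L"
    then obtain u where u: "u \<in> words G" "X = word_class G u"
      by (auto simp: boolean_rank_def boolean_poset_def elim: quotientE)
    then have "u \<in> X" by (simp add: word_class_altdef)
    then have "length u = card (verts G)"
      using X by (auto simp: boolean_rank_def)
    then have "set u = verts G"
      using u(1) fin card_subset_eq[of "verts G" "set u"] by (simp add: words_def distinct_card)
    then show "X \<in> ?R"
      using u by (auto simp: words_def permutations_of_set_def)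
  qed
  show "?R \<subseteq> ?L"
  proof
    fix X assume "X \<in> ?R"
    then obtain u where u: "u \<in> permutations_of_set (verts G)" "X = word_class G u" by blast
    then have uG: "u \<in> words G" using permutations_of_set_words by blast
    have "length v = card (verts G)" if "v \<in> X" for v
    proof -
      have "v \<in> words G" "same_order (edges G) u v"
        using that u(2) word_class_altdef[OF uG] by auto
      moreover have "set u = verts G"
        using u(1) by (rule permutations_of_setD)
      ultimately show ?thesis
        using distinct_card[of v] by (simp add: words_def same_order_def)
    qed
    then show "X \<in> ?L"
      using uG u(2) by (auto simp: boolean_rank_def boolean_poset_def quotientI)
  qed
qed

section \<open>Chains as images of combinations of words\<close>

abbreviation word_chains :: "'a set \<Rightarrow> ('a list \<Rightarrow>\<^sub>0 bit) set" where
  "word_chains L \<equiv> {a. keys a \<subseteq> permutations_of_set L}"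

definition remove_letter :: "'a \<Rightarrow> ('a list \<Rightarrow>\<^sub>0 bit) \<Rightarrow> ('a list \<Rightarrow>\<^sub>0 bit)" where
  "remove_letter v = linear_ext (\<lambda>u. basis_elt (removeAll v u))"

lemma project_chain_add: "project_chain G (a + b) = project_chain G a + project_chain G b"
  by (simp add: project_chain_def linear_ext_add)

lemma remove_letter_add: "remove_letter v (a + b) = remove_letter v a + remove_letter v b"
  by (simp add: remove_letter_def linear_ext_add)

lemma partial_boundary_add:
  "partial_boundary G v (a + b) = partial_boundary G v a + partial_boundary G v b"
  by (simp add: partial_boundary_def linear_ext_add)

lemma boundary_add: "boundary G (a + b) = boundary G a + boundary G b"
  by (simp add: boundary_def partial_boundary_add sum.distrib)

lemma project_chain_0 [simp]: "project_chain G 0 = 0"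
  by (simp add: project_chain_def)

lemma partial_boundary_0 [simp]: "partial_boundary G v 0 = 0"
  by (simp add: partial_boundary_def)

lemma remove_letter_0 [simp]: "remove_letter v 0 = 0"
  by (simp add: remove_letter_def)

lemma remove_letter_basis [simp]: "remove_letter v (basis_elt u) = basis_elt (removeAll v u)"
  by (simp add: remove_letter_def)

lemma project_chain_basis [simp]: "project_chain G (basis_elt u) = basis_elt (word_class G u)"
  by (simp add: project_chain_def)

lemma removeAll_permutations_of_set:
  "u \<in> permutations_of_set L \<Longrightarrow> removeAll v u \<in> permutations_of_set (L - {v})"
  by (auto simp: permutations_of_set_def distinct_removeAll)

lemma remove_letter_word_chains:
  assumes "a \<in> word_chains L"
  shows "remove_letter v a \<in> word_chains (L - {v})"
proof -
  have "keys (remove_letter v a) \<subseteq> removeAll v ` permutations_of_set L"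
    unfolding remove_letter_def using assms by (intro keys_linear_ext_image) simp
  also have "\<dots> \<subseteq> permutations_of_set (L - {v})"
    using removeAll_permutations_of_set by (rule image_subsetI)
  finally show ?thesis by simp
qed

lemma remove_letter_commute: "remove_letter v (remove_letter w a) = remove_letter w (remove_letter v a)"
proof -
  have "removeAll v (removeAll w u) = removeAll w (removeAll v u)" for u
    by (induction u) auto
  then show ?thesis
    by (simp add: remove_letter_def linear_ext_linear_ext)
qed

text \<open>Moves boundaries from classes to words, where they are plain deletions.\<close>

lemma partial_boundary_project_chain:
  assumes "keys a \<subseteq> words G"
  shows "partial_boundary G v (project_chain G a) = project_chain G (remove_letter v a)"
  unfolding partial_boundary_def project_chain_def remove_letter_def linear_ext_linear_ext
  by (rule linear_ext_cong[OF assms]) (simp add: delete_letter_word_class)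

lemma keys_project_chain:
  "keys a \<subseteq> S \<Longrightarrow> keys (project_chain G a) \<subseteq> word_class G ` S"
  unfolding project_chain_def by (rule keys_linear_ext_image)

lemma sum_eq_0_disjoint_keys:
  fixes f :: "'i \<Rightarrow> ('b \<Rightarrow>\<^sub>0 bit)"
  assumes "finite A" "\<And>i. i \<in> A \<Longrightarrow> keys (f i) \<subseteq> K i"
    and "\<And>i j. i \<in> A \<Longrightarrow> j \<in> A \<Longrightarrow> i \<noteq> j \<Longrightarrow> K i \<inter> K j = {}"
    and "sum f A = 0" "i \<in> A"
  shows "f i = 0"
proof (rule poly_mapping_eqI)
  fix x
  have "Poly_Mapping.lookup (f i) x = 0"
  proof (cases "x \<in> K i")
    case True
    have other: "Poly_Mapping.lookup (f j) x = 0" if "j \<in> A - {i}" for j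
      using that True assms(2)[of j] assms(3)[of j i] \<open>i \<in> A\<close> by (auto simp: in_keys_iff)
    have "0 = Poly_Mapping.lookup (sum f A) x" using assms(4) by simp
    also have "\<dots> = (\<Sum>j\<in>A. Poly_Mapping.lookup (f j) x)" by (rule lookup_sum)
    also have "\<dots> = Poly_Mapping.lookup (f i) x"
      using other assms(1,5) by (simp add: sum.remove[of A i])
    finally show ?thesis by simp
  next
    case False
    then show ?thesis using assms(2)[OF \<open>i \<in> A\<close>] by (auto simp: in_keys_iff)
  qed
  then show "Poly_Mapping.lookup (f i) x = Poly_Mapping.lookup 0 x" by simp
qed

lemma project_chain_lift:
  assumes "ordered_graph G" "c \<in> chains G (int (card (verts G)) - 1)"
  obtains a where "a \<in> word_chains (verts G)" "c = project_chain G a"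
proof -
  have "keys c \<subseteq> word_class G ` permutations_of_set (verts G)"
    using assms(2) unfolding chains_def boolean_rank_top[OF assms(1)] by simp
  then obtain a where "keys a \<subseteq> permutations_of_set (verts G)" "c = project_chain G a"
    unfolding project_chain_def by (rule linear_ext_image_lift)
  then show ?thesis using that by auto
qed

lemma word_chains_words: "L \<subseteq> verts G \<Longrightarrow> a \<in> word_chains L \<Longrightarrow> keys a \<subseteq> words G"
  using permutations_of_set_words[of L G] by blast

text \<open>
  Words missing different letters lie in different classes, so that the boundary of a top chain
  vanishes only if each of the partial boundaries does.
\<close>

lemma project_chain_top_homology_iff:
  assumes G: "ordered_graph G" and a: "a \<in> word_chains (verts G)"
  shows "project_chain G a \<in> top_homology G \<longleftrightarrow>
    (\<forall>v\<in>verts G. project_chain G (remove_letter v a) = 0)"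
proof -
  let ?V = "verts G"
  have fin: "finite ?V" using G by (simp add: ordered_graph_def)
  have chain: "project_chain G a \<in> chains G (int (card ?V) - 1)"
    unfolding chains_def boolean_rank_top[OF G]
    using keys_project_chain[of a "permutations_of_set ?V" G] a by simp
  have pb: "partial_boundary G v (project_chain G a) = project_chain G (remove_letter v a)" for v
    by (rule partial_boundary_project_chain[OF word_chains_words[OF subset_refl a]])
  have bd: "boundary G (project_chain G a) = (\<Sum>v\<in>?V. project_chain G (remove_letter v a))"
    by (simp add: boundary_def pb)
  let ?K = "\<lambda>v. word_class G ` permutations_of_set (?V - {v})"
  have disj: "?K v \<inter> ?K w = {}" if "v \<in> ?V" "w \<in> ?V" "v \<noteq> w" for v w
  proof -
    have "word_class G x \<noteq> word_class G y"
      if "x \<in> permutations_of_set (?V - {v})" "y \<in> permutations_of_set (?V - {w})" for x y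
    proof
      assume eq: "word_class G x = word_class G y"
      have "x \<in> words G" "y \<in> words G"
        using that permutations_of_set_words[of "?V - {v}" G]
          permutations_of_set_words[of "?V - {w}" G] by blast+
      with eq have "set x = set y" by (simp add: word_class_eq_iff same_order_def)
      then show False
        using that \<open>v \<in> ?V\<close> \<open>w \<in> ?V\<close> \<open>v \<noteq> w\<close> by (auto simp: permutations_of_set_def)
    qed
    then show ?thesis by blast
  qed
  have "project_chain G (remove_letter v a) = 0"
    if "boundary G (project_chain G a) = 0" "v \<in> ?V" for v
  proof (rule sum_eq_0_disjoint_keys[of ?V _ ?K])
    show "keys (project_chain G (remove_letter w a)) \<subseteq> ?K w" for w
      using keys_project_chain[of "remove_letter w a" "permutations_of_set (?V - {w})" G]
        remove_letter_word_chains[OF a, of w] by simp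
  qed (use that fin disj bd in auto)
  then show ?thesis
    using chain bd by (auto simp: top_homology_def)
qed

lemma top_homologyE:
  assumes "ordered_graph G" "c \<in> top_homology G"
  obtains a where "a \<in> word_chains (verts G)" "c = project_chain G a"
  using project_chain_lift[OF assms(1)] assms(2) by (auto simp: top_homology_def)

lemma top_homology_add:
  assumes "c \<in> top_homology G" "d \<in> top_homology G"
  shows "c + d \<in> top_homology G"
  using assms Poly_Mapping.keys_add[of c d]
  by (fastforce simp: top_homology_def chains_def boundary_add)

text \<open>Commutations of a word involve only edges between its own letters. Graphs that agree on
  \<open>L\<close> therefore have literally the same classes there, which lets chains of different
  graphs be compared.\<close>

lemma project_chain_cong_words:
  assumes "a \<in> word_chains L" "L \<subseteq> verts G" "L \<subseteq> verts H"
    and "\<And>e. e \<subseteq> L \<Longrightarrow> e \<in> edges G \<longleftrightarrow> e \<in> edges H"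
  shows "project_chain G a = project_chain H a"
  unfolding project_chain_def
proof (rule linear_ext_cong)
  show "keys a \<subseteq> permutations_of_set L" using assms(1) by simp
  fix u assume u: "u \<in> permutations_of_set L"
  then have uGH: "u \<in> words G" "u \<in> words H" "set u = L"
    using assms(2,3) by (auto simp: words_def permutations_of_set_def)
  have "same_order (edges G) u v \<longleftrightarrow> same_order (edges H) u v" for v
  proof -
    have "{x, y} \<in> edges G \<longleftrightarrow> {x, y} \<in> edges H" if "before u x y \<or> before v x y" "set u = set v" for x y
      using that uGH(3) assms(4)[of "{x, y}"] before_set[of u x y] before_set[of v x y] by auto
    then show ?thesis unfolding same_order_def by blast
  qed
  moreover have "v \<in> words G \<longleftrightarrow> v \<in> words H" if "same_order (edges G) u v" for v
    using that uGH by (auto simp: words_def same_order_def)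
  ultimately have "word_class G u = word_class H u"
    unfolding word_class_altdef[OF uGH(1)] word_class_altdef[OF uGH(2)] by blast
  then show "basis_elt (word_class G u) = basis_elt (word_class H u)" by simp
qed

section \<open>Blowing up a vertex to an edge\<close>

definition expand :: "'a \<Rightarrow> 'a list \<Rightarrow> 'a list \<Rightarrow> 'a list" where
  "expand s ys u = concat (map (\<lambda>a. if a = s then ys else [a]) u)"

lemma expand_simps [simp]:
  "expand s ys [] = []"
  "expand s ys (a # u) = (if a = s then ys else [a]) @ expand s ys u"
  "expand s ys (u @ v) = expand s ys u @ expand s ys v"
  by (simp_all add: expand_def)

lemma expand_notin: "s \<notin> set u \<Longrightarrow> expand s ys u = u"
  by (induction u) auto

lemma set_expand: "set (expand s ys u) = (set u - {s}) \<union> (if s \<in> set u then set ys else {})"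
  by (induction u) auto

lemma distinct_expand:
  "distinct u \<Longrightarrow> distinct ys \<Longrightarrow> set ys \<inter> (set u - {s}) = {} \<Longrightarrow> distinct (expand s ys u)"
  by (induction u) (auto simp: expand_notin set_expand)

lemma removeAll_expand:
  "v \<notin> insert s (set ys) \<Longrightarrow> removeAll v (expand s ys u) = expand s ys (removeAll v u)"
  by (induction u) auto

lemma removeAll_expand_pair:
  "v \<in> {s, t} \<Longrightarrow> removeAll v (expand s [s, t] u) = removeAll v (expand s [t, s] u)"
  by (induction u) auto

text \<open>The block replacing \<open>s\<close> is contiguous, so its letters compare with outside
  letters exactly as \<open>s\<close> did; only the order inside the block is new
  information.\<close>

lemma before_expand:
  assumes "distinct u" "t \<notin> set u" "set ys = {s, t}" "s \<noteq> t"
  shows "before (expand s ys u) a b \<longleftrightarrow>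
    s \<in> set u \<and> before ys a b \<or> before u (if a = t then s else a) (if b = t then s else b)"
  using assms(1,2)
proof (induction u)
  case (Cons x u)
  show ?case
  proof (cases "x = s")
    case True
    then have su: "s \<notin> set u" using Cons.prems by simp
    then have "\<not> before u s c" "\<not> before u c s" "\<not> before u t c" "\<not> before u c t" for c
      using Cons.prems before_set[of u] by auto
    then show ?thesis
      using True su Cons.prems assms(3,4) by (auto simp: expand_notin)
  next
    case False
    then show ?thesis
      using Cons assms(3,4) by (auto simp: set_expand dest: before_set)
  qed
qed simp

text \<open>The value 0 on words already containing \<open>t\<close> makes the map multiplicative,
  in accordance with products vanishing on words that share a letter. Words without \<open>s\<close>
  and \<open>t\<close> are fixed, so on a product of cycles only the factor containing
  \<open>s\<close> changes.\<close>

definition blow_up :: "'a \<Rightarrow> 'a \<Rightarrow> ('a list \<Rightarrow>\<^sub>0 bit) \<Rightarrow> ('a list \<Rightarrow>\<^sub>0 bit)" where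
  "blow_up s t = linear_ext (\<lambda>u.
     if t \<in> set u then 0
     else if s \<in> set u then basis_elt (expand s [s, t] u) + basis_elt (expand s [t, s] u)
     else basis_elt u)"

lemma blow_up_basis:
  "blow_up s t (basis_elt u) =
     (if t \<in> set u then 0
      else if s \<in> set u then basis_elt (expand s [s, t] u) + basis_elt (expand s [t, s] u)
      else basis_elt u)"
  by (simp add: blow_up_def)

lemma blow_up_add: "blow_up s t (a + b) = blow_up s t a + blow_up s t b"
  by (simp add: blow_up_def linear_ext_add)

lemma blow_up_0 [simp]: "blow_up s t 0 = 0"
  by (simp add: blow_up_def)

lemma remove_letter_blow_up:
  assumes "v \<noteq> s" "v \<noteq> t"
  shows "remove_letter v (blow_up s t a) = blow_up s t (remove_letter v a)"
  using subset_UNIV[of "keys a"]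
proof (induction rule: chain_induct)
  case (add u a)
  have "remove_letter v (blow_up s t (basis_elt u)) = blow_up s t (basis_elt (removeAll v u))"
    using assms by (auto simp: blow_up_basis remove_letter_add removeAll_expand)
  then show ?case
    using add by (simp add: blow_up_add remove_letter_add)
qed simp

text \<open>Deleting either letter makes the blocks \<open>[s, t]\<close> and \<open>[t, s]\<close>
  equal, and the two terms cancel. Every word has to contain \<open>s\<close>, since other words are
  not doubled.\<close>

lemma remove_letter_blow_up_self:
  assumes "v \<in> {s, t}" "keys a \<subseteq> {u. s \<in> set u}"
  shows "remove_letter v (blow_up s t a) = 0"
  using assms(2)
proof (induction rule: chain_induct)
  case (add u a)
  then show ?case
    using removeAll_expand_pair[OF assms(1)]
    by (simp add: blow_up_add remove_letter_add blow_up_basis)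
qed simp

lemma blow_up_word_chains:
  assumes "a \<in> word_chains (V - {t})" "s \<in> V" "t \<in> V" "s \<noteq> t"
  shows "blow_up s t a \<in> word_chains V"
proof -
  have "keys (blow_up s t (basis_elt u)) \<subseteq> permutations_of_set V"
    if "u \<in> permutations_of_set (V - {t})" for u
  proof -
    have u: "set u = V - {t}" "distinct u"
      using that by (auto dest: permutations_of_setD)
    have "expand s ys u \<in> permutations_of_set V" if "ys \<in> {[s, t], [t, s]}" for ys
    proof (rule permutations_of_setI)
      have ys: "set ys = {s, t}" "distinct ys" using that assms(4) by auto
      show "set (expand s ys u) = V"
        unfolding set_expand u(1) ys(1) using assms(2-4) by auto
      show "distinct (expand s ys u)"
        by (rule distinct_expand[OF u(2) ys(2)]) (use u(1) ys(1) in blast)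
    qed
    moreover have "s \<in> set u" "t \<notin> set u" using u assms by auto
    ultimately show ?thesis
      using Poly_Mapping.keys_add[of "basis_elt (expand s [s, t] u)" "basis_elt (expand s [t, s] u)"]
      by (auto simp: blow_up_basis)
  qed
  moreover have "keys a \<subseteq> permutations_of_set (V - {t})" using assms(1) by simp
  ultimately have "keys (blow_up s t a) \<subseteq> permutations_of_set V"
    unfolding blow_up_def linear_ext_basis_elt by (rule keys_linear_ext_subset[rotated])
  then show ?thesis by simp
qed

section \<open>Word classes of G, of G - e and of G / e for a fixed edge e\<close>

locale graph_edge =
  fixes G :: "'a::linorder graph" and s t :: 'a
  assumes graph: "ordered_graph G" and edge: "{s, t} \<in> edges G"
begin

abbreviation "G_del \<equiv> deletion G s t"
abbreviation "G_con \<equiv> contraction G s t"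
abbreviation "G_ext \<equiv> extraction G s t"

abbreviation "merge \<equiv> \<lambda>a. if a = t then s else a"

lemma st: "s \<noteq> t" "s \<in> verts G" "t \<in> verts G"
  using graph edge by (auto simp: ordered_graph_def)

lemma verts_simps [simp]:
  "verts G_del = verts G" "verts G_con = verts G - {t}" "verts G_ext = verts G - {s, t}"
  by (simp_all add: deletion_def contraction_def extraction_def)

lemma graph_del: "ordered_graph G_del"
  and graph_con: "ordered_graph G_con"
  and graph_ext: "ordered_graph G_ext"
  using ordered_graph_deletion ordered_graph_contraction ordered_graph_extraction graph edge
  by blast+

lemma edge_distinct: "{a, b} \<in> edges H \<Longrightarrow> ordered_graph H \<Longrightarrow> a \<noteq> b"
  by (auto simp: ordered_graph_def)

lemma edges_con_iff:
  assumes "a \<noteq> b"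
  shows "{a, b} \<in> edges G_con \<longleftrightarrow>
    (\<exists>x y. {x, y} \<in> edges G \<and> merge x = a \<and> merge y = b)"
proof
  assume "{a, b} \<in> edges G_con"
  then obtain f where f: "f \<in> edges G" "merge ` f = {a, b}"
    by (auto simp: contraction_def)
  then obtain x y where xy: "f = {x, y}"
    using graph by (auto simp: ordered_graph_def card_2_iff)
  then have "merge x = a \<and> merge y = b \<or> merge y = a \<and> merge x = b"
    using f(2) unfolding xy image_insert image_empty doubleton_eq_iff by blast
  then show "\<exists>x y. {x, y} \<in> edges G \<and> merge x = a \<and> merge y = b"
  proof
    assume "merge x = a \<and> merge y = b"
    then show ?thesis using f(1) unfolding xy by blast
  next
    assume "merge y = a \<and> merge x = b"
    moreover have "{y, x} \<in> edges G" using f(1) unfolding xy by (simp add: insert_commute)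
    ultimately show ?thesis by blast
  qed
next
  assume "\<exists>x y. {x, y} \<in> edges G \<and> merge x = a \<and> merge y = b"
  then obtain x y where xy: "{x, y} \<in> edges G" "merge x = a" "merge y = b" by blast
  then have "{a, b} \<in> (\<lambda>f. merge ` f) ` edges G"
    by (intro image_eqI[of _ _ "{x, y}"]) (simp_all only: image_insert image_empty)
  moreover have "{a, b} \<noteq> {s}" using assms by auto
  ultimately show "{a, b} \<in> edges G_con" by (simp add: contraction_def)
qed

lemma words_con: "u \<in> words G_con \<longleftrightarrow> u \<in> words G \<and> t \<notin> set u"
  by (auto simp: words_def)

lemma expand_words:
  assumes "u \<in> words G_con" "ys \<in> {[s, t], [t, s]}"
  shows "expand s ys u \<in> words G"
proof -
  have "distinct (expand s ys u)"
    using assms st by (intro distinct_expand) (auto simp: words_def)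
  then show ?thesis
    using assms st by (auto simp: words_def set_expand split: if_splits)
qed

text \<open>Makes the blow-up well defined and injective on classes. An edge of the contraction
  comes from an edge of \<open>G\<close> with the same merged ends, while the edge
  \<open>{s, t}\<close> only compares two identical blocks.\<close>

lemma same_order_expand:
  assumes "u \<in> words G_con" "v \<in> words G_con" "ys \<in> {[s, t], [t, s]}"
  shows "same_order (edges G) (expand s ys u) (expand s ys v) \<longleftrightarrow>
    same_order (edges G_con) u v"
proof -
  have u: "distinct u" "t \<notin> set u" and v: "distinct v" "t \<notin> set v"
    using assms by (auto simp: words_def)
  have ys: "set ys = {s, t}" using assms by auto
  note be = before_expand[OF u ys st(1)] before_expand[OF v ys st(1)]
  have sets: "set (expand s ys u) = set (expand s ys v) \<longleftrightarrow> set u = set v"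
  proof
    assume eq: "set (expand s ys u) = set (expand s ys v)"
    have "set x = merge ` set (expand s ys x)" if "t \<notin> set x" for x
      using that ys st by (auto simp: set_expand)
    then show "set u = set v" using u v eq by metis
  qed (simp add: set_expand)
  show ?thesis
  proof
    assume L: "same_order (edges G) (expand s ys u) (expand s ys v)"
    show "same_order (edges G_con) u v"
      unfolding same_order_def
    proof (intro conjI allI impI)
      show "set u = set v" using L sets by (simp add: same_order_def)
      fix a b assume ab: "{a, b} \<in> edges G_con"
      then have "a \<noteq> b" using graph_con edge_distinct by blast
      then obtain x y where xy: "{x, y} \<in> edges G" "merge x = a" "merge y = b"
        using ab edges_con_iff by blast
      \<comment> \<open>Both letters of the block merge to \<open>s\<close>, whereas
        \<open>x\<close> and \<open>y\<close> have different merged values.\<close>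
      then have "\<not> before ys x y"
        using \<open>a \<noteq> b\<close> assms(3) by auto
      moreover have "before (expand s ys u) x y = before (expand s ys v) x y"
        using L xy(1) unfolding same_order_def by blast
      ultimately show "before u a b = before v a b"
        unfolding be xy(2,3) by blast
    qed
  next
    assume R: "same_order (edges G_con) u v"
    then have uv: "set u = set v" by (simp add: same_order_def)
    show "same_order (edges G) (expand s ys u) (expand s ys v)"
      unfolding same_order_def
    proof (intro conjI allI impI)
      show "set (expand s ys u) = set (expand s ys v)" using uv sets by simp
      fix a b assume ab: "{a, b} \<in> edges G"
      have "before u (merge a) (merge b) = before v (merge a) (merge b)"
      proof (cases "merge a = merge b")
        case True
        show ?thesis
          unfolding True using before_irrefl[OF u(1)] before_irrefl[OF v(1)] by blast
      next
        case False
        then have "{merge a, merge b} \<in> edges G_con"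
          using ab edges_con_iff by blast
        then show ?thesis using R unfolding same_order_def by blast
      qed
      then show "before (expand s ys u) a b = before (expand s ys v) a b"
        unfolding be uv by blast
    qed
  qed
qed

text \<open>As \<open>{s, t}\<close> is an edge, the order of \<open>s\<close> and \<open>t\<close>
  is part of the class. Hence no term with block \<open>[s, t]\<close> cancels against a term with
  block \<open>[t, s]\<close>.\<close>

lemma not_same_order_expand:
  assumes "u \<in> words G_con" "v \<in> words G_con" "s \<in> set u"
  shows "\<not> same_order (edges G) (expand s [s, t] u) (expand s [t, s] v)"
proof
  assume so: "same_order (edges G) (expand s [s, t] u) (expand s [t, s] v)"
  have u: "distinct u" "t \<notin> set u" and v: "distinct v" "t \<notin> set v"
    using assms by (auto simp: words_def)
  have "before (expand s [s, t] u) s t"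
    using before_expand[OF u _ st(1), of "[s, t]"] assms(3) by simp
  then have "before (expand s [t, s] v) s t"
    using so edge by (auto simp: same_order_def)
  moreover have "set [t, s] = {s, t}" by auto
  ultimately show False
    using before_expand[OF v _ st(1), of "[t, s]"] st(1) before_irrefl[OF v(1)] by auto
qed

lemma same_order_del_expand:
  assumes "u \<in> words G_con"
  shows "same_order (edges G_del) (expand s [s, t] u) (expand s [t, s] u)"
proof -
  have u: "distinct u" "t \<notin> set u"
    using assms by (auto simp: words_def)
  have "before (expand s [s, t] u) a b = before (expand s [t, s] u) a b"
    if "{a, b} \<in> edges G_del" for a b
  proof -
    have "{a, b} \<noteq> {s, t}" using that by (simp add: deletion_def)
    then show ?thesis
      using before_expand[OF u _ st(1), of "[s, t]" a b] before_expand[OF u _ st(1), of "[t, s]" a b]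
      by auto
  qed
  moreover have "set (expand s [s, t] u) = set (expand s [t, s] u)"
    by (auto simp: set_expand)
  ultimately show ?thesis by (simp add: same_order_def)
qed

text \<open>
  If \<open>v\<close> orders \<open>t\<close> before \<open>s\<close> but otherwise agrees with \<open>u\<close>, it tells which of the letters
  between \<open>s\<close> and \<open>t\<close> in \<open>u\<close> can be moved to the left of \<open>s\<close>, the others to the right of \<open>t\<close>.
\<close>

lemma same_order_del_obtain:
  assumes u: "u \<in> words G" and v: "v \<in> words G" and so: "same_order (edges G_del) u v"
    and ust: "before u s t" and vts: "before v t s"
  obtains x where "x \<in> words G_con" "set x = set u - {t}" "s \<in> set x"
    "same_order (edges G) u (expand s [s, t] x)" "same_order (edges G) v (expand s [t, s] x)"
proof -
  have dist: "distinct u" "distinct v" using u v by (auto simp: words_def)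
  have so': "before u a b = before v a b" if "{a, b} \<in> edges G" "{a, b} \<noteq> {s, t}" for a b
    using so that by (simp add: same_order_def deletion_def)
  obtain P R where PR: "u = P @ s # R"
    using before_set[OF ust] by (meson split_list)
  then have "t \<in> set R"
    using ust dist(1) st(1) before_set[of P s t] before_set[of R s t] by auto
  then obtain M Q where MQ: "R = M @ t # Q" by (meson split_list)
  have u_eq: "u = P @ [s] @ M @ [t] @ Q" using PR MQ by simp
  define N where "N = filter (\<lambda>m. before v m s) M"
  define D where "D = filter (\<lambda>m. \<not> before v m s) M"
  define x where "x = P @ N @ [s] @ D @ Q"
  have ND: "set M = set N \<union> set D" "set N \<inter> set D = {}"
    by (auto simp: N_def D_def)
  have vu: "set v = set u" using so by (simp add: same_order_def)
  have N: "before v n s" if "n \<in> set N" for n using that by (simp add: N_def)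
  have D: "before v s d" if "d \<in> set D" for d
  proof -
    have "d \<in> set v" "s \<in> set v" "d \<noteq> s"
      using that dist(1) unfolding vu u_eq by (auto simp: D_def)
    then show ?thesis using that before_total[of d v s] by (auto simp: D_def)
  qed
  have xu: "set x = set u - {t}" "distinct x"
    using dist(1) unfolding u_eq x_def by (auto simp: N_def D_def)
  have sx: "s \<in> set x" by (simp add: x_def)
  have xw: "x \<in> words G_con"
    using xu u by (auto simp: words_def)
  have notin: "s \<notin> set P" "s \<notin> set N" "s \<notin> set D" "s \<notin> set Q"
    using dist(1) unfolding u_eq by (auto simp: N_def D_def)
  have ex: "expand s ys x = P @ N @ ys @ D @ Q" for ys
    using notin by (simp add: x_def expand_notin)
  define y where "y = P @ N @ [s, t] @ D @ Q"
  have y_dist: "distinct y"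
    using dist(1) unfolding u_eq y_def by (auto simp: N_def D_def)
  have y_set: "set y = set u"
    unfolding u_eq y_def by (auto simp: N_def D_def)
  \<comment> \<open>Only the pairs moved past each other matter. \<open>v\<close> orders each of
    them as \<open>y\<close> does, by transitivity through \<open>s\<close>; since \<open>u\<close>
    and \<open>v\<close> agree on all edges except \<open>{s, t}\<close>, no such pair is an
    edge.\<close>
  have agree: "before u a b" if yab: "before y a b" and ab: "{a, b} \<in> edges G" for a b
  proof (rule ccontr)
    assume nb: "\<not> before u a b"
    have MN: "before M a b" if "before N a b" using that by (simp add: N_def)
    have MD: "before M a b" if "before D a b" using that by (simp add: D_def)
    \<comment> \<open>The moves are: \<open>N\<close> passes \<open>D\<close>, \<open>N\<close>
      passes \<open>s\<close>, and \<open>D\<close> passes \<open>t\<close>.\<close>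
    consider "a \<in> set N" "b \<in> set D" | "a \<in> set N" "b = s" | "a = t" "b \<in> set D"
      using yab nb MN MD ND(1) unfolding y_def u_eq by auto
    then show False
    proof cases
      case 1
      then have "before v a b" using N D before_trans dist by metis
      moreover have "{a, b} \<noteq> {s, t}"
        using 1 notin by (auto simp: doubleton_eq_iff)
      ultimately show False using so' ab nb by blast
    next
      case 2
      moreover have "a \<noteq> t" using 2 dist(1) unfolding u_eq by (auto simp: N_def)
      ultimately show False using so'[OF ab] N nb notin by (auto simp: doubleton_eq_iff)
    next
      case 3
      then have "before v t b" using D vts before_trans dist by metis
      then show False using so'[OF ab] 3 nb notin by (auto simp: doubleton_eq_iff)
    qed
  qed
  have uy: "same_order (edges G) u y"
    unfolding same_order_def
  proof (intro conjI allI impI)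
    show "set u = set y" using y_set by simp
    fix a b assume ab: "{a, b} \<in> edges G"
    show "before u a b = before y a b"
    proof
      \<comment> \<open>\<open>agree\<close> is one-sided; the converse applies it to the reversed
        pair, both words being linear orders on the same letters.\<close>
      assume ba: "before u a b"
      have "a \<in> set y" "b \<in> set y"
        using before_set[OF ba] y_set by simp_all
      moreover have "a \<noteq> b"
        using ba before_irrefl[OF dist(1), of a] by blast
      ultimately have "before y a b \<or> before y b a" by (rule before_total)
      moreover have "{b, a} \<in> edges G" using ab by (simp only: insert_commute)
      then have "\<not> before y b a"
        using agree[of b a] before_asym[OF dist(1) ba] by blast
      ultimately show "before y a b" by blast
    qed (use agree ab in blast)
  qed
  have yz: "same_order (edges G) v (P @ N @ [t, s] @ D @ Q)" (is "same_order _ v ?z")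
    unfolding same_order_def
  proof (intro conjI allI impI)
    show "set v = set ?z" using y_set vu by (auto simp: y_def)
    fix a b assume ab: "{a, b} \<in> edges G"
    show "before v a b = before ?z a b"
    proof (cases "{a, b} = {s, t}")
      case True
      have "before ?z t s" by simp
      moreover have "distinct ?z" using y_dist by (auto simp: y_def)
      ultimately show ?thesis
        using True vts before_asym[of ?z t s] before_asym[OF dist(2) vts]
        by (auto simp: doubleton_eq_iff simp del: before.simps before_append)
    next
      case False
      then have "before ?z a b = before y a b"
        using st(1) by (auto simp: y_def)
      then show ?thesis using so'[OF ab False] uy ab by (simp add: same_order_def)
    qed
  qed
  show ?thesis
    using that[of x] xw xu(1) sx uy yz by (simp add: ex y_def)
qed

section \<open>Linear maps between the chains of G, of G - e and of G / e\<close>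

definition to_del :: "('a list set \<Rightarrow>\<^sub>0 bit) \<Rightarrow> ('a list set \<Rightarrow>\<^sub>0 bit)" where
  "to_del = linear_ext (\<lambda>X. basis_elt (word_class G_del (SOME u. u \<in> X)))"

definition class_blow_up :: "('a list set \<Rightarrow>\<^sub>0 bit) \<Rightarrow> ('a list set \<Rightarrow>\<^sub>0 bit)" where
  "class_blow_up = linear_ext (\<lambda>X. project_chain G (blow_up s t (basis_elt (SOME u. u \<in> X))))"

text \<open>A left inverse of \<open>class_blow_up\<close> on words containing \<open>s\<close>: of
  the two terms of a blow-up it keeps the one with block \<open>[s, t]\<close> and kills the
  other.\<close>

definition class_contract :: "('a list set \<Rightarrow>\<^sub>0 bit) \<Rightarrow> ('a list set \<Rightarrow>\<^sub>0 bit)" where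
  "class_contract = linear_ext (\<lambda>X.
     if \<exists>x\<in>words G_con. s \<in> set x \<and> X = word_class G (expand s [s, t] x)
     then basis_elt (word_class G_con
       (SOME x. x \<in> words G_con \<and> s \<in> set x \<and> X = word_class G (expand s [s, t] x)))
     else 0)"

lemma class_contract_0: "class_contract 0 = 0"
  and class_blow_up_0: "class_blow_up 0 = 0"
  by (simp_all add: class_contract_def class_blow_up_def)

lemma some_in_word_class:
  assumes "u \<in> words H"
  shows "(SOME v. v \<in> word_class H u) \<in> words H"
    and "same_order (edges H) u (SOME v. v \<in> word_class H u)"
proof -
  have "u \<in> word_class H u" using assms by (simp add: word_class_altdef)
  then have "(SOME v. v \<in> word_class H u) \<in> word_class H u" by (rule someI)
  then show "(SOME v. v \<in> word_class H u) \<in> words H"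
    and "same_order (edges H) u (SOME v. v \<in> word_class H u)"
    unfolding word_class_altdef[OF assms] by simp_all
qed

lemma words_del [simp]: "words G_del = words G"
  by (simp add: words_def)

lemma to_del_project_chain:
  assumes "keys a \<subseteq> words G"
  shows "to_del (project_chain G a) = project_chain G_del a"
  unfolding to_del_def project_chain_def linear_ext_linear_ext linear_ext_basis_elt
proof (rule linear_ext_cong[OF assms])
  fix u assume u: "u \<in> words G"
  have "same_order (edges G_del) u (SOME v. v \<in> word_class G u)"
    using some_in_word_class(2)[OF u] by (simp add: same_order_def deletion_def)
  then have "word_class G_del u = word_class G_del (SOME v. v \<in> word_class G u)"
    by (intro word_class_eq_iff[THEN iffD2]) (use u some_in_word_class(1)[OF u] in simp_all)
  then show "basis_elt (word_class G_del (SOME v. v \<in> word_class G u)) = basis_elt (word_class G_del u)"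
    by (simp only:)
qed

lemma project_chain_blow_up_cong:
  assumes "u \<in> words G_con" "v \<in> words G_con" "same_order (edges G_con) u v"
  shows "project_chain G (blow_up s t (basis_elt u)) = project_chain G (blow_up s t (basis_elt v))"
proof (cases "s \<in> set u")
  have t: "t \<notin> set u" "t \<notin> set v" using assms words_con by blast+
  case True
  then have "s \<in> set v" using assms(3) by (simp add: same_order_def)
  have "word_class G (expand s ys u) = word_class G (expand s ys v)" if "ys \<in> {[s, t], [t, s]}" for ys
    using word_class_eq_iff[OF expand_words[OF assms(1) that] expand_words[OF assms(2) that]]
      same_order_expand[OF assms(1,2) that] assms(3) by simp
  then show ?thesis
    using True \<open>s \<in> set v\<close> t by (simp add: blow_up_basis project_chain_add)
next
  have t: "t \<notin> set u" "t \<notin> set v" using assms words_con by blast+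
  case False
  then have "s \<notin> set v" using assms(3) by (simp add: same_order_def)
  have "same_order (edges G) u v"
    using same_order_expand[OF assms(1,2), of "[s, t]"] assms(3) False \<open>s \<notin> set v\<close>
    by (simp add: expand_notin)
  then have "word_class G u = word_class G v"
    using assms(1,2) by (simp add: word_class_eq_iff words_con)
  then show ?thesis
    using False \<open>s \<notin> set v\<close> t by (simp add: blow_up_basis)
qed

lemma class_blow_up_project_chain:
  assumes "keys a \<subseteq> words G_con"
  shows "class_blow_up (project_chain G_con a) = project_chain G (blow_up s t a)"
proof -
  have "class_blow_up (project_chain G_con a) =
      linear_ext (\<lambda>u. project_chain G (blow_up s t (basis_elt u))) a"
    unfolding class_blow_up_def project_chain_def[of G_con] linear_ext_linear_ext linear_ext_basis_elt
    by (rule linear_ext_cong[OF assms])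
      (metis project_chain_blow_up_cong some_in_word_class)
  also have "\<dots> = project_chain G (blow_up s t a)"
    by (simp add: project_chain_def blow_up_def linear_ext_linear_ext)
  finally show ?thesis .
qed

text \<open>The chosen \<open>x\<close> is unique up to commutation by
  \<open>same_order_expand\<close>, and \<open>not_same_order_expand\<close> shows that the other
  block is never of the form that is kept.\<close>

lemma class_contract_expand:
  assumes u: "u \<in> words G_con" "s \<in> set u"
  shows "class_contract (basis_elt (word_class G (expand s [s, t] u))) =
      basis_elt (word_class G_con u)"
    and "class_contract (basis_elt (word_class G (expand s [t, s] u))) = 0"
proof -
  let ?P = "\<lambda>x. x \<in> words G_con \<and> s \<in> set x \<and>
    word_class G (expand s [s, t] u) = word_class G (expand s [s, t] x)"
  have "?P u" using u by simp
  define x where "x = (SOME x. ?P x)"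
  have x: "x \<in> words G_con" "word_class G (expand s [s, t] u) = word_class G (expand s [s, t] x)"
    using someI[of ?P, OF \<open>?P u\<close>] unfolding x_def by blast+
  have "same_order (edges G) (expand s [s, t] u) (expand s [s, t] x)"
    using x(2) expand_words[OF u(1), of "[s, t]"] expand_words[OF x(1), of "[s, t]"]
    by (simp only: word_class_eq_iff insert_iff simp_thms)
  then have "same_order (edges G_con) x u"
    using same_order_expand[OF u(1) x(1), of "[s, t]"] same_order_sym by blast
  then have "word_class G_con x = word_class G_con u"
    by (rule word_class_eq_iff[OF x(1) u(1), THEN iffD2])
  moreover have "\<exists>x\<in>words G_con. s \<in> set x \<and>
      word_class G (expand s [s, t] u) = word_class G (expand s [s, t] x)"
    using u by blast
  ultimately show "class_contract (basis_elt (word_class G (expand s [s, t] u))) =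
      basis_elt (word_class G_con u)"
    unfolding class_contract_def linear_ext_basis_elt x_def by (simp only: if_True)
  have "\<not> (\<exists>x\<in>words G_con. s \<in> set x \<and>
      word_class G (expand s [t, s] u) = word_class G (expand s [s, t] x))"
  proof
    assume "\<exists>x\<in>words G_con. s \<in> set x \<and>
      word_class G (expand s [t, s] u) = word_class G (expand s [s, t] x)"
    then obtain x where x: "x \<in> words G_con" "s \<in> set x"
      "word_class G (expand s [t, s] u) = word_class G (expand s [s, t] x)" by blast
    then have "same_order (edges G) (expand s [t, s] u) (expand s [s, t] x)"
      using u(1) word_class_eq_iff[of "expand s [t, s] u" G "expand s [s, t] x"] expand_words by simp
    then show False
      using not_same_order_expand[OF x(1) u(1) x(2)] same_order_sym by blast
  qed
  then show "class_contract (basis_elt (word_class G (expand s [t, s] u))) = 0"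
    unfolding class_contract_def linear_ext_basis_elt by (simp only: if_False)
qed

lemma class_contract_add: "class_contract (a + b) = class_contract a + class_contract b"
  by (simp add: class_contract_def linear_ext_add)

lemma class_contract_blow_up:
  assumes "keys a \<subseteq> {u \<in> words G_con. s \<in> set u}"
  shows "class_contract (project_chain G (blow_up s t a)) = project_chain G_con a"
  using assms
proof (induction rule: chain_induct)
  case zero
  then show ?case by (simp add: class_contract_def)
next
  case (add u a)
  then have "class_contract (project_chain G (blow_up s t (basis_elt u))) = basis_elt (word_class G_con u)"
    by (simp add: blow_up_basis words_con project_chain_add class_contract_add class_contract_expand)
  then show ?case
    using add by (simp add: blow_up_add project_chain_add class_contract_add)
qed

section \<open>Exactness: chains of G that vanish in G - e are blow-ups\<close>

lemma project_chain_del_blow_up: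
  assumes "keys a \<subseteq> {u \<in> words G_con. s \<in> set u}"
  shows "project_chain G_del (blow_up s t a) = 0"
  using assms
proof (induction rule: chain_induct)
  case (add u a)
  then have "word_class G_del (expand s [s, t] u) = word_class G_del (expand s [t, s] u)"
    by (simp add: word_class_eq_iff expand_words same_order_del_expand)
  then show ?case
    using add by (simp add: blow_up_add project_chain_add blow_up_basis words_con)
qed simp

text \<open>Induction on the size of the support. Two distinct classes of the support must have the
  same image in the deletion; \<open>same_order_del_obtain\<close> presents their sum as the blow-up
  of one word, and removing both classes leaves a smaller kernel element.\<close>

lemma kernel_to_del:
  assumes "keys c \<subseteq> word_class G ` permutations_of_set (verts G)" "to_del c = 0"
  shows "\<exists>a \<in> word_chains (verts G - {t}). c = project_chain G (blow_up s t a)"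
  using assms
proof (induction "card (keys c)" arbitrary: c rule: less_induct)
  case less
  show ?case
  proof (cases "c = 0")
    case True
    then show ?thesis by (intro bexI[of _ 0]) auto
  next
    case False
    then obtain X where X: "X \<in> keys c" by (metis ex_in_conv keys_eq_empty)
    obtain Y where Y: "Y \<in> keys c" "Y \<noteq> X"
      "word_class G_del (SOME u. u \<in> Y) = word_class G_del (SOME u. u \<in> X)"
      using less.prems(2) X unfolding to_del_def by (rule linear_ext_eq_0_collision)
    obtain u v where uv: "u \<in> permutations_of_set (verts G)" "v \<in> permutations_of_set (verts G)"
      "X = word_class G u" "Y = word_class G v"
      using X Y(1) less.prems(1) by blast
    have uw: "u \<in> words G" "v \<in> words G"
      using uv permutations_of_set_words[of "verts G" G] by blast+
    have "to_del (project_chain G (basis_elt u)) = to_del (project_chain G (basis_elt v))"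
      using Y(3) uv(3,4) by (simp add: to_del_def)
    then have "project_chain G_del (basis_elt u) = project_chain G_del (basis_elt v)"
      using to_del_project_chain[of "basis_elt u"] to_del_project_chain[of "basis_elt v"] uw
      by (simp del: project_chain_basis)
    then have "word_class G_del u = word_class G_del v"
      by (metis lookup_single_eq lookup_single_not_eq project_chain_basis zero_neq_one)
    then have so: "same_order (edges G_del) u v"
      using uw word_class_eq_iff[of u G_del v] by simp
    have nso: "\<not> same_order (edges G) u v"
      using Y(2) uv(3,4) uw word_class_eq_iff by metis
    have set_uv: "set u = verts G" "set v = verts G"
      using uv by (auto dest: permutations_of_setD)
    have dist: "distinct u" "distinct v" using uw by (auto simp: words_def)
    \<comment> \<open>The words agree on all edges other than \<open>{s, t}\<close> but lie in
      different classes of \<open>G\<close>, so they orient this edge oppositely.\<close>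
    have "before u s t \<and> before v t s \<or> before v s t \<and> before u t s"
    proof (rule ccontr)
      assume no: "\<not> ?thesis"
      have tot: "before u s t \<or> before u t s" "before v s t \<or> before v t s"
        using before_total st set_uv by metis+
      have "before u s t = before v s t" "before u t s = before v t s"
        using no tot before_asym dist by metis+
      then have "before u a b = before v a b" if "{a, b} \<in> edges G" for a b
        using so that unfolding same_order_def deletion_def
        by (cases "{a, b} = {s, t}") (auto simp: doubleton_eq_iff)
      then show False
        using nso set_uv by (simp add: same_order_def)
    qed
    then have "\<exists>x. x \<in> words G_con \<and> set x = verts G - {t} \<and> s \<in> set x \<and>
        {X, Y} = {word_class G (expand s [s, t] x), word_class G (expand s [t, s] x)}"
    proof
      assume "before u s t \<and> before v t s"
      then obtain x where "x \<in> words G_con" "set x = set u - {t}" "s \<in> set x"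
        "same_order (edges G) u (expand s [s, t] x)" "same_order (edges G) v (expand s [t, s] x)"
        using same_order_del_obtain[OF uw so] by blast
      moreover from this have "X = word_class G (expand s [s, t] x)" "Y = word_class G (expand s [t, s] x)"
        unfolding uv(3,4) using uw expand_words by (simp_all add: word_class_eq_iff)
      ultimately show ?thesis using set_uv by blast
    next
      assume "before v s t \<and> before u t s"
      then obtain x where "x \<in> words G_con" "set x = set v - {t}" "s \<in> set x"
        "same_order (edges G) v (expand s [s, t] x)" "same_order (edges G) u (expand s [t, s] x)"
        using same_order_del_obtain[OF uw(2,1) same_order_sym[OF so]] by blast
      moreover from this have "Y = word_class G (expand s [s, t] x)" "X = word_class G (expand s [t, s] x)"
        unfolding uv(3,4) using uw expand_words by (simp_all add: word_class_eq_iff)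
      ultimately show ?thesis using set_uv by blast
    qed
    then obtain x where x: "x \<in> words G_con" "set x = verts G - {t}" "s \<in> set x"
      "{X, Y} = {word_class G (expand s [s, t] x), word_class G (expand s [t, s] x)}" by blast
    let ?b = "basis_elt x"
    have b: "project_chain G (blow_up s t ?b) = basis_elt X + basis_elt Y"
    proof -
      have "project_chain G (blow_up s t ?b) =
        basis_elt (word_class G (expand s [s, t] x)) + basis_elt (word_class G (expand s [t, s] x))"
        using x by (simp add: blow_up_basis words_con project_chain_add)
      then show ?thesis
        using x(4) Y(2) by (auto simp: doubleton_eq_iff add.commute)
    qed
    \<comment> \<open>Both classes have coefficient 1, so adding them removes them from the
      support.\<close>
    let ?c = "basis_elt X + (basis_elt Y + c)"
    have kc: "keys ?c = keys c - {Y} - {X}"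
      using X Y(1,2) by (simp add: keys_basis_add)
    have "to_del (basis_elt X + basis_elt Y) = 0"
      unfolding to_del_def linear_ext_add linear_ext_basis_elt Y(3) by simp
    then have "to_del ?c = 0"
      using less.prems(2) by (simp add: to_del_def linear_ext_add flip: add.assoc)
    moreover have "card (keys ?c) < card (keys c)"
      unfolding kc using X Y(1) by (intro psubset_card_mono) auto
    ultimately obtain a where a: "a \<in> word_chains (verts G - {t})" "?c = project_chain G (blow_up s t a)"
      using less.hyps[of ?c] less.prems(1) kc by blast
    have "c = (basis_elt X + basis_elt Y) + ?c"
      by (metis add.assoc bit_chain_add_self_left)
    also have "\<dots> = project_chain G (blow_up s t (?b + a))"
      by (simp only: a(2) b blow_up_add project_chain_add)
    finally have "c = project_chain G (blow_up s t (?b + a))" .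
    moreover have "x \<in> permutations_of_set (verts G - {t})"
      using x by (intro permutations_of_setI) (auto simp: words_def)
    then have "?b + a \<in> word_chains (verts G - {t})"
      using Poly_Mapping.keys_add[of ?b a] a(1) by auto
    ultimately show ?thesis by blast
  qed
qed

text \<open>\<open>U\<close> is empty for chains on all letters and a single letter for their
  partial boundaries.\<close>

lemma word_chains_con:
  assumes "a \<in> word_chains (verts G - {t} - U)" "s \<notin> U"
  shows "keys a \<subseteq> {u \<in> words G_con. s \<in> set u}"
proof
  fix u assume "u \<in> keys a"
  then have "u \<in> permutations_of_set (verts G - {t} - U)" using assms(1) by blast
  then have "set u = verts G - {t} - U" "distinct u"
    by (auto dest: permutations_of_setD)
  then show "u \<in> {u \<in> words G_con. s \<in> set u}"
    using st assms(2) by (simp add: words_def)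
qed

text \<open>A boundary concentrated at the contracted vertex consists of words avoiding that vertex,
  and on the remaining vertices contraction and extraction have the same edges.\<close>

lemma project_chain_con_eq_ext:
  assumes "a \<in> word_chains L" "L \<subseteq> verts G - {s, t}"
  shows "project_chain G_con a = project_chain G_ext a"
proof (rule project_chain_cong_words[OF assms(1)])
  fix e assume e: "e \<subseteq> L"
  have "e \<in> edges G_con" if "e \<in> edges G" "e \<inter> {s, t} = {}"
  proof -
    have "(\<lambda>u. if u = t then s else u) ` e = id ` e"
      using that(2) by (intro image_cong) auto
    then have "e \<in> (\<lambda>f. (\<lambda>u. if u = t then s else u) ` f) ` edges G"
      using that(1) by (intro image_eqI[of _ _ e]) simp_all
    then show ?thesis using that(2) by (auto simp: contraction_def)
  qed
  moreover have "e \<in> edges G" if con: "e \<in> edges G_con" "e \<inter> {s, t} = {}"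
  proof -
    obtain f where f: "f \<in> edges G" "e = (\<lambda>u. if u = t then s else u) ` f"
      using con(1) by (auto simp: contraction_def)
    have "t \<notin> f"
      using con(2) unfolding f(2) by auto
    then have "(\<lambda>u. if u = t then s else u) ` f = id ` f"
      by (intro image_cong) auto
    then show ?thesis using f by simp
  qed
  moreover have "e \<inter> {s, t} = {}" using e assms(2) by blast
  ultimately show "e \<in> edges G_con \<longleftrightarrow> e \<in> edges G_ext"
    by (auto simp: extraction_def)
qed (use assms(2) in auto)

text \<open>
  Removing \<open>s\<close> or \<open>t\<close> always annihilates a blown up chain, so of the conditions for a cycle only
  those for the other letters remain.
\<close>

lemma project_blow_up_top_homology_iff:
  assumes a: "a \<in> word_chains (verts G - {t})"
  shows "project_chain G (blow_up s t a) \<in> top_homology G \<longleftrightarrow>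
    (\<forall>v\<in>verts G - {s, t}. project_chain G_con (remove_letter v a) = 0)"
proof -
  have as: "keys a \<subseteq> {u \<in> words G_con. s \<in> set u}"
    using word_chains_con[of a "{}"] a by simp
  have "project_chain G (remove_letter v (blow_up s t a)) = 0" if "v \<in> {s, t}" for v
  proof -
    have "keys a \<subseteq> {u. s \<in> set u}" using as by blast
    then show ?thesis using remove_letter_blow_up_self[OF that, of a] by simp
  qed
  moreover have "project_chain G (remove_letter v (blow_up s t a)) = 0 \<longleftrightarrow>
      project_chain G_con (remove_letter v a) = 0" if v: "v \<in> verts G - {s, t}" for v
  proof -
    have rv: "keys (remove_letter v a) \<subseteq> {u \<in> words G_con. s \<in> set u}"
      using word_chains_con[of _ "{v}"] remove_letter_word_chains[OF a, of v] v by blast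
    then have rw: "keys (remove_letter v a) \<subseteq> words G_con" by blast
    have eq: "project_chain G (remove_letter v (blow_up s t a)) =
        project_chain G (blow_up s t (remove_letter v a))"
      using v by (simp add: remove_letter_blow_up)
    \<comment> \<open>Applying \<open>class_contract\<close> gives one implication and applying
      \<open>class_blow_up\<close> the other.\<close>
    show ?thesis
      unfolding eq
      using class_contract_blow_up[OF rv] class_blow_up_project_chain[OF rw]
      by (metis class_contract_0 class_blow_up_0)
  qed
  moreover have "verts G = insert s (insert t (verts G - {s, t}))" using st by blast
  ultimately show ?thesis
    using project_chain_top_homology_iff[OF graph blow_up_word_chains[OF a st(2,3,1)]]
    by blast
qed

lemma project_con_top_homology_iff:
  assumes a: "a \<in> word_chains (verts G - {t})"
  shows "project_chain G_con a \<in> top_homology G_con \<longleftrightarrow>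
    project_chain G (blow_up s t a) \<in> top_homology G \<and>
    project_chain G_con (remove_letter s a) = 0"
proof -
  have "verts G - {t} = insert s (verts G - {s, t})" using st by blast
  then show ?thesis
    unfolding project_blow_up_top_homology_iff[OF a]
    using project_chain_top_homology_iff[OF graph_con, of a] a by auto
qed

section \<open>The two-step filtration of the top homology\<close>

lemma class_blow_up_con_image:
  "{h \<in> {h \<in> top_homology G. to_del h = 0}. partial_boundary G_con s (class_contract h) = 0} =
   class_blow_up ` top_homology G_con" (is "?L = ?R")
proof
  have con: "keys a \<subseteq> {u \<in> words G_con. s \<in> set u}" "keys a \<subseteq> words G_con"
    if "a \<in> word_chains (verts G - {t})" for a
    using word_chains_con[of a "{}"] that by auto
  show "?L \<subseteq> ?R"
  proof
    fix h assume h: "h \<in> ?L"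
    then have "keys h \<subseteq> word_class G ` permutations_of_set (verts G)"
      by (auto simp: top_homology_def chains_def simp flip: boolean_rank_top[OF graph])
    moreover have "to_del h = 0" using h by simp
    ultimately obtain a where a: "a \<in> word_chains (verts G - {t})" "h = project_chain G (blow_up s t a)"
      using kernel_to_del by blast
    have "project_chain G_con (remove_letter s a) = 0"
      using h class_contract_blow_up[OF con(1)[OF a(1)]]
        partial_boundary_project_chain[OF con(2)[OF a(1)]] unfolding a(2) by simp
    then have "project_chain G_con a \<in> top_homology G_con"
      using h a project_con_top_homology_iff by blast
    then show "h \<in> ?R"
      using class_blow_up_project_chain[OF con(2)[OF a(1)]] a(2) by (metis imageI)
  qed
  show "?R \<subseteq> ?L"
  proof
    fix h assume "h \<in> ?R"
    then obtain z where z: "z \<in> top_homology G_con" "h = class_blow_up z" by blast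
    obtain a where "a \<in> word_chains (verts G_con)" and za: "z = project_chain G_con a"
      using top_homologyE[OF graph_con z(1)] .
    then have a: "a \<in> word_chains (verts G - {t})" by simp
    have h: "h = project_chain G (blow_up s t a)"
      using class_blow_up_project_chain[OF con(2)[OF a]] z(2) za by simp
    have top: "h \<in> top_homology G" "project_chain G_con (remove_letter s a) = 0"
      using project_con_top_homology_iff[OF a] z(1) za h by blast+
    have "blow_up s t a \<in> word_chains (verts G)"
      by (rule blow_up_word_chains[OF a st(2,3,1)])
    then have "to_del h = 0"
      using to_del_project_chain[of "blow_up s t a"] word_chains_words[of "verts G" G]
        project_chain_del_blow_up[OF con(1)[OF a]] h by auto
    moreover have "partial_boundary G_con s (class_contract h) = 0"
      unfolding h class_contract_blow_up[OF con(1)[OF a]]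
        partial_boundary_project_chain[OF con(2)[OF a]] by (rule top(2))
    ultimately show "h \<in> ?L" using top(1) by blast
  qed
qed

text \<open>\<open>F\<close> is abstract, which separates the linear algebra from the combinatorics
  of derangements. \<open>basis_family_extension\<close> is used twice: inside the kernel of
  \<open>to_del\<close>, with quotient given by the extraction, and then for \<open>to_del\<close>
  itself. The hypotheses on \<open>F\<close> say that the lifts are cycles of \<open>G\<close>; this
  makes the quotients full.\<close>

lemma basis_family_deletion_contraction_extraction:
  fixes F :: "'i \<Rightarrow> ('a list \<Rightarrow>\<^sub>0 bit)"
  assumes del: "basis_family (\<lambda>x. project_chain G_del (F x)) D0 (top_homology G_del)"
    and con: "basis_family (\<lambda>x. project_chain G_con (F1 x)) D1 (top_homology G_con)"
    and ext: "basis_family (\<lambda>x. project_chain G_ext (F2 x)) D2 (top_homology G_ext)"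
    and F: "\<And>x. x \<in> D0 \<Longrightarrow> F x \<in> word_chains (verts G)"
      "\<And>x. x \<in> D0 \<Longrightarrow> project_chain G (F x) \<in> top_homology G"
    and F1: "\<And>x. x \<in> D1 \<Longrightarrow> F1 x \<in> word_chains (verts G - {t})"
      "\<And>x. x \<in> D1 \<Longrightarrow> F (g1 x) = blow_up s t (F1 x)"
    and F2: "\<And>x. x \<in> D2 \<Longrightarrow> project_chain G (F (g2 x)) \<in> top_homology G"
      "\<And>x. x \<in> D2 \<Longrightarrow> \<exists>z \<in> word_chains (verts G - {t}).
        F (g2 x) = blow_up s t z \<and> remove_letter s z = F2 x"
  shows "basis_family (\<lambda>x. project_chain G (F x)) (D0 \<union> g1 ` D1 \<union> g2 ` D2) (top_homology G)"
proof -
  let ?f = "\<lambda>x. project_chain G (F x)"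
  let ?K = "{h \<in> top_homology G. to_del h = 0}"
  let ?q = "\<lambda>h. partial_boundary G_con s (class_contract h)"
  have cona: "keys a \<subseteq> {u \<in> words G_con. s \<in> set u}" "keys a \<subseteq> words G_con"
    if "a \<in> word_chains (verts G - {t})" for a
    using word_chains_con[of a "{}"] that by auto
  have to_del_add: "to_del (a + b) = to_del a + to_del b" for a b
    by (simp add: to_del_def linear_ext_add)
  have q_blow_up: "?q (project_chain G (blow_up s t a)) = project_chain G_ext (remove_letter s a)"
    if a: "a \<in> word_chains (verts G - {t})" for a
  proof -
    have "remove_letter s a \<in> word_chains (verts G - {s, t})"
      using remove_letter_word_chains[OF a, of s] by (simp add: Diff_insert2[symmetric] insert_commute)
    then show ?thesis
      unfolding class_contract_blow_up[OF cona(1)[OF a]]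
        partial_boundary_project_chain[OF cona(2)[OF a]]
      by (rule project_chain_con_eq_ext) simp
  qed
  have to_del_blow_up: "to_del (project_chain G (blow_up s t a)) = 0"
    if a: "a \<in> word_chains (verts G - {t})" for a
    using to_del_project_chain[OF word_chains_words[OF subset_refl blow_up_word_chains[OF a st(2,3,1)]]]
      project_chain_del_blow_up[OF cona(1)[OF a]] by simp
  have con_inj: "z = 0" if z: "z \<in> top_homology G_con" "class_blow_up z = 0" for z
  proof -
    obtain a where "a \<in> word_chains (verts G_con)" and za: "z = project_chain G_con a"
      using top_homologyE[OF graph_con z(1)] .
    then have a: "a \<in> word_chains (verts G - {t})" by simp
    then have "class_contract (class_blow_up z) = z"
      unfolding za class_blow_up_project_chain[OF cona(2)[OF a]]
      by (intro class_contract_blow_up cona)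
    then show ?thesis using z(2) by (simp add: class_contract_def)
  qed
  have "basis_family (\<lambda>x. class_blow_up (project_chain G_con (F1 x))) D1
      (class_blow_up ` top_homology G_con)"
    unfolding class_blow_up_def
    by (rule basis_family_linear_image[OF con]) (use con_inj in \<open>simp add: class_blow_up_def\<close>)
  also have "basis_family (\<lambda>x. class_blow_up (project_chain G_con (F1 x))) D1 =
      basis_family (\<lambda>x. ?f (g1 x)) D1"
    using F1 class_blow_up_project_chain cona(2) by (intro HOL.ext basis_family_cong) auto
  finally have ker: "basis_family ?f (g1 ` D1) {h \<in> ?K. ?q h = 0}"
    unfolding class_blow_up_con_image by (rule basis_family_image)
  have quot: "basis_family (\<lambda>x. ?q (?f x)) (g2 ` D2) (top_homology G_ext)"
  proof (rule basis_family_image)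
    \<comment> \<open>\<open>?q\<close> undoes the blow-up and deletes \<open>s\<close>, so on the
      blow-up of \<open>z\<close> it returns \<open>remove_letter s z\<close>.\<close>
    have "?q (?f (g2 x)) = project_chain G_ext (F2 x)" if "x \<in> D2" for x
      using F2(2)[OF that] q_blow_up by auto
    then show "basis_family (\<lambda>x. ?q (?f (g2 x))) D2 (top_homology G_ext)"
      using ext by (subst basis_family_cong) simp_all
  qed
  have K: "basis_family ?f (g2 ` D2 \<union> g1 ` D1) ?K"
  proof (rule basis_family_extension[where p = ?q, OF _ _ _ quot _ ker])
    show "a + b \<in> ?K" if "a \<in> ?K" "b \<in> ?K" for a b
      using that by (simp add: top_homology_add to_del_add)
    show "?q (a + b) = ?q a + ?q b" for a b
      by (simp add: class_contract_add partial_boundary_add)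
    show "?f x \<in> ?K" if "x \<in> g2 ` D2" for x
    proof -
      obtain y where y: "y \<in> D2" "x = g2 y" using \<open>x \<in> g2 ` D2\<close> by blast
      then obtain z where "z \<in> word_chains (verts G - {t})" "F x = blow_up s t z"
        using F2(2) by blast
      then have "to_del (?f x) = 0" using to_del_blow_up by simp
      moreover have "?f x \<in> top_homology G" using F2(1)[OF y(1)] y(2) by simp
      ultimately show ?thesis by simp
    qed
    show "?q h \<in> top_homology G_ext" if h: "h \<in> ?K" for h
    proof -
      have "keys h \<subseteq> word_class G ` permutations_of_set (verts G)"
        using h by (auto simp: top_homology_def chains_def simp flip: boolean_rank_top[OF graph])
      moreover have "to_del h = 0" using h by simp
      ultimately obtain a where a: "a \<in> word_chains (verts G - {t})" "h = project_chain G (blow_up s t a)"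
        using kernel_to_del by blast
      have ra: "remove_letter s a \<in> word_chains (verts G_ext)"
        using remove_letter_word_chains[OF a(1), of s]
        by (simp add: Diff_insert2[symmetric] insert_commute)
      \<comment> \<open>Deletions commute, and deleting \<open>v\<close> alone already gives zero in
        the contraction because the blow-up is a cycle.\<close>
      have "project_chain G_ext (remove_letter v (remove_letter s a)) = 0" if v: "v \<in> verts G_ext" for v
      proof -
        have "project_chain G_con (remove_letter v a) = 0"
          using h v project_blow_up_top_homology_iff[OF a(1)] unfolding a(2) by simp
        then have "partial_boundary G_con s (project_chain G_con (remove_letter v a)) = 0" by simp
        moreover have rva: "remove_letter v a \<in> word_chains (verts G_con - {v})"
          using remove_letter_word_chains[OF a(1), of v] by simp
        moreover have "remove_letter v (remove_letter s a) \<in> word_chains (verts G_ext - {v})"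
          by (rule remove_letter_word_chains[OF ra])
        ultimately show ?thesis
          using partial_boundary_project_chain[OF word_chains_words[OF Diff_subset rva], of s]
            project_chain_con_eq_ext[of "remove_letter v (remove_letter s a)" "verts G_ext - {v}"]
          by (simp add: remove_letter_commute[of s v])
      qed
      then show ?thesis
        unfolding a(2) q_blow_up[OF a(1)] project_chain_top_homology_iff[OF graph_ext ra] by blast
    qed
  qed
  have "to_del (?f x) = project_chain G_del (F x)" if "x \<in> D0" for x
    by (rule to_del_project_chain[OF word_chains_words[OF subset_refl F(1)[OF that]]])
  then have "basis_family (\<lambda>x. to_del (?f x)) D0 (top_homology G_del)"
    using del by (subst basis_family_cong) simp_all
  \<comment> \<open>Outer step: over \<open>D0\<close> the family lifts the basis of the deletion,
    and \<open>K\<close> provides the kernel.\<close>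
  then have "basis_family ?f (D0 \<union> (g2 ` D2 \<union> g1 ` D1)) (top_homology G)"
  proof (rule basis_family_extension[where p = to_del, OF _ _ _ _ _ K, rotated 3])
    show "a + b \<in> top_homology G" if "a \<in> top_homology G" "b \<in> top_homology G" for a b
      using that by (rule top_homology_add)
    show "to_del (a + b) = to_del a + to_del b" for a b by (rule to_del_add)
    show "?f x \<in> top_homology G" if "x \<in> D0" for x using that by (rule F(2))
    show "to_del h \<in> top_homology G_del" if h: "h \<in> top_homology G" for h
    proof -
      obtain a where a: "a \<in> word_chains (verts G)" and ha: "h = project_chain G a"
        using top_homologyE[OF graph h] .
      have "project_chain G_del (remove_letter v a) = 0" if v: "v \<in> verts G" for v
      proof -
        have "project_chain G (remove_letter v a) = 0"
          using project_chain_top_homology_iff[OF graph a] h ha v by blast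
        then show ?thesis
          using to_del_project_chain[OF word_chains_words[OF Diff_subset remove_letter_word_chains[OF a]], of v]
          by (simp add: to_del_def)
      qed
      then show ?thesis
        using to_del_project_chain[OF word_chains_words[OF subset_refl a]]
          project_chain_top_homology_iff[OF graph_del, of a] a ha by simp
    qed
  qed
  moreover have "D0 \<union> (g2 ` D2 \<union> g1 ` D1) = D0 \<union> g1 ` D1 \<union> g2 ` D2" by blast
  ultimately show ?thesis by simp
qed

end

section \<open>Products of word chains\<close>

lemma concat_prod_basis:
  "concat_prod (basis_elt u) (basis_elt v) =
     (if set u \<inter> set v = {} then basis_elt (u @ v) else 0)"
  by (simp add: concat_prod_def)

lemma concat_prod_add_left: "concat_prod (a + b) c = concat_prod a c + concat_prod b c"
  by (simp add: concat_prod_def linear_ext_add)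

lemma concat_prod_add_right: "concat_prod c (a + b) = concat_prod c a + concat_prod c b"
  by (simp add: concat_prod_def linear_ext_add linear_ext_add_fun)

lemma concat_prod_0 [simp]: "concat_prod 0 a = 0" "concat_prod a 0 = 0"
  by (simp_all add: concat_prod_def)

lemma concat_prod_induct [consumes 2, case_names zero_left add_left zero_right add_right basis]:
  assumes "keys a \<subseteq> A" "keys b \<subseteq> B"
    and "\<And>b. P 0 b" "\<And>a a' b. P a b \<Longrightarrow> P a' b \<Longrightarrow> P (a + a') b"
    and "\<And>a. P a 0" "\<And>a b b'. P a b \<Longrightarrow> P a b' \<Longrightarrow> P a (b + b')"
    and "\<And>u v. u \<in> A \<Longrightarrow> v \<in> B \<Longrightarrow> P (basis_elt u) (basis_elt v)"
  shows "P a b"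
proof -
  have "P (basis_elt u) b" if "u \<in> A" for u
    using assms(2) by (induction rule: chain_induct) (use that assms in auto)
  then show ?thesis
    using assms(1) by (induction rule: chain_induct[consumes 1, OF assms(1)]) (use assms in auto)
qed

lemma concat_prod_one [simp]: "concat_prod (basis_elt []) a = a" "concat_prod a (basis_elt []) = a"
  using subset_refl[of "keys a"]
  by (induction rule: chain_induct)
    (simp_all add: concat_prod_add_left concat_prod_add_right concat_prod_basis)

lemma word_chains_0 [simp]: "0 \<in> word_chains L"
  by simp

lemma word_chains_add: "a \<in> word_chains L \<Longrightarrow> b \<in> word_chains L \<Longrightarrow> a + b \<in> word_chains L"
  using Poly_Mapping.keys_add[of a b] by auto

lemma word_chains_basis: "distinct u \<Longrightarrow> basis_elt u \<in> word_chains (set u)"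
  by (simp add: permutations_of_set_def)

lemma concat_prod_word_chains:
  assumes "a \<in> word_chains L" "b \<in> word_chains M" "L \<inter> M = {}"
  shows "concat_prod a b \<in> word_chains (L \<union> M)"
proof -
  have "keys a \<subseteq> permutations_of_set L" "keys b \<subseteq> permutations_of_set M"
    using assms by simp_all
  then show ?thesis
  proof (induction rule: concat_prod_induct)
    case (basis u v)
    then show ?case
      using assms(3) by (auto simp: concat_prod_basis permutations_of_set_def)
  next
    case (add_left a a' b)
    then show ?case unfolding concat_prod_add_left by (rule word_chains_add)
  next
    case (add_right a b b')
    then show ?case unfolding concat_prod_add_right by (rule word_chains_add)
  qed simp_all
qed

text \<open>A single deletion is multiplicative, not a derivation, because it fixes the factor
  without \<open>v\<close>. Disjointness matters: factors sharing only \<open>v\<close> multiply to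
  zero, but no longer do so once \<open>v\<close> is deleted.\<close>

lemma remove_letter_concat_prod:
  assumes "a \<in> word_chains L" "b \<in> word_chains M" "L \<inter> M = {}"
  shows "remove_letter v (concat_prod a b) = concat_prod (remove_letter v a) (remove_letter v b)"
proof -
  have "keys a \<subseteq> permutations_of_set L" "keys b \<subseteq> permutations_of_set M"
    using assms by simp_all
  then show ?thesis
  proof (induction rule: concat_prod_induct)
    case (basis u w)
    then have "set u = L" "set w = M" by (auto dest: permutations_of_setD)
    then have "set u \<inter> set w = {}" "set (removeAll v u) \<inter> set (removeAll v w) = {}"
      using assms(3) by auto
    then show ?case by (simp add: concat_prod_basis)
  qed (simp_all add: concat_prod_add_left concat_prod_add_right remove_letter_add)
qed

lemma remove_letter_notin:
  assumes "a \<in> word_chains L" "v \<notin> L"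
  shows "remove_letter v a = a"
proof -
  have "keys a \<subseteq> permutations_of_set L" using assms(1) by simp
  then show ?thesis
  proof (induction rule: chain_induct)
    case (add u a)
    then have "v \<notin> set u" using assms(2) by (auto dest: permutations_of_setD)
    then show ?case using add by (simp add: remove_letter_add)
  qed simp
qed

lemma blow_up_notin:
  assumes "a \<in> word_chains L" "s \<notin> L" "t \<notin> L"
  shows "blow_up s t a = a"
proof -
  have "keys a \<subseteq> permutations_of_set L" using assms(1) by simp
  then show ?thesis
  proof (induction rule: chain_induct)
    case (add u a)
    then have "s \<notin> set u" "t \<notin> set u" using assms by (auto dest: permutations_of_setD)
    then show ?case using add by (simp add: blow_up_add blow_up_basis)
  qed simp
qed

text \<open>Holds for arbitrary factors because both sides vanish together: a word containing
  \<open>t\<close> is sent to zero, and two words containing \<open>s\<close> still share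
  \<open>s\<close> after any expansion.\<close>

lemma blow_up_concat_prod:
  assumes "s \<noteq> t"
  shows "blow_up s t (concat_prod a b) = concat_prod (blow_up s t a) (blow_up s t b)"
  using subset_UNIV[of "keys a"] subset_UNIV[of "keys b"]
proof (induction rule: concat_prod_induct)
  case (basis u v)
  consider "t \<in> set u \<union> set v" | "t \<notin> set u" "t \<notin> set v" "s \<in> set u" "s \<in> set v"
    | "t \<notin> set u" "t \<notin> set v" "s \<notin> set u" | "t \<notin> set u" "t \<notin> set v" "s \<notin> set v" by blast
  then show ?case
  proof cases
    case 1
    then show ?thesis by (auto simp: blow_up_basis concat_prod_basis)
  next
    case 2
    then have "s \<in> set (expand s ys u) \<inter> set (expand s zs v)" if "s \<in> set ys" "s \<in> set zs" for ys zs
      using that by (auto simp: set_expand)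
    then have "set (expand s ys u) \<inter> set (expand s zs v) \<noteq> {}" if "s \<in> set ys" "s \<in> set zs" for ys zs
      using that by blast
    moreover have "set u \<inter> set v \<noteq> {}" using 2 by blast
    ultimately show ?thesis
      using 2 by (simp add: blow_up_basis concat_prod_basis concat_prod_add_left concat_prod_add_right)
  next
    case 3
    have "set u \<inter> set (expand s ys v) = set u \<inter> set v" if "set ys = {s, t}" for ys
      using 3 that by (auto simp: set_expand)
    from this[of "[s, t]"] this[of "[t, s]"] show ?thesis
      using 3 by (auto simp: blow_up_basis concat_prod_basis concat_prod_add_right expand_notin
          insert_commute)
  next
    case 4
    have "set (expand s ys u) \<inter> set v = set u \<inter> set v" if "set ys = {s, t}" for ys
      using 4 that by (auto simp: set_expand)
    from this[of "[s, t]"] this[of "[t, s]"] show ?thesis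
      using 4 by (auto simp: blow_up_basis concat_prod_basis concat_prod_add_left expand_notin
          insert_commute)
  qed
qed (simp_all add: concat_prod_add_left concat_prod_add_right blow_up_add)

lemma blow_up_diamond:
  "s \<noteq> t \<Longrightarrow> blow_up s t (diamond a b) = diamond (blow_up s t a) (blow_up s t b)"
  by (simp add: diamond_def blow_up_add blow_up_concat_prod)

definition word_product :: "('a list \<Rightarrow>\<^sub>0 bit) list \<Rightarrow> ('a list \<Rightarrow>\<^sub>0 bit)" where
  "word_product Qs = foldr concat_prod Qs (basis_elt [])"

lemma word_product_simps [simp]:
  "word_product [] = basis_elt []"
  "word_product (Q # Qs) = concat_prod Q (word_product Qs)"
  by (simp_all add: word_product_def)

lemma word_product_one [simp]: "word_product (xs @ basis_elt [] # ys) = word_product (xs @ ys)"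
  by (induction xs) simp_all

lemma word_product_zero: "0 \<in> set Qs \<Longrightarrow> word_product Qs = 0"
  by (induction Qs) auto

lemma blow_up_word_product:
  "s \<noteq> t \<Longrightarrow> blow_up s t (word_product Qs) = word_product (map (blow_up s t) Qs)"
  by (induction Qs) (simp_all add: blow_up_concat_prod blow_up_basis)

lemma word_product_word_chains:
  assumes "distinct (concat cs)" "\<And>c. c \<in> set cs \<Longrightarrow> f c \<in> word_chains (set c)"
  shows "word_product (map f cs) \<in> word_chains (set (concat cs))"
  using assms
proof (induction cs)
  case Nil
  then show ?case using word_chains_basis[of "[]"] by simp
next
  case (Cons c cs)
  then have "concat_prod (f c) (word_product (map f cs)) \<in> word_chains (set c \<union> set (concat cs))"
    by (intro concat_prod_word_chains) auto
  then show ?case by simp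
qed

lemma remove_letter_word_product:
  assumes "distinct (concat cs)" "\<And>c. c \<in> set cs \<Longrightarrow> f c \<in> word_chains (set c)"
  shows "remove_letter v (word_product (map f cs)) = word_product (map (\<lambda>c. remove_letter v (f c)) cs)"
  using assms
proof (induction cs)
  case (Cons c cs)
  have "remove_letter v (concat_prod (f c) (word_product (map f cs))) =
      concat_prod (remove_letter v (f c)) (remove_letter v (word_product (map f cs)))"
  proof (rule remove_letter_concat_prod)
    show "f c \<in> word_chains (set c)" using Cons.prems by simp
    show "word_product (map f cs) \<in> word_chains (set (concat cs))"
      by (rule word_product_word_chains) (use Cons.prems in auto)
    show "set c \<inter> set (concat cs) = {}" using Cons.prems by simp
  qed
  then show ?case using Cons by simp
qed simp

section \<open>Evaluation of cycles\<close>

abbreviation letter_quantities :: "'a list \<Rightarrow> ('a \<times> ('a list \<Rightarrow>\<^sub>0 bit)) list" where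
  "letter_quantities \<equiv> map (\<lambda>a. (a, basis_elt [a]))"

section \<open>Evaluating stars on a list of quantities\<close>

lemma eval_star_notin: "c \<notin> fst ` set (tl xs) \<Longrightarrow> eval_star c xs = xs"
  by (induction c xs rule: eval_star.induct) auto

text \<open>The first quantity has no star on its left, so its letter survives even if it equals
  \<open>c\<close>.\<close>

lemma map_fst_eval_star:
  "distinct (map fst xs) \<Longrightarrow>
    map fst (eval_star c xs) = take 1 (map fst xs) @ filter (\<lambda>x. x \<noteq> c) (tl (map fst xs))"
proof (induction c xs rule: eval_star.induct)
  case (1 c a Q b R xs)
  then show ?case by (auto intro!: filter_True[symmetric])
qed auto

lemma distinct_eval_star: "distinct (map fst xs) \<Longrightarrow> distinct (map fst (eval_star c xs))"
  by (cases xs) (auto simp: map_fst_eval_star)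

lemma map_fst_fold_eval_star:
  "distinct (map fst xs) \<Longrightarrow>
    map fst (fold eval_star L xs) =
      take 1 (map fst xs) @ filter (\<lambda>x. x \<notin> set L) (tl (map fst xs))"
proof (induction L arbitrary: xs)
  case Nil
  then show ?case by (cases xs) auto
next
  case (Cons c L)
  show ?case
    using Cons.IH[OF distinct_eval_star[OF Cons.prems]] map_fst_eval_star[OF Cons.prems, of c]
    by (cases xs) (auto intro: filter_cong)
qed

lemma fst_hd_eval_star: "distinct (map fst xs) \<Longrightarrow> xs \<noteq> [] \<Longrightarrow>
  eval_star c xs \<noteq> [] \<and> fst (hd (eval_star c xs)) = fst (hd xs)"
  using map_fst_eval_star[of xs c] by (cases xs; cases "eval_star c xs") auto

lemma eval_star_append:
  "distinct (map fst (xs @ ys)) \<Longrightarrow> ys \<noteq> [] \<longrightarrow> fst (hd ys) \<noteq> c \<Longrightarrow>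
    eval_star c (xs @ ys) = eval_star c xs @ eval_star c ys"
proof (induction c xs rule: eval_star.induct)
  case (1 c a Q b R xs)
  show ?case
  proof (cases "b = c")
    case True
    then have "c \<notin> fst ` set (tl ys)"
      using 1(2) by (cases ys) auto
    then show ?thesis using True by (simp add: eval_star_notin)
  next
    case False
    then show ?thesis using 1 by simp
  qed
next
  case ("2_1" c)
  then show ?case by simp
next
  case ("2_2" c x)
  then show ?case by (cases x; cases ys) auto
qed

text \<open>No star stands at the junction, because the first letter of the second part is not
  evaluated; so the two parts, later different cycles, do not interact.\<close>

lemma fold_eval_star_append:
  "distinct (map fst (xs @ ys)) \<Longrightarrow> ys \<noteq> [] \<longrightarrow> fst (hd ys) \<notin> set L \<Longrightarrow>
    fold eval_star L (xs @ ys) = fold eval_star L xs @ fold eval_star L ys"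
proof (induction L arbitrary: xs ys)
  case (Cons c L)
  have app: "eval_star c (xs @ ys) = eval_star c xs @ eval_star c ys"
    using Cons.prems by (intro eval_star_append) auto
  have "fold eval_star L (eval_star c xs @ eval_star c ys) =
      fold eval_star L (eval_star c xs) @ fold eval_star L (eval_star c ys)"
  proof (rule Cons.IH)
    show "distinct (map fst (eval_star c xs @ eval_star c ys))"
      unfolding app[symmetric] by (rule distinct_eval_star[OF Cons.prems(1)])
    show "eval_star c ys \<noteq> [] \<longrightarrow> fst (hd (eval_star c ys)) \<notin> set L"
      using Cons.prems fst_hd_eval_star[of ys c] by (cases "ys = []") auto
  qed
  then show ?case using app by simp
qed simp

text \<open>Evaluation touches the quantities only through \<open>diamond\<close>. It will be
  applied with a blow-up as \<open>h\<close>.\<close>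

lemma fold_eval_star_map:
  assumes "\<And>Q R. h (diamond Q R) = diamond (h Q) (h R)"
  shows "fold eval_star L (map (apsnd h) xs) = map (apsnd h) (fold eval_star L xs)"
proof -
  have "eval_star c (map (apsnd h) xs) = map (apsnd h) (eval_star c xs)" for c xs
    by (induction c xs rule: eval_star.induct) (auto simp: assms)
  then show ?thesis by (induction L arbitrary: xs) simp_all
qed

text \<open>\<open>L\<close> is meant to be the order of all stars of the permutation, so that one
  fold serves every cycle; letters outside \<open>c\<close> have no effect.\<close>

definition cycle_value :: "'a list \<Rightarrow> 'a list \<Rightarrow> ('a list \<Rightarrow>\<^sub>0 bit)" where
  "cycle_value L c = snd (hd (fold eval_star L (letter_quantities c)))"

lemma fold_eval_star_cycle:
  assumes "distinct c" "c \<noteq> []" "set (tl c) \<subseteq> set L"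
  shows "fold eval_star L (letter_quantities c) = [(hd c, cycle_value L c)]"
proof -
  have map_id: "map fst (letter_quantities c) = c" by (simp add: comp_def)
  then have "map fst (fold eval_star L (letter_quantities c)) =
      take 1 c @ filter (\<lambda>x. x \<notin> set L) (tl c)"
    using map_fst_fold_eval_star[of "letter_quantities c" L] assms(1) by simp
  also have "filter (\<lambda>x. x \<notin> set L) (tl c) = []"
    using assms(3) by (auto simp: filter_empty_conv)
  also have "take 1 c @ [] = [hd c]"
    using assms(2) by (cases c) auto
  finally show ?thesis
    unfolding cycle_value_def by (cases "fold eval_star L (letter_quantities c)") auto
qed

lemma fold_eval_star_concat:
  assumes "distinct (concat cs)" "\<And>c. c \<in> set cs \<Longrightarrow> c \<noteq> [] \<and> hd c \<notin> set L \<and> set (tl c) \<subseteq> set L"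
  shows "fold eval_star L (letter_quantities (concat cs)) = map (\<lambda>c. (hd c, cycle_value L c)) cs"
  using assms
proof (induction cs)
  case Nil
  have "fold eval_star L [] = []" by (induction L) auto
  then show ?case by simp
next
  case (Cons c cs)
  have ids: "map fst (letter_quantities u) = u" for u :: "'a list" by (simp add: comp_def)
  have "fold eval_star L (letter_quantities c @ letter_quantities (concat cs)) =
     fold eval_star L (letter_quantities c) @ fold eval_star L (letter_quantities (concat cs))"
  proof (rule fold_eval_star_append)
    show "distinct (map fst (letter_quantities c @ letter_quantities (concat cs)))"
      unfolding map_append ids using Cons.prems(1) by simp
    show "letter_quantities (concat cs) \<noteq> [] \<longrightarrow>
        fst (hd (letter_quantities (concat cs))) \<notin> set L"
      using Cons.prems(2) by (cases cs) (auto simp: hd_append hd_map)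
  qed
  then show ?case
    using Cons fold_eval_star_cycle[of c L] by simp
qed

text \<open>The invariant of the evaluation. Deleting the letter of a one-letter quantity gives the
  unit \<open>basis_elt []\<close>; as soon as two letters are joined, all deletions vanish.\<close>

definition nearly_closed :: "'a set \<Rightarrow> ('a list \<Rightarrow>\<^sub>0 bit) \<Rightarrow> bool" where
  "nearly_closed L Q \<longleftrightarrow> L \<noteq> {} \<and> Q \<in> word_chains L \<and>
     (\<forall>v\<in>L. remove_letter v Q = (if L = {v} then basis_elt [] else 0))"

text \<open>Deletion is multiplicative, and after it one of the two factors is 0 or the unit. Both
  commute with everything, so the commutator \<open>diamond\<close> vanishes.\<close>

lemma nearly_closed_diamond:
  assumes Q: "nearly_closed L Q" and R: "nearly_closed M R" and disj: "L \<inter> M = {}"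
  shows "nearly_closed (L \<union> M) (diamond Q R)"
proof -
  have wc: "Q \<in> word_chains L" "R \<in> word_chains M"
    using Q R by (simp_all add: nearly_closed_def)
  have disj': "M \<inter> L = {}" using disj by blast
  have closed: "diamond Q R \<in> word_chains (L \<union> M)"
    unfolding diamond_def
    using concat_prod_word_chains[OF wc disj] concat_prod_word_chains[OF wc(2,1) disj']
    by (intro word_chains_add) (simp_all add: Un_commute)
  have zero: "remove_letter v (diamond Q R) = 0" if "v \<in> L \<union> M" for v
  proof -
    have eq: "remove_letter v (diamond Q R) =
        concat_prod (remove_letter v Q) (remove_letter v R) +
        concat_prod (remove_letter v R) (remove_letter v Q)"
      unfolding diamond_def remove_letter_add
        remove_letter_concat_prod[OF wc disj] remove_letter_concat_prod[OF wc(2,1) disj'] ..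
    have "remove_letter v Q \<in> {0, basis_elt []} \<or> remove_letter v R \<in> {0, basis_elt []}"
      using that Q R by (auto simp: nearly_closed_def split: if_splits)
    then show ?thesis unfolding eq by auto
  qed
  have ne: "L \<noteq> {}" "M \<noteq> {}"
    using Q R unfolding nearly_closed_def by blast+
  have not_singleton: "L \<union> M \<noteq> {v}" for v
  proof
    assume "L \<union> M = {v}"
    then have "L = {v}" "M = {v}" using ne by auto
    with disj show False by simp
  qed
  show ?thesis
    unfolding nearly_closed_def
  proof (intro conjI ballI)
    show "L \<union> M \<noteq> {}" using ne by blast
    show "diamond Q R \<in> word_chains (L \<union> M)" by (rule closed)
    show "remove_letter v (diamond Q R) = (if L \<union> M = {v} then basis_elt [] else 0)"
      if "v \<in> L \<union> M" for v
      unfolding zero[OF that] by (simp only: not_singleton if_False)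
  qed
qed

fun covers :: "'a set \<Rightarrow> ('a \<times> ('a list \<Rightarrow>\<^sub>0 bit)) list \<Rightarrow> bool" where
  "covers L [] \<longleftrightarrow> L = {}"
| "covers L (x # xs) \<longleftrightarrow>
     (\<exists>M N. L = M \<union> N \<and> M \<inter> N = {} \<and> nearly_closed M (snd x) \<and> covers N xs)"

lemma covers_ConsI:
  "M \<inter> N = {} \<Longrightarrow> nearly_closed M (snd x) \<Longrightarrow> covers N xs \<Longrightarrow> covers (M \<union> N) (x # xs)"
  unfolding covers.simps by blast

lemma covers_ConsE:
  assumes "covers L (x # xs)"
  obtains M N where "L = M \<union> N" "M \<inter> N = {}" "nearly_closed M (snd x)" "covers N xs"
  using assms unfolding covers.simps by blast

text \<open>A star merges two neighbouring blocks of letters, to which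
  \<open>nearly_closed_diamond\<close> applies.\<close>

lemma covers_eval_star: "covers L xs \<Longrightarrow> covers L (eval_star c xs)"
proof (induction c xs arbitrary: L rule: eval_star.induct)
  case (1 c a Q b R xs)
  obtain M N where L: "L = M \<union> N" "M \<inter> N = {}" "nearly_closed M Q" "covers N ((b, R) # xs)"
    by (rule covers_ConsE[OF 1(2), unfolded snd_conv])
  show ?case
  proof (cases "b = c")
    case True
    obtain N' N'' where N: "N = N' \<union> N''" "N' \<inter> N'' = {}" "nearly_closed N' R" "covers N'' xs"
      by (rule covers_ConsE[OF L(4), unfolded snd_conv])
    have "nearly_closed (M \<union> N') (diamond Q R)"
      using L(2,3) N(1,3) by (intro nearly_closed_diamond) blast+
    then have "covers ((M \<union> N') \<union> N'') ((a, diamond Q R) # xs)"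
      using L(2) N(1,2,4) by (intro covers_ConsI) (simp_all, blast)
    then show ?thesis using True L(1) N(1) by (simp only: eval_star.simps if_True Un_assoc simp_thms)
  next
    case False
    have "covers (M \<union> N) ((a, Q) # eval_star c ((b, R) # xs))"
      using 1(1)[OF False L(4)] L(2,3) by (intro covers_ConsI) (simp_all only: snd_conv)
    then show ?thesis
      using False L(1) by (simp only: eval_star.simps if_False)
  qed
qed auto

lemma covers_letter_quantities: "distinct c \<Longrightarrow> covers (set c) (letter_quantities c)"
proof (induction c)
  case (Cons a c)
  have "nearly_closed {a} (basis_elt [a])"
    using word_chains_basis[of "[a]"] by (simp add: nearly_closed_def)
  then have "covers ({a} \<union> set c) ((a, basis_elt [a]) # letter_quantities c)"
    using Cons by (intro covers_ConsI) simp_all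
  then show ?case by simp
qed simp

lemma nearly_closed_cycle_value:
  assumes "distinct c" "c \<noteq> []" "set (tl c) \<subseteq> set L"
  shows "nearly_closed (set c) (cycle_value L c)"
proof -
  have "covers M xs \<Longrightarrow> covers M (fold eval_star L xs)" for M xs
    by (induction L arbitrary: xs) (simp_all add: covers_eval_star)
  from this[OF covers_letter_quantities[OF assms(1)]]
  show ?thesis unfolding fold_eval_star_cycle[OF assms] by auto
qed

lemma cycle_value_word_chains:
  assumes "distinct c" "c \<noteq> []" "set (tl c) \<subseteq> set L"
  shows "cycle_value L c \<in> word_chains (set c)"
  using nearly_closed_cycle_value[OF assms] by (simp add: nearly_closed_def)

lemma cycle_value_singleton: "cycle_value L [a] = basis_elt [a]"
proof -
  have "fold eval_star L [(a, basis_elt [a])] = [(a, basis_elt [a])]"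
    by (induction L) auto
  then show ?thesis by (simp add: cycle_value_def)
qed

section \<open>Standard cycle forms\<close>

text \<open>A local description of a cycle written out from its head. Unlike \<open>support\<close>,
  which refers to the least returning power of \<open>w\<close>, it can be checked letter by letter
  after an insertion.\<close>

definition cyclic_list :: "('a \<Rightarrow> 'a) \<Rightarrow> 'a list \<Rightarrow> bool" where
  "cyclic_list w u \<longleftrightarrow>
     u \<noteq> [] \<and> distinct u \<and> successively (\<lambda>a b. b = w a) u \<and> w (last u) = hd u"

lemma successively_nth_funpow:
  "successively (\<lambda>a b. b = w a) u \<Longrightarrow> i < length u \<Longrightarrow> u ! i = (w ^^ i) (hd u)"
proof (induction u arbitrary: i)
  case (Cons a u)
  show ?case
  proof (cases i)
    case (Suc j)
    then have "u \<noteq> []" "hd u = w a" "u ! j = (w ^^ j) (hd u)"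
      using Cons by (auto simp: successively_Cons)
    then show ?thesis using Suc by (simp add: funpow_swap1)
  qed simp
qed simp

lemma cyclic_list_funpow_length:
  assumes "cyclic_list w u"
  shows "(w ^^ length u) (hd u) = hd u"
proof -
  have u: "u \<noteq> []" "successively (\<lambda>a b. b = w a) u" "w (last u) = hd u"
    using assms by (auto simp: cyclic_list_def)
  then have "last u = (w ^^ (length u - 1)) (hd u)"
    using successively_nth_funpow[of w u "length u - 1"] by (simp add: last_conv_nth)
  moreover have "length u = Suc (length u - 1)" using u(1) by (cases u) auto
  ultimately show ?thesis using u(3) by (metis comp_apply funpow.simps(2))
qed

text \<open>Returning to the head in fewer than \<open>length u\<close> steps would repeat a letter,
  so the least power is the length.\<close>

lemma support_eq_cyclic_list:
  assumes "cyclic_list w u"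
  shows "support w (hd u) = u"
proof -
  have u: "u \<noteq> []" "distinct u" "successively (\<lambda>a b. b = w a) u"
    using assms by (auto simp: cyclic_list_def)
  have "least_power w (hd u) = length u"
    unfolding least_power_def
  proof (rule Least_equality)
    show "(w ^^ length u) (hd u) = hd u \<and> 0 < length u"
      using cyclic_list_funpow_length[OF assms] u(1) by simp
    fix n assume n: "(w ^^ n) (hd u) = hd u \<and> 0 < n"
    show "length u \<le> n"
    proof (rule ccontr)
      assume "\<not> length u \<le> n"
      then have "n < length u" by simp
      moreover from this have "u ! n = u ! 0"
        using n successively_nth_funpow[OF u(3), of n] u(1) by (simp add: hd_conv_nth)
      ultimately show False
        using n u(1,2) nth_eq_iff_index_eq[of u n 0] by auto
    qed
  qed
  then show ?thesis
    using successively_nth_funpow[OF u(3)] by (auto intro: nth_equalityI)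
qed

lemma orbit_eq_cyclic_list:
  assumes "cyclic_list w u"
  shows "orbit w (hd u) = set u"
proof
  have u: "u \<noteq> []" "successively (\<lambda>a b. b = w a) u"
    using assms by (auto simp: cyclic_list_def)
  have closed: "w x \<in> set u" if x: "x \<in> set u" for x
  proof -
    obtain i where i: "i < length u" "x = u ! i" using x by (auto simp: in_set_conv_nth)
    then have wx: "w x = (w ^^ Suc i) (hd u)"
      using successively_nth_funpow[OF u(2)] by simp
    show ?thesis
    proof (cases "Suc i = length u")
      case True
      then show ?thesis using wx cyclic_list_funpow_length[OF assms] u(1) by simp
    next
      case False
      then have "Suc i < length u" using i(1) by simp
      then show ?thesis using wx successively_nth_funpow[OF u(2), of "Suc i"] by (metis nth_mem)
    qed
  qed
  show "orbit w (hd u) \<subseteq> set u"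
  proof
    fix x assume "x \<in> orbit w (hd u)"
    then show "x \<in> set u"
      by induction (use closed u(1) in auto)
  qed
  show "set u \<subseteq> orbit w (hd u)"
  proof
    fix x assume "x \<in> set u"
    then obtain i where i: "i < length u" "x = u ! i" by (auto simp: in_set_conv_nth)
    then have x: "x = (w ^^ i) (hd u)"
      using successively_nth_funpow[OF u(2)] by simp
    \<comment> \<open>\<open>orbit\<close> consists of the positive iterates, so the head itself is
      reached by going round once.\<close>
    show "x \<in> orbit w (hd u)"
    proof (cases "i = 0")
      case True
      then have "x = (w ^^ length u) (hd u)"
        using x cyclic_list_funpow_length[OF assms] by simp
      moreover have "0 < length u" using u(1) by simp
      ultimately show ?thesis unfolding orbit_altdef by blast
    next
      case False
      then show ?thesis using x unfolding orbit_altdef by blast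
    qed
  qed
qed

lemma cyclic_list_support:
  assumes "permutation w"
  shows "cyclic_list w (support w m)" "hd (support w m) = m"
proof -
  let ?n = "least_power w m"
  have n: "(w ^^ ?n) m = m" "0 < ?n"
    using least_power_of_permutation[OF assms] by blast+
  then show hd: "hd (support w m) = m"
    by (simp add: hd_map)
  have "successively (\<lambda>a b. b = w a) (support w m)"
    unfolding successively_conv_nth by simp
  moreover have "w (last (support w m)) = m"
  proof -
    have "last (support w m) = (w ^^ (?n - 1)) m"
      using n(2) by (simp add: last_map)
    then show ?thesis using n by (metis Suc_diff_1 comp_apply funpow.simps(2))
  qed
  moreover have "support w m \<noteq> []" using n(2) by simp
  ultimately show "cyclic_list w (support w m)"
    unfolding cyclic_list_def hd using cycle_of_permutation[OF assms, of m] by blast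
qed

definition cycle_minima :: "'a::linorder set \<Rightarrow> ('a \<Rightarrow> 'a) \<Rightarrow> 'a set" where
  "cycle_minima V w = {m \<in> V. \<forall>x\<in>orbit w m. m \<le> x}"

lemma standard_cycle_form_altdef:
  "standard_cycle_form V w = map (support w) (sorted_list_of_set (cycle_minima V w))"
  by (simp add: standard_cycle_form_def cycle_minima_def)

context
  fixes V :: "'a::linorder set" and w
  assumes fin: "finite V" and perm: "w permutes V"
begin

lemma permutation: "permutation w"
  using fin perm permutation_permutes by blast

lemma set_support: "set (support w m) = orbit w m"
  using orbit_eq_cyclic_list[OF cyclic_list_support(1)[OF permutation]]
    cyclic_list_support(2)[OF permutation] by metis

lemma orbit_subset: "m \<in> V \<Longrightarrow> orbit w m \<subseteq> V"
  using perm by (rule permutes_orbit_subset)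

lemma self_in_orbit: "m \<in> orbit w m"
  by (rule permutation_self_in_orbit[OF permutation])

lemma orbit_eq: "x \<in> orbit w m \<Longrightarrow> orbit w x = orbit w m"
  using orbit_trans orbit_swap self_in_orbit by fast

lemma finite_cycle_minima: "finite (cycle_minima V w)"
  using fin by (simp add: cycle_minima_def)

lemma set_concat_standard_cycle_form: "set (concat (standard_cycle_form V w)) = V"
proof -
  have "set (concat (standard_cycle_form V w)) = (\<Union>m\<in>cycle_minima V w. orbit w m)"
    unfolding standard_cycle_form_altdef set_concat set_map[of "support w"]
    by (simp only: image_image set_support set_sorted_list_of_set[OF finite_cycle_minima])
  also have "\<dots> = V"
  proof
    show "(\<Union>m\<in>cycle_minima V w. orbit w m) \<subseteq> V"
      using orbit_subset by (auto simp: cycle_minima_def)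
    show "V \<subseteq> (\<Union>m\<in>cycle_minima V w. orbit w m)"
    proof
      fix v assume v: "v \<in> V"
      have f: "finite (orbit w v)" "orbit w v \<noteq> {}"
        using orbit_subset[OF v] fin finite_subset self_in_orbit by blast+
      let ?m = "Min (orbit w v)"
      have m: "?m \<in> orbit w v" using f by (rule Min_in)
      then have "orbit w ?m = orbit w v" by (rule orbit_eq)
      then have "?m \<in> cycle_minima V w" "v \<in> orbit w ?m"
        using m orbit_subset[OF v] f self_in_orbit by (auto simp: cycle_minima_def)
      then show "v \<in> (\<Union>m\<in>cycle_minima V w. orbit w m)" by blast
    qed
  qed
  finally show ?thesis .
qed

text \<open>Two minima in a common orbit would each be at most the other.\<close>

lemma distinct_concat_standard_cycle_form: "distinct (concat (standard_cycle_form V w))"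
proof -
  have disj: "orbit w m \<inter> orbit w m' = {}"
    if "m \<in> cycle_minima V w" "m' \<in> cycle_minima V w" "m \<noteq> m'" for m m'
  proof (rule ccontr)
    assume "orbit w m \<inter> orbit w m' \<noteq> {}"
    then obtain x where "x \<in> orbit w m" "x \<in> orbit w m'" by blast
    then have "orbit w m = orbit w m'" using orbit_eq by metis
    then have "m \<in> orbit w m'" "m' \<in> orbit w m" using self_in_orbit by auto
    then have "m \<le> m'" "m' \<le> m" using that(1,2) by (simp_all add: cycle_minima_def)
    then show False using that(3) by simp
  qed
  have inj: "inj_on (support w) (cycle_minima V w)"
    by (rule inj_on_inverseI[of _ hd]) (rule cyclic_list_support(2)[OF permutation])
  show ?thesis
    unfolding standard_cycle_form_altdef
  proof (rule distinct_concat)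
    show "distinct (map (support w) (sorted_list_of_set (cycle_minima V w)))"
      using inj finite_cycle_minima by (simp only: distinct_map) simp
    show "distinct c" if "c \<in> set (map (support w) (sorted_list_of_set (cycle_minima V w)))" for c
      using that cycle_of_permutation[OF permutation] unfolding set_map by blast
    show "set c \<inter> set d = {}"
      if cd: "c \<in> set (map (support w) (sorted_list_of_set (cycle_minima V w)))"
        "d \<in> set (map (support w) (sorted_list_of_set (cycle_minima V w)))" "c \<noteq> d" for c d
    proof -
      obtain m m' where "m \<in> cycle_minima V w" "m' \<in> cycle_minima V w"
        "c = support w m" "d = support w m'"
        using cd(1,2) unfolding set_map[of "support w"]
          set_sorted_list_of_set[OF finite_cycle_minima] by blast
      moreover from this have "m \<noteq> m'" using cd(3) by blast
      ultimately show ?thesis using disj by (simp only: set_support)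
    qed
  qed
qed

lemma standard_cycle_form_nonempty: "c \<in> set (standard_cycle_form V w) \<Longrightarrow> c \<noteq> []"
  using cyclic_list_support(1)[OF permutation]
  by (auto simp only: standard_cycle_form_altdef set_map cyclic_list_def)

text \<open>Excludes one-letter cycles, the only ones for which a deletion gives the unit instead of
  zero.\<close>

lemma standard_cycle_form_length:
  assumes "\<And>v. v \<in> V \<Longrightarrow> w v \<noteq> v" "c \<in> set (standard_cycle_form V w)"
  shows "set c \<noteq> {v}"
proof
  assume v: "set c = {v}"
  obtain m where m: "m \<in> V" "c = support w m"
    using assms(2) finite_cycle_minima
    by (auto simp: standard_cycle_form_def cycle_minima_def)
  then have "orbit w m = {v}" using v set_support by simp
  then have "w m = m" using self_in_orbit orbit.base by (metis singletonD)
  then show False using assms(1) m(1) by blast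
qed

end

section \<open>The element of a permutation as a product of cycle values\<close>

definition star_order :: "'a::linorder list list \<Rightarrow> 'a list" where
  "star_order cs = rev (sorted_list_of_set (star_letters cs))"

lemma set_star_order: "set (star_order cs) = (\<Union>c\<in>set cs. set (tl c))"
  by (simp add: star_order_def star_letters_def)

lemma phi_complete_eq_fold:
  fixes V w
  defines "cs \<equiv> standard_cycle_form V w"
  shows "phi_complete V w =
    word_product (map snd (fold eval_star (star_order cs) (letter_quantities (concat cs))))"
  by (simp add: phi_complete_def Let_def word_product_def star_order_def cs_def)

lemma hd_notin_star_letters:
  assumes "distinct (concat cs)" "[] \<notin> set cs" "c \<in> set cs"
  shows "hd c \<notin> (\<Union>d\<in>set cs. set (tl d))"
  using assms
proof (induction cs)
  case (Cons d cs)
  then have d: "d \<noteq> []" "distinct d" "set d \<inter> set (concat cs) = {}" by auto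
  then have hd_d: "hd d \<notin> set (tl d)" by (cases d) auto
  have tl: "set (tl e) \<subseteq> set e" for e :: "'a list" by (cases e) auto
  show ?case
  proof (cases "c = d")
    case True
    have "hd d \<in> set d" using d(1) by simp
    then show ?thesis
      using True hd_d d(3) tl by fastforce
  next
    case False
    then have "c \<in> set cs" using Cons.prems by simp
    moreover from this have "hd c \<in> set (concat cs)"
      using Cons.prems(2) by (metis hd_in_set in_set_conv_nth list.set_intros(2) UN_I set_concat)
    ultimately show ?thesis
      using Cons tl d(3) by fastforce
  qed
qed simp

lemma phi_complete_eq_cycle_values:
  assumes "finite V" "w permutes V" "standard_cycle_form V w = cs"
  shows "phi_complete V w = word_product (map (cycle_value (star_order cs)) cs)"
proof -
  have cs: "distinct (concat cs)" "[] \<notin> set cs"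
    using distinct_concat_standard_cycle_form[OF assms(1,2)]
      standard_cycle_form_nonempty[OF assms(1,2)] assms(3) by auto
  have "fold eval_star (star_order cs) (letter_quantities (concat cs)) =
      map (\<lambda>c. (hd c, cycle_value (star_order cs) c)) cs"
    using cs hd_notin_star_letters[OF cs]
    by (intro fold_eval_star_concat) (auto simp: set_star_order)
  then show ?thesis
    by (simp add: phi_complete_eq_fold assms(3) comp_def)
qed

text \<open>The cycle containing \<open>v\<close> has at least two letters, so deleting
  \<open>v\<close> kills its value and with it the product. This holds before any letters are
  identified, hence the projection is a cycle for every graph on \<open>V\<close>.\<close>

lemma phi_complete_closed:
  assumes fin: "finite V" and w: "w permutes V" and derang: "\<And>v. v \<in> V \<Longrightarrow> w v \<noteq> v"
  shows "phi_complete V w \<in> word_chains V"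
    and "v \<in> V \<Longrightarrow> remove_letter v (phi_complete V w) = 0"
proof -
  define cs where "cs = standard_cycle_form V w"
  let ?L = "star_order cs"
  have cs: "distinct (concat cs)" "set (concat cs) = V" "\<And>c. c \<in> set cs \<Longrightarrow> c \<noteq> []"
    unfolding cs_def
    using distinct_concat_standard_cycle_form[OF fin w] set_concat_standard_cycle_form[OF fin w]
      standard_cycle_form_nonempty[OF fin w] by auto
  have phi: "phi_complete V w = word_product (map (cycle_value ?L) cs)"
    by (rule phi_complete_eq_cycle_values[OF fin w]) (simp add: cs_def)
  have nc: "nearly_closed (set c) (cycle_value ?L c)" if "c \<in> set cs" for c
    using that cs by (intro nearly_closed_cycle_value) (auto simp: set_star_order distinct_concat_iff)
  then have wc: "cycle_value ?L c \<in> word_chains (set c)" if "c \<in> set cs" for c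
    using that unfolding nearly_closed_def by blast
  show "phi_complete V w \<in> word_chains V"
    unfolding phi using word_product_word_chains[OF cs(1) wc] unfolding cs(2) by blast
  show "remove_letter v (phi_complete V w) = 0" if v: "v \<in> V"
  proof -
    obtain c where c: "c \<in> set cs" "v \<in> set c" using v cs(2) by auto
    have "set c \<noteq> {v}"
      using standard_cycle_form_length[OF fin w derang] c(1) by (simp add: cs_def)
    then have "remove_letter v (cycle_value ?L c) = 0"
      using nc[OF c(1)] c(2) unfolding nearly_closed_def by simp
    then have "0 \<in> set (map (\<lambda>c. remove_letter v (cycle_value ?L c)) cs)"
      using c(1) by (auto simp: image_iff intro!: bexI[of _ c])
    moreover have "remove_letter v (word_product (map (cycle_value ?L) cs)) =
        word_product (map (\<lambda>c. remove_letter v (cycle_value ?L c)) cs)"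
      by (rule remove_letter_word_product[OF cs(1) wc])
    ultimately show ?thesis
      unfolding phi using word_product_zero by metis
  qed
qed

text \<open>Stars are taken in decreasing order, so a new largest letter is put in front and leaves
  the rest as it was.\<close>

lemma star_order_insert_max:
  assumes "(\<Union>c\<in>set cs'. set (tl c)) = insert t (\<Union>c\<in>set cs. set (tl c))"
    and "\<And>x. x \<in> (\<Union>c\<in>set cs. set (tl c)) \<Longrightarrow> x < t"
  shows "star_order cs' = t # star_order cs"
proof -
  let ?S = "\<Union>c\<in>set cs. set (tl c)"
  have "sorted_list_of_set (insert t ?S) = sorted_list_of_set ?S @ [t]"
  proof (rule sorted_list_of_set.idem_if_sorted_distinct[THEN subst])
    show "sorted (sorted_list_of_set ?S @ [t])"
      using assms(2) by (auto simp: sorted_append less_imp_le)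
    show "distinct (sorted_list_of_set ?S @ [t])"
      using assms(2) by auto
  qed simp
  then show ?thesis
    by (simp add: star_order_def star_letters_def assms(1))
qed

subsection \<open>Splitting a letter\<close>

text \<open>As a composition with a transposition the new map is visibly a permutation.\<close>

lemma split_letter_eq: "w t = t \<Longrightarrow> split_letter s t w = w \<circ> transpose s t"
  by (auto simp: split_letter_def fun_eq_iff transpose_def)

lemma add_two_cycle_eq: "w s = s \<Longrightarrow> w t = t \<Longrightarrow> add_two_cycle s t w = w \<circ> transpose s t"
  by (auto simp: add_two_cycle_def fun_eq_iff transpose_def)

lemma split_letter_permutes:
  assumes "w permutes V - {t}" "s \<in> V" "t \<in> V"
  shows "split_letter s t w permutes V"
proof -
  have "w t = t" using assms(1) by (simp add: permutes_not_in)
  moreover have "w permutes V" using assms(1) by (rule permutes_subset) auto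
  ultimately show ?thesis
    using permutes_compose[OF permutes_swap_id[OF assms(2,3)]] by (simp add: split_letter_eq)
qed

lemma add_two_cycle_permutes:
  assumes "w permutes V - {s, t}" "s \<in> V" "t \<in> V"
  shows "add_two_cycle s t w permutes V"
proof -
  have "w s = s" "w t = t" using assms(1) by (simp_all add: permutes_not_in)
  moreover have "w permutes V" using assms(1) by (rule permutes_subset) auto
  ultimately show ?thesis
    using permutes_compose[OF permutes_swap_id[OF assms(2,3)]] by (simp add: add_two_cycle_eq)
qed

lemma hd_expand: "u \<noteq> [] \<Longrightarrow> hd (expand s [s, t] u) = hd u"
  by (cases u) auto

lemma last_expand: "u \<noteq> [] \<Longrightarrow> last (expand s [s, t] u) = (if last u = s then t else last u)"
  by (cases u rule: rev_cases) auto

lemma expand_eq_Nil [simp]: "expand s [s, t] u = [] \<longleftrightarrow> u = []"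
  by (cases u) auto

text \<open>Inserting \<open>t\<close> behind \<open>s\<close> only changes the steps around
  \<open>s\<close>. If \<open>s\<close> was last, the new last letter is \<open>t\<close>, which is
  sent on to the old image of \<open>s\<close>.\<close>

lemma cyclic_list_expand:
  assumes u: "cyclic_list w u" and t: "t \<notin> set u" and "s \<noteq> t"
  shows "cyclic_list (split_letter s t w) (expand s [s, t] u)"
proof -
  have "successively (\<lambda>a b. b = split_letter s t w a) (expand s [s, t] v)"
    if "successively (\<lambda>a b. b = w a) v" "t \<notin> set v" for v
    using that
  proof (induction v)
    case (Cons a v)
    then show ?case
      using assms(3)
      by (cases "v = []") (auto simp: successively_Cons hd_expand split_letter_def)
  qed simp
  moreover have "distinct (expand s [s, t] u)"
    using u t assms(3) by (intro distinct_expand) (auto simp: cyclic_list_def)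
  moreover have "split_letter s t w (last (expand s [s, t] u)) = hd u"
  proof -
    have "last u \<noteq> t" using u t by (auto simp: cyclic_list_def)
    then show ?thesis
      using u assms(3) by (auto simp: last_expand cyclic_list_def split_letter_def)
  qed
  ultimately show ?thesis
    using u t by (auto simp: cyclic_list_def hd_expand)
qed

context
  fixes V :: "'a::linorder set" and s t
  assumes finite_V: "finite V" and s: "s \<in> V" and t: "t \<in> V" and st_less: "s < t"
    and max: "\<And>v. v \<in> V \<Longrightarrow> v \<le> t"
begin

text \<open>\<open>t\<close> joins the cycle of the smaller letter \<open>s\<close>, so it is not a
  cycle minimum, and being maximal it does not affect the other comparisons. The minima, and with
  them the arrangement of the cycles, stay the same.\<close>

lemma standard_cycle_form_split_letter:
  assumes w: "w permutes V - {t}"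
  shows "standard_cycle_form V (split_letter s t w) =
    map (expand s [s, t]) (standard_cycle_form (V - {t}) w)"
proof -
  let ?w = "split_letter s t w"
  have fin: "finite (V - {t})" using finite_V by simp
  note w_perm = permutation[OF fin w]
  have w': "?w permutes V" by (rule split_letter_permutes[OF w s t])
  have cyc: "support ?w m = expand s [s, t] (support w m)"
      "orbit ?w m = set (expand s [s, t] (support w m))" if m: "m \<in> V - {t}" for m
  proof -
    have "t \<notin> set (support w m)"
      using set_support[OF fin w] orbit_subset[OF fin w m] by blast
    then have "cyclic_list ?w (expand s [s, t] (support w m))"
      using st_less by (intro cyclic_list_expand cyclic_list_support(1)[OF w_perm]) auto
    moreover have "hd (expand s [s, t] (support w m)) = m"
      using hd_expand cyclic_list_support[OF w_perm, of m] by (metis cyclic_list_def)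
    ultimately show "support ?w m = expand s [s, t] (support w m)"
      "orbit ?w m = set (expand s [s, t] (support w m))"
      using support_eq_cyclic_list orbit_eq_cyclic_list by metis+
  qed
  have t_not: "t \<notin> cycle_minima V ?w"
  proof
    assume "t \<in> cycle_minima V ?w"
    then have le: "\<forall>x\<in>orbit ?w t. t \<le> x" by (simp add: cycle_minima_def)
    have "s \<in> V - {t}" using s st_less by auto
    then have "t \<in> orbit ?w s"
      using self_in_orbit[OF fin w, of s] set_support[OF fin w, of s] cyc(2)
      by (auto simp: set_expand)
    then have "s \<in> orbit ?w t"
      using orbit_swap self_in_orbit[OF finite_V w'] by metis
    then show False using le st_less by auto
  qed
  have "m \<in> cycle_minima V ?w \<longleftrightarrow> m \<in> cycle_minima (V - {t}) w" if m: "m \<in> V - {t}" for m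
  proof -
    have "m \<le> t" using max m by blast
    then have "(\<forall>x\<in>orbit ?w m. m \<le> x) \<longleftrightarrow> (\<forall>x\<in>orbit w m. m \<le> x)"
      unfolding cyc(2)[OF m] set_expand set_support[OF fin w] by auto
    then show ?thesis using m by (simp add: cycle_minima_def)
  qed
  moreover have "cycle_minima V ?w \<subseteq> V" "cycle_minima (V - {t}) w \<subseteq> V - {t}"
    by (auto simp: cycle_minima_def)
  ultimately have minima: "cycle_minima V ?w = cycle_minima (V - {t}) w"
    using t_not by blast
  have "map (support ?w) (sorted_list_of_set (cycle_minima (V - {t}) w)) =
      map (expand s [s, t]) (map (support w) (sorted_list_of_set (cycle_minima (V - {t}) w)))"
    unfolding map_map
  proof (rule map_cong[OF refl])
    fix m assume "m \<in> set (sorted_list_of_set (cycle_minima (V - {t}) w))"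
    then have "m \<in> V - {t}"
      using finite_cycle_minima[OF fin w] by (simp add: cycle_minima_def)
    then show "support ?w m = (expand s [s, t] \<circ> support w) m"
      using cyc(1) by (simp only: comp_apply)
  qed
  then show ?thesis
    by (simp only: standard_cycle_form_altdef minima)
qed

text \<open>The star before \<open>t\<close> joins \<open>s\<close> and \<open>t\<close> to
  \<open>st + ts\<close>, the blow-up of the letter \<open>s\<close>; all other letters are fixed by
  the blow-up.\<close>

lemma eval_star_expand:
  assumes "distinct u" "t \<notin> set u"
  shows "eval_star t (letter_quantities (expand s [s, t] u)) =
    map (apsnd (blow_up s t)) (letter_quantities u)"
  using assms
proof (induction u)
  case (Cons a u)
  have bu: "blow_up s t (basis_elt [b]) = basis_elt [b]" if "b \<noteq> s" "b \<noteq> t" for b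
    using that by (simp add: blow_up_basis)
  show ?case
  proof (cases "a = s")
    case True
    then have "s \<notin> set u" using Cons.prems by simp
    moreover from this have "map (apsnd (blow_up s t)) (letter_quantities u) = letter_quantities u"
      using Cons.prems by (auto intro!: bu)
    moreover have "blow_up s t (basis_elt [s]) = diamond (basis_elt [s]) (basis_elt [t])"
      using st_less by (simp add: blow_up_basis diamond_def concat_prod_basis)
    ultimately show ?thesis
      using True by (simp add: expand_notin)
  next
    case False
    \<comment> \<open>The expansion of \<open>u\<close> starts with the head of \<open>u\<close> and
      thus not with \<open>t\<close>, so the star right after \<open>a\<close> is not the one
      evaluated.\<close>
    have "eval_star t ((a, Q) # letter_quantities (expand s [s, t] u)) =
        (a, Q) # eval_star t (letter_quantities (expand s [s, t] u))" for Q
    proof (cases "expand s [s, t] u")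
      case (Cons b v)
      then have "b = hd u" using hd_expand[of u s t] by (cases u) auto
      moreover have "u \<noteq> []" using Cons by auto
      ultimately have "b \<noteq> t" using \<open>t \<notin> set (a # u)\<close> by auto
      then show ?thesis using Cons by simp
    qed simp
    moreover have "blow_up s t (basis_elt [a]) = basis_elt [a]"
      using False Cons.prems(2) by (intro bu) auto
    ultimately show ?thesis
      using False Cons by simp
  qed
qed simp

text \<open>After the star at \<open>t\<close>, both evaluations run through the same stars in the
  same order, and the blow-up respects \<open>diamond\<close> and products.\<close>

lemma phi_complete_split_letter:
  assumes w: "w permutes V - {t}"
  shows "phi_complete V (split_letter s t w) = blow_up s t (phi_complete (V - {t}) w)"
proof -
  define cs where "cs = standard_cycle_form (V - {t}) w"
  have fin: "finite (V - {t})" using finite_V by simp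
  have cs: "distinct (concat cs)" "set (concat cs) = V - {t}" "\<And>c. c \<in> set cs \<Longrightarrow> c \<noteq> []"
    unfolding cs_def
    using distinct_concat_standard_cycle_form[OF fin w] set_concat_standard_cycle_form[OF fin w]
      standard_cycle_form_nonempty[OF fin w] by auto
  let ?cs' = "map (expand s [s, t]) cs"
  have cs': "standard_cycle_form V (split_letter s t w) = ?cs'"
    unfolding cs_def by (rule standard_cycle_form_split_letter[OF w])
  have concat: "concat ?cs' = expand s [s, t] (concat cs)"
    by (induction cs) simp_all
  have st_ne: "s \<noteq> t" using st_less by simp
  have tl_expand: "set (tl (expand s [s, t] c)) = set (tl c) \<union> (if s \<in> set c then {t} else {})"
    if "c \<in> set cs" for c
  proof (cases c)
    case (Cons a u)
    moreover have "distinct c" using that cs(1) by (auto simp: distinct_concat_iff)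
    ultimately show ?thesis
      by (auto simp: set_expand)
  qed simp
  obtain c where c: "c \<in> set cs" "s \<in> set c"
    using cs(2) s st_less by (metis Diff_iff UN_E singletonD set_concat less_irrefl)
  have "(\<Union>c\<in>set ?cs'. set (tl c)) = insert t (\<Union>c\<in>set cs. set (tl c))"
    using tl_expand c by (auto split: if_splits)
  moreover have "x < t" if x: "x \<in> (\<Union>c\<in>set cs. set (tl c))" for x
  proof -
    obtain d where "d \<in> set cs" "x \<in> set (tl d)" using x by blast
    then have "x \<in> V - {t}" using cs(2) list.set_sel(2)[of d x] cs(3) by auto
    then show ?thesis using max by fastforce
  qed
  ultimately have order: "star_order ?cs' = t # star_order cs"
    by (rule star_order_insert_max)
  have "phi_complete V (split_letter s t w) =
      word_product (map snd (fold eval_star (star_order cs)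
        (eval_star t (letter_quantities (expand s [s, t] (concat cs))))))"
    unfolding phi_complete_eq_fold cs' order concat by simp
  also have "eval_star t (letter_quantities (expand s [s, t] (concat cs))) =
      map (apsnd (blow_up s t)) (letter_quantities (concat cs))"
    by (rule eval_star_expand) (use cs in auto)
  also have "fold eval_star (star_order cs) \<dots> =
      map (apsnd (blow_up s t)) (fold eval_star (star_order cs) (letter_quantities (concat cs)))"
    by (rule fold_eval_star_map) (rule blow_up_diamond[OF st_ne])
  also have "map snd \<dots> = map (blow_up s t)
      (map snd (fold eval_star (star_order cs) (letter_quantities (concat cs))))"
    by simp
  also have "word_product \<dots> = blow_up s t (phi_complete (V - {t}) w)"
    unfolding phi_complete_eq_fold by (simp only: blow_up_word_product[OF st_ne] cs_def)
  finally show ?thesis .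
qed

text \<open>Cycles are sorted by their minima, so \<open>[s, t]\<close> is inserted between those
  with minimum below \<open>s\<close> and those above. The other cycles persist, as the two
  permutations agree on them.\<close>

lemma standard_cycle_form_add_two_cycle:
  assumes w: "w permutes V - {s, t}"
  obtains A B where "standard_cycle_form (V - {s, t}) w = A @ B"
    "standard_cycle_form V (add_two_cycle s t w) = A @ [s, t] # B"
proof -
  let ?w = "add_two_cycle s t w"
  let ?M = "cycle_minima (V - {s, t}) w"
  have fin: "finite (V - {s, t})" using finite_V by simp
  note w_perm = permutation[OF fin w]
  have w': "?w permutes V" by (rule add_two_cycle_permutes[OF w s t])
  have "cyclic_list ?w [s, t]"
    using st_less by (simp add: cyclic_list_def add_two_cycle_def)
  then have st_cyc: "support ?w s = [s, t]" "orbit ?w s = {s, t}"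
    using support_eq_cyclic_list[of ?w "[s, t]"] orbit_eq_cyclic_list[of ?w "[s, t]"] by simp_all
  have cyc: "support ?w m = support w m" "orbit ?w m = orbit w m" if m: "m \<in> V - {s, t}" for m
  proof -
    have sub: "set (support w m) \<subseteq> V - {s, t}"
      using set_support[OF fin w] orbit_subset[OF fin w m] by blast
    have agree: "?w x = w x" if "x \<in> set (support w m)" for x
      using that sub by (auto simp: add_two_cycle_def)
    have cl: "cyclic_list w (support w m)" by (rule cyclic_list_support(1)[OF w_perm])
    have "cyclic_list ?w (support w m)"
      unfolding cyclic_list_def
    proof (intro conjI)
      show ne: "support w m \<noteq> []" and "distinct (support w m)"
        using cl unfolding cyclic_list_def by blast+
      have "successively (\<lambda>a b. b = w a) (support w m)"
        using cl by (simp only: cyclic_list_def)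
      then show "successively (\<lambda>a b. b = ?w a) (support w m)"
        by (rule successively_mono) (simp only: agree)
      have "last (support w m) \<in> set (support w m)"
        using ne by (rule last_in_set)
      then show "?w (last (support w m)) = hd (support w m)"
        using agree cl by (simp only: cyclic_list_def)
    qed
    then show "support ?w m = support w m" "orbit ?w m = orbit w m"
      using support_eq_cyclic_list orbit_eq_cyclic_list cyclic_list_support(2)[OF w_perm]
        set_support[OF fin w] by metis+
  qed
  have "t \<notin> cycle_minima V ?w"
  proof
    assume "t \<in> cycle_minima V ?w"
    moreover have "s \<in> orbit ?w t"
      using orbit_swap[of s ?w t] st_cyc(2) by simp
    ultimately show False using st_less by (auto simp: cycle_minima_def)
  qed
  moreover have "s \<in> cycle_minima V ?w"
    using s st_cyc(2) st_less by (simp add: cycle_minima_def)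
  moreover have "m \<in> cycle_minima V ?w \<longleftrightarrow> m \<in> ?M" if "m \<in> V - {s, t}" for m
    using that cyc(2)[OF that] by (simp add: cycle_minima_def)
  moreover have "cycle_minima V ?w \<subseteq> V" "?M \<subseteq> V - {s, t}"
    by (auto simp: cycle_minima_def)
  ultimately have minima: "cycle_minima V ?w = insert s ?M" by blast
  have s_less: "m < s \<or> s < m" if "m \<in> ?M" for m
    using that by (auto simp: cycle_minima_def neq_iff)
  let ?A = "filter (\<lambda>m. m < s) (sorted_list_of_set ?M)"
  let ?B = "filter (\<lambda>m. s < m) (sorted_list_of_set ?M)"
  have finM: "finite ?M" by (rule finite_cycle_minima[OF fin w])
  have AB: "sorted_list_of_set ?M = ?A @ ?B"
  proof (rule sorted_distinct_set_unique)
    show "sorted (?A @ ?B)"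
      by (auto simp: sorted_append intro: sorted_wrt_filter)
    show "set (sorted_list_of_set ?M) = set (?A @ ?B)"
      using finM s_less by (auto simp: set_insort_key)
  qed auto
  have AsB: "sorted_list_of_set (insert s ?M) = ?A @ s # ?B"
  proof (rule sorted_distinct_set_unique)
    show "sorted (?A @ s # ?B)"
      by (auto simp: sorted_append intro: sorted_wrt_filter)
    show "set (sorted_list_of_set (insert s ?M)) = set (?A @ s # ?B)"
      using finM s_less by (auto simp: set_insort_key)
  qed auto
  have same: "map (support ?w) xs = map (support w) xs" if "set xs \<subseteq> ?M" for xs
  proof (rule map_cong[OF refl])
    fix m assume "m \<in> set xs"
    then have "m \<in> V - {s, t}" using that by (auto simp: cycle_minima_def)
    then show "support ?w m = support w m" by (rule cyc(1))
  qed
  show ?thesis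
  proof (rule that)
    show "standard_cycle_form (V - {s, t}) w = map (support w) ?A @ map (support w) ?B"
      unfolding standard_cycle_form_altdef map_append[symmetric] by (simp only: AB[symmetric])
    have "map (support ?w) ?A = map (support w) ?A" "map (support ?w) ?B = map (support w) ?B"
      using finM by (intro same; auto)+
    then show "standard_cycle_form V ?w = map (support w) ?A @ [s, t] # map (support w) ?B"
      unfolding standard_cycle_form_altdef minima AsB map_append list.map st_cyc(1)
      by (simp only:)
  qed
qed

lemma cycle_value_Cons_notin:
  "t \<notin> set c \<Longrightarrow> cycle_value (t # L) c = cycle_value L c"
proof -
  assume "t \<notin> set c"
  then have "t \<notin> fst ` set (tl (letter_quantities c))"
    by (cases c) auto
  then show ?thesis by (simp add: cycle_value_def eval_star_notin)
qed

text \<open>The preimage \<open>z\<close> has the one-letter cycle \<open>[s]\<close> in place of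
  \<open>[s, t]\<close>. Blowing up that factor gives \<open>st + ts\<close>; deleting
  \<open>s\<close> turns it into the unit, which drops out of the product.\<close>

lemma phi_complete_add_two_cycle:
  assumes w: "w permutes V - {s, t}"
  obtains z where "z \<in> word_chains (V - {t})"
    "phi_complete V (add_two_cycle s t w) = blow_up s t z"
    "remove_letter s z = phi_complete (V - {s, t}) w"
proof -
  have fin: "finite (V - {s, t})" using finite_V by simp
  obtain A B where AB: "standard_cycle_form (V - {s, t}) w = A @ B"
    "standard_cycle_form V (add_two_cycle s t w) = A @ [s, t] # B"
    using standard_cycle_form_add_two_cycle[OF w] .
  have cs: "distinct (concat (A @ B))" "set (concat (A @ B)) = V - {s, t}"
    "\<And>c. c \<in> set (A @ B) \<Longrightarrow> c \<noteq> []"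
    using distinct_concat_standard_cycle_form[OF fin w] set_concat_standard_cycle_form[OF fin w]
      standard_cycle_form_nonempty[OF fin w] unfolding AB(1) by blast+
  let ?L = "star_order (A @ B)"
  have order: "star_order (A @ [s, t] # B) = t # ?L"
  proof (rule star_order_insert_max)
    show "(\<Union>c\<in>set (A @ [s, t] # B). set (tl c)) = insert t (\<Union>c\<in>set (A @ B). set (tl c))" by auto
    fix x assume "x \<in> (\<Union>c\<in>set (A @ B). set (tl c))"
    then obtain d where "d \<in> set (A @ B)" "x \<in> set (tl d)" by blast
    then have "x \<in> set (concat (A @ B))" using list.set_sel(2)[of d x] cs(3) by fastforce
    then have "x \<in> V - {s, t}" unfolding cs(2) .
    then show "x < t" using max by fastforce
  qed
  have phi_w: "phi_complete (V - {s, t}) w = word_product (map (cycle_value ?L) (A @ B))"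
    by (rule phi_complete_eq_cycle_values[OF fin w AB(1)])
  have wc: "cycle_value ?L c \<in> word_chains (set c)" if "c \<in> set (A @ B)" for c
    using that cs by (intro cycle_value_word_chains) (auto simp: set_star_order distinct_concat_iff)
  have notin: "s \<notin> set c" "t \<notin> set c" if "c \<in> set (A @ B)" for c
  proof -
    have "set c \<subseteq> set (concat (A @ B))" using that by auto
    then show "s \<notin> set c" "t \<notin> set c" unfolding cs(2) by auto
  qed
  let ?z = "word_product (map (cycle_value ?L) (A @ [s] # B))"
  have dist: "distinct (concat (A @ [s] # B))"
    using cs(1) notin(1) by auto
  have wc_s: "cycle_value ?L c \<in> word_chains (set c)" if "c \<in> set (A @ [s] # B)" for c
    using that wc word_chains_basis[of "[s]"] by (auto simp: cycle_value_singleton simp del: mem_Collect_eq)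
  have "set (concat (A @ [s] # B)) = insert s (set (concat (A @ B)))" by auto
  also have "\<dots> = V - {t}" unfolding cs(2) using s st_less by auto
  finally have "?z \<in> word_chains (V - {t})"
    using word_product_word_chains[OF dist wc_s] by (simp only:)
  moreover have "phi_complete V (add_two_cycle s t w) = blow_up s t ?z"
  proof -
    have st_value: "cycle_value (t # ?L) [s, t] = blow_up s t (basis_elt [s])"
    proof -
      \<comment> \<open>After the star at \<open>t\<close> a single quantity is left, which the
        remaining stars do not affect.\<close>
      have "fold eval_star L [(s, Q)] = [(s, Q)]" for L Q
        by (induction L) auto
      then show ?thesis
        using st_less by (simp add: cycle_value_def blow_up_basis diamond_def concat_prod_basis)
    qed
    have "cycle_value (t # ?L) c = blow_up s t (cycle_value ?L c)" if "c \<in> set (A @ B)" for c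
      unfolding cycle_value_Cons_notin[OF notin(2)[OF that]]
        blow_up_notin[OF wc[OF that] notin(1)[OF that] notin(2)[OF that]] ..
    then have "map (cycle_value (t # ?L)) (A @ [s, t] # B) =
        map (blow_up s t) (map (cycle_value ?L) (A @ [s] # B))"
      by (simp add: st_value cycle_value_singleton)
    moreover have "s \<noteq> t" using st_less by simp
    ultimately show ?thesis
      unfolding phi_complete_eq_cycle_values[OF finite_V add_two_cycle_permutes[OF w s t] AB(2)]
        order by (simp only: blow_up_word_product[OF \<open>s \<noteq> t\<close>])
  qed
  moreover have "remove_letter s ?z = phi_complete (V - {s, t}) w"
  proof -
    have "remove_letter s (cycle_value ?L c) = cycle_value ?L c" if "c \<in> set (A @ B)" for c
      using remove_letter_notin[OF wc[OF that] notin(1)[OF that]] .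
    then have "map (\<lambda>c. remove_letter s (cycle_value ?L c)) (A @ [s] # B) =
        map (cycle_value ?L) A @ basis_elt [] # map (cycle_value ?L) B"
      by (simp add: cycle_value_singleton)
    moreover have "remove_letter s ?z =
        word_product (map (\<lambda>c. remove_letter s (cycle_value ?L c)) (A @ [s] # B))"
      by (rule remove_letter_word_product[OF dist]) (rule wc_s)
    ultimately show ?thesis
      unfolding phi_w by (simp only: word_product_one map_append)
  qed
  ultimately show ?thesis using that by blast
qed

end

section \<open>The recursion for derangements\<close>

text \<open>
  Giving the empty graph its unique permutation makes the case of a single edge an instance of the
  general recursion.
\<close>

definition derangements :: "'a::linorder graph \<Rightarrow> ('a \<Rightarrow> 'a) set" where
  "derangements G = (if verts G = {} then {id} else derangement_set G)"

lemma max_edge: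
  assumes G: "ordered_graph G" and ne: "neighbours G (max_vertex G) \<noteq> {}"
  shows "{max_neighbour G, max_vertex G} \<in> edges G"
    and "v \<in> verts G \<Longrightarrow> v \<le> max_vertex G"
    and "max_neighbour G < max_vertex G"
proof -
  have fin: "finite (verts G)" using G by (simp add: ordered_graph_def)
  then have "finite (neighbours G (max_vertex G))" by (simp add: neighbours_def)
  then have "max_neighbour G \<in> neighbours G (max_vertex G)"
    unfolding max_neighbour_def using ne by (rule Max_in)
  then have *: "max_neighbour G \<in> verts G" "{max_neighbour G, max_vertex G} \<in> edges G"
    by (simp_all add: neighbours_def)
  then show "{max_neighbour G, max_vertex G} \<in> edges G" by simp
  show max: "v \<le> max_vertex G" if "v \<in> verts G" for v
    using that fin by (simp add: max_vertex_def)
  have "max_neighbour G \<noteq> max_vertex G"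
    using *(2) G by (auto simp: ordered_graph_def)
  then show "max_neighbour G < max_vertex G"
    using max[OF *(1)] by simp
qed

lemma derangements_isolated:
  assumes "verts G \<noteq> {}" "neighbours G (max_vertex G) = {}"
  shows "derangements G = {}"
  using assms by (simp add: derangements_def derangement_set.simps[of G] Let_def)

text \<open>With only two vertices, deletion and contraction have an isolated maximal vertex and
  contribute nothing, while the permutation \<open>id\<close> of the empty extraction yields the
  transposition.\<close>

lemma derangements_rec:
  assumes G: "ordered_graph G" and ne: "neighbours G (max_vertex G) \<noteq> {}"
    and s: "s = max_neighbour G" and t: "t = max_vertex G"
  shows "derangements G = derangements (deletion G s t)
    \<union> split_letter s t ` derangements (contraction G s t)
    \<union> add_two_cycle s t ` derangements (extraction G s t)"
proof -
  have edge: "{s, t} \<in> edges G" using max_edge(1)[OF G ne] s t by simp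
  have st: "s \<in> verts G" "t \<in> verts G" "s \<noteq> t"
    using edge G by (auto simp: ordered_graph_def)
  have verts: "verts (deletion G s t) = verts G" "verts (contraction G s t) = verts G - {t}"
    "verts (extraction G s t) = verts G - {s, t}"
    by (simp_all add: deletion_def contraction_def extraction_def)
  have rec: "derangement_set G = (if verts G = {s, t} then {transpose s t}
      else derangement_set (deletion G s t)
           \<union> split_letter s t ` derangement_set (contraction G s t)
           \<union> add_two_cycle s t ` derangement_set (extraction G s t))"
    using G ne st(1) by (subst derangement_set.simps) (auto simp: Let_def s t)
  have G_eq: "derangements G = derangement_set G"
    using st(1) by (auto simp: derangements_def)
  show ?thesis
  proof (cases "verts G = {s, t}")
    case True
    have no_loop: "{v} \<notin> edges H" if "ordered_graph H" for v :: 'a and H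
      using that by (auto simp: ordered_graph_def)
    have "neighbours (deletion G s t) (max_vertex (deletion G s t)) = {}"
    proof -
      have "max_vertex (deletion G s t) = t"
        unfolding max_vertex_def verts(1) using t by (simp add: max_vertex_def)
      then show ?thesis
        using True no_loop[OF G] by (auto simp: neighbours_def deletion_def)
    qed
    then have del: "derangements (deletion G s t) = {}"
      using st by (intro derangements_isolated) (auto simp: verts)
    have "neighbours (contraction G s t) (max_vertex (contraction G s t)) = {}"
    proof -
      have "verts (contraction G s t) = {s}" using True st verts by auto
      moreover from this have "max_vertex (contraction G s t) = s" by (simp add: max_vertex_def)
      ultimately show ?thesis
        using no_loop[OF ordered_graph_contraction[OF G edge]] by (auto simp: neighbours_def)
    qed
    then have con: "derangements (contraction G s t) = {}"
      using st by (intro derangements_isolated) (auto simp: verts)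
    have "derangements (extraction G s t) = {id}"
      using True by (simp add: derangements_def verts)
    moreover have "add_two_cycle s t id = transpose s t"
      by (simp add: add_two_cycle_def transpose_def fun_eq_iff)
    ultimately show ?thesis
      using G_eq rec True del con by simp
  next
    case False
    then have "verts G - {s, t} \<noteq> {}" "verts G - {t} \<noteq> {}" "verts G \<noteq> {}"
      using st by auto
    then show ?thesis
      using G_eq rec False by (simp add: derangements_def verts)
  qed
qed

text \<open>Uses the measure from the termination of \<open>derangement_set\<close>: deletion keeps
  the vertices and loses an edge, the other two operations lose vertices.\<close>

lemma graph_cases_induct [consumes 1, case_names empty isolated step]:
  assumes G: "ordered_graph G"
    and empty: "\<And>G. verts G = {} \<Longrightarrow> ordered_graph G \<Longrightarrow> P G"
    and isolated: "\<And>G. ordered_graph G \<Longrightarrow> verts G \<noteq> {} \<Longrightarrow>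
      neighbours G (max_vertex G) = {} \<Longrightarrow> P G"
    and edge: "\<And>G s t. ordered_graph G \<Longrightarrow> {s, t} \<in> edges G \<Longrightarrow> s < t \<Longrightarrow>
      (\<And>v. v \<in> verts G \<Longrightarrow> v \<le> t) \<Longrightarrow>
      derangements G = derangements (deletion G s t)
        \<union> split_letter s t ` derangements (contraction G s t)
        \<union> add_two_cycle s t ` derangements (extraction G s t) \<Longrightarrow>
      P (deletion G s t) \<Longrightarrow> P (contraction G s t) \<Longrightarrow> P (extraction G s t) \<Longrightarrow> P G"
  shows "P G"
  using G
proof (induction G rule: wf_induct_rule[OF wf_measures[of "[\<lambda>G. card (verts G), \<lambda>G. card (edges G)]"]])
  case (1 G)
  consider "verts G = {}" | "verts G \<noteq> {}" "neighbours G (max_vertex G) = {}"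
    | "verts G \<noteq> {}" "neighbours G (max_vertex G) \<noteq> {}" by blast
  then show ?case
  proof cases
    case 1
    then show ?thesis using empty \<open>ordered_graph G\<close> by blast
  next
    case 2
    then show ?thesis using isolated \<open>ordered_graph G\<close> by blast
  next
    case 3
    let ?s = "max_neighbour G" and ?t = "max_vertex G"
    note G = \<open>ordered_graph G\<close>
    note me = max_edge[OF G 3(2)]
    have fin: "finite (verts G)" "edges G \<subseteq> Pow (verts G)"
      using G by (auto simp: ordered_graph_def)
    have st: "?s \<in> verts G" "?t \<in> verts G" using me(1) fin by auto
    have "finite (edges G)" using fin by (meson finite_Pow_iff finite_subset)
    then have "card (edges G - {{?s, ?t}}) < card (edges G)"
      using me(1) by (rule card_Diff1_less)
    then have "P (deletion G ?s ?t)"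
      by (intro "1.IH" ordered_graph_deletion G) (simp add: deletion_def)
    moreover have "card (verts G - {?t}) < card (verts G)"
      using fin(1) st(2) by (rule card_Diff1_less)
    then have "P (contraction G ?s ?t)"
      by (intro "1.IH" ordered_graph_contraction G me) (simp add: contraction_def)
    moreover have "card (verts G - {?s, ?t}) < card (verts G)"
      using fin(1) st by (intro psubset_card_mono) auto
    then have "P (extraction G ?s ?t)"
      by (intro "1.IH" ordered_graph_extraction G) (simp add: extraction_def)
    ultimately show ?thesis
      using edge[OF G me(1,3,2) derangements_rec[OF G 3(2) refl refl]] by blast
  qed
qed

lemma derangements_derange:
  assumes "ordered_graph G" "w \<in> derangements G"
  shows "w permutes verts G \<and> (\<forall>v\<in>verts G. w v \<noteq> v)"
  using assms
proof (induction G arbitrary: w rule: graph_cases_induct)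
  case (empty G)
  then show ?case by (auto simp: derangements_def permutes_def)
next
  case (isolated G)
  then show ?case by (simp add: derangements_isolated)
next
  case (step G s t)
  interpret graph_edge G s t by unfold_locales (rule step)+
  consider "w \<in> derangements G_del"
    | w' where "w' \<in> derangements G_con" "w = split_letter s t w'"
    | w' where "w' \<in> derangements G_ext" "w = add_two_cycle s t w'"
    using step(5,9) by blast
  then show ?case
  proof cases
    case 1
    then show ?thesis using step(6) by simp
  next
    case 2
    then have w': "w' permutes verts G - {t}" "\<And>v. v \<in> verts G - {t} \<Longrightarrow> w' v \<noteq> v"
      using step(7) by auto
    \<comment> \<open>The new permutation sends \<open>t\<close> to \<open>w' s\<close>, so this
      inequality says that \<open>t\<close> is not fixed.\<close>
    have "w' s \<noteq> t"
      using permutes_in_image[OF w'(1), of s] st by auto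
    then show ?thesis
      using w' split_letter_permutes[OF w'(1) st(2,3)] st 2(2) by (auto simp: split_letter_def)
  next
    case 3
    then have w': "w' permutes verts G - {s, t}" "\<And>v. v \<in> verts G - {s, t} \<Longrightarrow> w' v \<noteq> v"
      using step(8) by auto
    then show ?thesis
      using add_two_cycle_permutes[OF w'(1) st(2,3)] st 3(2) by (auto simp: add_two_cycle_def)
  qed
qed

section \<open>Cycles from derangements, and the base cases of the induction\<close>

lemma phi_complete_derangements:
  assumes G: "ordered_graph G" and w: "w \<in> derangements G"
  shows "phi_complete (verts G) w \<in> word_chains (verts G)" "phi G w \<in> top_homology G"
proof -
  have fin: "finite (verts G)" using G by (simp add: ordered_graph_def)
  have w': "w permutes verts G" "\<And>v. v \<in> verts G \<Longrightarrow> w v \<noteq> v"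
    using derangements_derange[OF G w] by auto
  show wc: "phi_complete (verts G) w \<in> word_chains (verts G)"
    by (rule phi_complete_closed(1)[OF fin w'])
  have "project_chain G (remove_letter v (phi_complete (verts G) w)) = 0" if "v \<in> verts G" for v
    using phi_complete_closed(2)[OF fin w' that] by simp
  then show "phi G w \<in> top_homology G"
    unfolding phi_def project_chain_top_homology_iff[OF G wc] by blast
qed

text \<open>An isolated \<open>t\<close> commutes with all letters, so deleting it from a word on
  all vertices loses nothing. The partial boundary at \<open>t\<close> is therefore injective on top
  chains, and only 0 is a cycle.\<close>

lemma top_homology_isolated:
  assumes G: "ordered_graph G" and t: "t \<in> verts G" "neighbours G t = {}"
  shows "top_homology G = {0}"
proof
  have no_edge: "{u, t} \<notin> edges G" for u
    using t G by (auto simp: neighbours_def ordered_graph_def)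
  have no_edge': "{t, u} \<notin> edges G" for u
    using no_edge[of u] by (simp add: insert_commute)
  show "top_homology G \<subseteq> {0}"
  proof
    fix c assume c: "c \<in> top_homology G"
    obtain a where a: "a \<in> word_chains (verts G)" "c = project_chain G a"
      using top_homologyE[OF G c] .
    then have "project_chain G (remove_letter t a) = 0"
      using c t(1) project_chain_top_homology_iff[OF G a(1)] by blast
    then have "partial_boundary G t c = 0"
      using partial_boundary_project_chain[OF word_chains_words[OF subset_refl a(1)]] a(2) by simp
    moreover have "inj_on (delete_letter G t) (word_class G ` permutations_of_set (verts G))"
    proof (rule inj_onI, clarify)
      fix u v
      assume uv: "u \<in> permutations_of_set (verts G)" "v \<in> permutations_of_set (verts G)"
        and eq: "delete_letter G t (word_class G u) = delete_letter G t (word_class G v)"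
      have w: "u \<in> words G" "v \<in> words G"
        using uv permutations_of_set_words[of "verts G" G] by blast+
      then have rw: "removeAll t u \<in> words G" "removeAll t v \<in> words G"
        by (auto simp: words_def distinct_removeAll)
      have "same_order (edges G) (removeAll t u) (removeAll t v)"
        using eq word_class_eq_iff[OF rw] by (simp only: delete_letter_word_class w)
      moreover have "a \<noteq> t \<and> b \<noteq> t" if "{a, b} \<in> edges G" for a b
        using that no_edge no_edge' by blast
      moreover have "set u = set v" using uv by (auto dest: permutations_of_setD)
      ultimately have "same_order (edges G) u v"
        unfolding same_order_def before_removeAll by blast
      then show "word_class G u = word_class G v"
        using word_class_eq_iff[OF w] by blast
    qed
    moreover have "keys c \<subseteq> word_class G ` permutations_of_set (verts G)"
      using keys_project_chain[of a "permutations_of_set (verts G)" G] a by simp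
    ultimately have "c = 0"
      unfolding partial_boundary_def using linear_ext_inj_eq_0 by blast
    then show "c \<in> {0}" by simp
  qed
  show "{0} \<subseteq> top_homology G"
    by (simp add: top_homology_def chains_def boundary_def)
qed

lemma basis_family_empty: "basis_family f {} {0}"
  by (simp add: basis_family_def)

text \<open>In degree minus one the chains are spanned by the empty word, and the boundary is an
  empty sum.\<close>

lemma basis_family_empty_graph:
  fixes G :: "'a::linorder graph"
  assumes "ordered_graph G" "verts G = {}"
  shows "basis_family (phi G) {id} (top_homology G)"
proof -
  let ?e = "basis_elt (word_class G [])"
  have "standard_cycle_form {} (id :: 'a \<Rightarrow> 'a) = []"
    by (simp add: standard_cycle_form_def)
  then have "phi G id = ?e"
    using assms(2) by (simp add: phi_def phi_complete_def Let_def star_letters_def)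
  moreover have "top_homology G = {0, ?e}"
  proof -
    have "c = 0 \<or> c = ?e" if "keys c \<subseteq> {word_class G []}" for c
    proof (cases "word_class G [] \<in> keys c")
      case True
      then have "keys (?e + c) = {}" using that by (subst keys_basis_add) auto
      then have "?e + c = 0" by (simp only: keys_eq_empty)
      then show ?thesis unfolding bit_chain_add_eq_0_iff by simp
    next
      case False
      then have "keys c = {}" using that by blast
      then show ?thesis by simp
    qed
    moreover have "boundary G c = 0" for c using assms(2) by (simp add: boundary_def)
    moreover have "chains G (int (card (verts G)) - 1) = {c. keys c \<subseteq> {word_class G []}}"
      unfolding chains_def boolean_rank_top[OF assms(1)] using assms(2) by simp
    ultimately show ?thesis unfolding top_homology_def by auto
  qed
  moreover have "?e \<noteq> 0"
    by (metis lookup_single_eq lookup_zero zero_neq_one)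
  moreover have "Pow {id :: 'a \<Rightarrow> 'a} = {{}, {id}}" by blast
  ultimately show ?thesis
    by (auto simp: basis_family_def subset_singleton_iff)
qed

lemma basis_family_phi:
  assumes "ordered_graph G"
  shows "basis_family (phi G) (derangements G) (top_homology G)"
  using assms
proof (induction G rule: graph_cases_induct)
  case (empty G)
  then show ?case
    using basis_family_empty_graph[of G] by (simp add: derangements_def)
next
  case (isolated G)
  then have "max_vertex G \<in> verts G"
    by (simp add: max_vertex_def ordered_graph_def)
  then show ?case
    using isolated top_homology_isolated[of G "max_vertex G"]
    by (simp add: derangements_isolated basis_family_empty)
next
  case (step G s t)
  interpret graph_edge G s t by unfold_locales (rule step)+
  let ?V = "verts G"
  have fin: "finite ?V" using graph by (simp add: ordered_graph_def)
  note setting = fin st(2,3) step(3,4)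
  have con_perm: "w permutes ?V - {t}" if "w \<in> derangements G_con" for w
    using derangements_derange[OF graph_con that] by simp
  have ext_perm: "w permutes ?V - {s, t}" if "w \<in> derangements G_ext" for w
    using derangements_derange[OF graph_ext that] by simp
  have "basis_family (\<lambda>w. project_chain G (phi_complete ?V w))
    (derangements G_del \<union> split_letter s t ` derangements G_con
      \<union> add_two_cycle s t ` derangements G_ext) (top_homology G)"
  proof (rule basis_family_deletion_contraction_extraction)
    show "basis_family (\<lambda>w. project_chain G_del (phi_complete ?V w)) (derangements G_del)
        (top_homology G_del)"
      using step(6) by (simp add: phi_def[abs_def])
    show "basis_family (\<lambda>w. project_chain G_con (phi_complete (?V - {t}) w)) (derangements G_con)
        (top_homology G_con)"
      using step(7) by (simp add: phi_def[abs_def])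
    show "basis_family (\<lambda>w. project_chain G_ext (phi_complete (?V - {s, t}) w)) (derangements G_ext)
        (top_homology G_ext)"
      using step(8) by (simp add: phi_def[abs_def])
  next
    fix w assume w: "w \<in> derangements G_del"
    \<comment> \<open>The same permutation occurs in the recursion for \<open>G\<close>, so its word
      chain projects to a cycle of \<open>G\<close> lying over the one in the deletion.\<close>
    then have "w \<in> derangements G" using step(5) by blast
    then show "phi_complete ?V w \<in> word_chains ?V"
      "project_chain G (phi_complete ?V w) \<in> top_homology G"
      using phi_complete_derangements[OF graph] by (simp_all only: phi_def)
  next
    fix w assume w: "w \<in> derangements G_con"
    show "phi_complete (?V - {t}) w \<in> word_chains (?V - {t})"
      using phi_complete_derangements(1)[OF graph_con w] by simp
    show "phi_complete ?V (split_letter s t w) = blow_up s t (phi_complete (?V - {t}) w)"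
      by (rule phi_complete_split_letter[OF setting con_perm[OF w]])
  next
    fix w assume w: "w \<in> derangements G_ext"
    then have "add_two_cycle s t w \<in> derangements G" using step(5) by blast
    then show "project_chain G (phi_complete ?V (add_two_cycle s t w)) \<in> top_homology G"
      using phi_complete_derangements(2)[OF graph] by (simp only: phi_def)
    show "\<exists>z\<in>word_chains (?V - {t}). phi_complete ?V (add_two_cycle s t w) = blow_up s t z \<and>
        remove_letter s z = phi_complete (?V - {s, t}) w"
      using phi_complete_add_two_cycle[OF setting ext_perm[OF w]] by blast
  qed
  then show ?case
    unfolding step(5)[symmetric] by (simp add: phi_def[abs_def])
qed

theorem theorem5p2:
  fixes G :: "'a::linorder graph"
  assumes "ordered_graph G" and "verts G \<noteq> {}"
  shows "is_basis (phi G ` derangement_set G) (top_homology G)"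
  using is_basis_basis_family[OF basis_family_phi[OF assms(1)]] assms(2)
  by (simp add: derangements_def)

end
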